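(* For $h>0$ sufficiently small let $(\alpha^*,\gamma^* )$, $\gamma^*=(\gamma_0^{\top},\dots,\gamma_{s-1}^{\top})^\top$, be the unique solution with $|\alpha|\le c\,h^2$ of the system $$\alpha=\frac{N(\alpha,\gamma)}{D(\alpha,\gamma)},\qquad\gamma=\Psi(\alpha,\gamma)$$ defined in the context (general case with invariant $C$, respectively Hamiltonian case), and let $y_1=y_0+h\gamma_0$ be the approximation to $y(h)$ provided by the corresponding $s$-stage EQUIP method, where $y(t)$ solves $\dot y=f(y)$, $y(0)=y_0$. Assume that $$f_0^\top\left((g_0')^\top f_0'-(g_0'f_0')^\top\right)f_0-\left(g_0''(f_0,f_0)\right)^\top f_0\neq0$$ in the general case, respectively $\left[f_0''(f_0,f_0)\right]^\top Jf_0\ne0$ in the Hamiltonian case, so that $D$ is bounded away from zero in a neighbourhood of $(0,\bar\gamma)$, with $\bar\gamma$ the solution of $\gamma=\Psi(0,\gamma)$. Then, as $h\to0^+$, $$y_1-y(h)=O(h^{2s+1}),$$ i.e., the method has order $2s$.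
   Context: The problem is $\dot y=f(y)$, $y(0)=y_0\in\mathbb{R}^m$, with $f:\mathbb{R}^m\to\mathbb{R}^m$ analytic and Lipschitz continuous. General case: $C:\mathbb{R}^m\to\mathbb{R}$ is analytic with $\nabla C(y)^\top f(y)=0$ for all $y$. Hamiltonian case: $m=2d$, $f=J\nabla H$ with $H$ analytic and $J=\begin{pmatrix}O_d&I_d\\-I_d&O_d\end{pmatrix}$. Notation: $f_0=f(y_0)$, $f_0'=f'(y_0)$ (Jacobian), $f_0''=f''(y_0)$ (second derivative, an $\mathbb{R}^m$-valued bilinear map); $g=\nabla C$, $g_0'=g'(y_0)$, $g_0''=g''(y_0)$; $c>0$ is a given constant. Fix an integer $s\ge2$. $\{P_j\}_{j\ge0}$ are the Legendre polynomials orthonormal on $[0,1]$ ($\deg P_j=j$, positive leading coefficient). $c_1<\dots<c_s$ are the zeros of $P_s$ and $b_i=\int_0^1\prod_{j\ne i}\frac{x-c_j}{c_i-c_j}dx$. $\mathcal{P}_s\in\mathbb{R}^{s\times s}$ has $(i,j)$ entry $P_{j-1}(c_i)$; $\mathcal{I}_s\in\mathbb{R}^{s\times s}$ has $(i,j)$ entry $\int_0^{c_i}P_{j-1}(x)dx$; $\Omega=\mathrm{diag}(b_1,\dots,b_s)$. With $\xi_i=\frac{1}{2\sqrt{|4i^2-1|}}$, $X_s$ is the $s\times s$ tridiagonal matrix with $(1,1)$ entry $\xi_0$, all other diagonal entries $0$, $(i+1,i)$ entry $\xi_i$ and $(i,i+1)$ entry $-\xi_i$, $i=1,\dots,s-1$.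 $W_s=e_2e_1^\top-e_1e_2^\top$, $\mathbf 1=(1,\dots,1)^\top\in\mathbb{R}^s$, $(\phi_{i0},\dots,\phi_{i,s-1})^\top=X_s^{-1}e_i$, $i=1,2$. The $s$-stage EQUIP method is the Runge-Kutta method with Butcher matrix $A(\alpha)=\mathcal{P}_s(X_s-\alpha W_s)\mathcal{P}_s^\top\Omega$ and weights $b_i$, with stages $Y_i$ and $\alpha$ determined at each step by the equation $\alpha=N/D$ below; in terms of $\gamma_j=\sum_ib_iP_j(c_i)f(Y_i)$, $\gamma=(\gamma_0^\top,\dots,\gamma_{s-1}^\top)^\top$, the stage equations are equivalent to $\gamma=\Psi(\alpha,\gamma)$ with $$\Psi(\alpha,\gamma)=(\mathcal{P}_s^\top\Omega\otimes I_m)\,f\big(\mathbf 1\otimes y_0+h((\mathcal{I}_s-\alpha\mathcal{P}_sW_s)\otimes I_m)\gamma\big)$$ ($f$ applied blockwise), and $y_1=y_0+h\sum_ib_if(Y_i)=y_0+h\gamma_0$. Given $(\alpha,\gamma)$ define, for $c,t\in[0,1]$, $$\sigma_1(ch)=y_0+h\sum_{j=0}^{s-1}\int_0^cP_j(x)dx\,[\gamma_j-\alpha(\phi_{2j}\gamma_0-\phi_{1j}\gamma_1)],\qquad\sigma_2(t)=y_0+h\gamma_0+(t-1)\alpha h(\phi_{20}\gamma_0-\phi_{10}\gamma_1).$$ General case: with $\rho_j(\sigma_1)=\int_0^1P_j(c)\nabla C(\sigma_1(ch))dc$ and $\bar\rho(\sigma_2)=\int_0^1\nabla C(\sigma_2(c))dc$,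 $$N=\sum_{j=0}^{s-1}\rho_j(\sigma_1)^\top\gamma_j,\qquad D=(\rho_0(\sigma_1)-\bar\rho(\sigma_2))^\top(\phi_{20}\gamma_0-\phi_{10}\gamma_1)+\sum_{j=1}^{s-1}\rho_j(\sigma_1)^\top(\phi_{2j}\gamma_0-\phi_{1j}\gamma_1).$$ Hamiltonian case: with $\gamma_j(\sigma_1)=\int_0^1P_j(c)f(\sigma_1(ch))dc$ and $\bar\gamma(\sigma_2)=\int_0^1f(\sigma_2(c))dc$, $$N=\sum_{j=0}^{s-1}\gamma_j(\sigma_1)^\top J\gamma_j,\qquad D=(\gamma_0(\sigma_1)-\bar\gamma(\sigma_2))^\top J(\phi_{20}\gamma_0-\phi_{10}\gamma_1)+\sum_{j=1}^{s-1}\gamma_j(\sigma_1)^\top J(\phi_{2j}\gamma_0-\phi_{1j}\gamma_1).$$ *)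

theory Defs
  imports
    "HOL-Analysis.Analysis"
    "HOL-Computational_Algebra.Polynomial"
    "HOL-Library.Landau_Symbols"
    "Jordan_Normal_Form.Gauss_Jordan_Elimination"
begin

no_notation Matrix.vec_index (infixl \<open>$\<close> 100)
no_notation Matrix.scalar_prod (infix \<open>\<bullet>\<close> 70)

text \<open>
  Vectors of the phase space have type \<open>real ^ 'm\<close>; the \<open>s \<times> s\<close> matrices of the method are
  matrices of the Jordan-Normal-Form library, whose indices start at \<open>0\<close>.  All stage indices are
  therefore shifted by one: \<open>c i\<close> and \<open>weight s c i\<close>, for \<open>i < s\<close>, are the node \<open>c\<^bsub>i+1\<^esub>\<close> and the
  weight \<open>b\<^bsub>i+1\<^esub>\<close>.  The indices of the Legendre polynomials \<open>P\<close>, of the coefficients \<open>\<gamma>\<close> and of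
  \<open>\<phi>\<^bsub>ij\<^esub>\<close> are not shifted.
\<close>

definition real_analytic :: "(real ^ 'm \<Rightarrow> 'b::real_normed_vector) \<Rightarrow> bool" where
  "real_analytic f \<longleftrightarrow>
     (\<forall>z. \<exists>r>0. \<exists>a :: ('m \<Rightarrow> nat) \<Rightarrow> 'b. \<forall>x\<in>ball z r.
        ((\<lambda>k. (\<Prod>i\<in>UNIV. (x $ i - z $ i) ^ k i) *\<^sub>R a k) has_sum f x) UNIV)"

definition gradient :: "('a::real_inner \<Rightarrow> real) \<Rightarrow> 'a \<Rightarrow> 'a" where
  "gradient C x = (THE g. GDERIV C x :> g)"

definition second_derivative ::
    "('a::real_normed_vector \<Rightarrow> 'b::real_normed_vector) \<Rightarrow> 'a \<Rightarrow> 'a \<Rightarrow> 'a \<Rightarrow> 'b" where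
  "second_derivative f x u v =
     frechet_derivative (\<lambda>z. frechet_derivative f (at z) v) (at x) u"

definition solves_ivp ::
    "('a::real_normed_vector \<Rightarrow> 'a) \<Rightarrow> 'a \<Rightarrow> (real \<Rightarrow> 'a) \<Rightarrow> bool" where
  "solves_ivp f y0 y \<longleftrightarrow>
     y 0 = y0 \<and> (\<forall>t\<ge>0. (y has_vector_derivative f (y t)) (at t within {0..}))"

text \<open>Coordinates indexed by \<open>Inl\<close> are the first \<open>d\<close> ones, those indexed by \<open>Inr\<close> the last \<open>d\<close>.\<close>

definition symplectic_J :: "real ^ ('d + 'd) ^ ('d::finite + 'd)" where
  "symplectic_J = (\<chi> i j. case (i, j) of
       (Inl k, Inr l) \<Rightarrow> if k = l then 1 else 0
     | (Inr k, Inl l) \<Rightarrow> if k = l then -1 else 0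
     | _ \<Rightarrow> 0)"

definition orthonormal_legendre :: "(nat \<Rightarrow> real poly) \<Rightarrow> bool" where
  "orthonormal_legendre P \<longleftrightarrow>
     (\<forall>j. degree (P j) = j \<and> lead_coeff (P j) > 0) \<and>
     (\<forall>i j. integral {0..1} (\<lambda>x. poly (P i) x * poly (P j) x) = (if i = j then 1 else 0))"

definition gauss_nodes :: "(nat \<Rightarrow> real poly) \<Rightarrow> nat \<Rightarrow> (nat \<Rightarrow> real) \<Rightarrow> bool" where
  "gauss_nodes P s c \<longleftrightarrow>
     strict_mono_on {..<s} c \<and> c ` {..<s} = {x. poly (P s) x = 0}"

definition weight :: "nat \<Rightarrow> (nat \<Rightarrow> real) \<Rightarrow> nat \<Rightarrow> real" where
  "weight s c i =
     integral {0..1} (\<lambda>x. \<Prod>j\<in>{..<s} - {i}. (x - c j) / (c i - c j))"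

definition P_mat :: "(nat \<Rightarrow> real poly) \<Rightarrow> nat \<Rightarrow> (nat \<Rightarrow> real) \<Rightarrow> real mat" where
  "P_mat P s c = mat s s (\<lambda>(i, j). poly (P j) (c i))"

definition I_mat :: "(nat \<Rightarrow> real poly) \<Rightarrow> nat \<Rightarrow> (nat \<Rightarrow> real) \<Rightarrow> real mat" where
  "I_mat P s c = mat s s (\<lambda>(i, j). integral {0..c i} (poly (P j)))"

definition Omega_mat :: "nat \<Rightarrow> (nat \<Rightarrow> real) \<Rightarrow> real mat" where
  "Omega_mat s c = mat s s (\<lambda>(i, j). if i = j then weight s c i else 0)"

definition xi :: "nat \<Rightarrow> real" where
  "xi i = 1 / (2 * sqrt \<bar>4 * (real i)\<^sup>2 - 1\<bar>)"

definition X_mat :: "nat \<Rightarrow> real mat" where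
  "X_mat s = mat s s (\<lambda>(i, j).
     if i = 0 \<and> j = 0 then xi 0
     else if i = j + 1 then xi i
     else if j = i + 1 then - xi j
     else 0)"

definition W_mat :: "nat \<Rightarrow> real mat" where
  "W_mat s = mat s s (\<lambda>(i, j).
     if i = 1 \<and> j = 0 then 1 else if i = 0 \<and> j = 1 then -1 else 0)"

text \<open>\<open>phi s i j\<close> is used for \<open>i \<in> {1, 2}\<close> and \<open>j < s\<close>; \<open>unit_vec s (i - 1)\<close> is \<open>e\<^sub>i\<close>.\<close>

definition phi :: "nat \<Rightarrow> nat \<Rightarrow> nat \<Rightarrow> real" where
  "phi s i j = vec_index (the (mat_inverse (X_mat s)) *\<^sub>v unit_vec s (i - 1)) j"

text \<open>
  A block vector \<open>\<gamma> = (\<gamma>\<^sub>0, \<dots>, \<gamma>\<^bsub>s-1\<^esub>)\<close> is a function \<open>nat \<Rightarrow> real ^ 'm\<close> of which only the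
  values below \<open>s\<close> matter, and \<open>(M \<otimes> I\<^sub>m) \<gamma>\<close> has the blocks \<open>\<Sum>\<^sub>k M\<^bsub>ik\<^esub> \<gamma>\<^sub>k\<close>.
\<close>

definition kron_apply :: "real mat \<Rightarrow> (nat \<Rightarrow> real ^ 'm) \<Rightarrow> nat \<Rightarrow> real ^ 'm" where
  "kron_apply M \<gamma> i = (\<Sum>k<dim_col M. (M $$ (i, k)) *\<^sub>R \<gamma> k)"

definition Psi :: "(nat \<Rightarrow> real poly) \<Rightarrow> nat \<Rightarrow> (nat \<Rightarrow> real) \<Rightarrow> (real ^ 'm \<Rightarrow> real ^ 'm) \<Rightarrow>
    real ^ 'm \<Rightarrow> real \<Rightarrow> real \<Rightarrow> (nat \<Rightarrow> real ^ 'm) \<Rightarrow> nat \<Rightarrow> real ^ 'm" where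
  "Psi P s c f y0 h \<alpha> \<gamma> =
     kron_apply (transpose_mat (P_mat P s c) * Omega_mat s c)
       (\<lambda>i. f (y0 + h *\<^sub>R kron_apply (I_mat P s c - \<alpha> \<cdot>\<^sub>m (P_mat P s c * W_mat s)) \<gamma> i))"

definition dir :: "nat \<Rightarrow> (nat \<Rightarrow> real ^ 'm) \<Rightarrow> nat \<Rightarrow> real ^ 'm" where
  "dir s \<gamma> j = phi s 2 j *\<^sub>R \<gamma> 0 - phi s 1 j *\<^sub>R \<gamma> 1"

text \<open>\<open>sigma1 P s y0 h \<alpha> \<gamma> x\<close> is the value of the path \<open>\<sigma>\<^sub>1\<close> at time \<open>x * h\<close>, for \<open>x \<in> [0,1]\<close>.\<close>

definition sigma1 :: "(nat \<Rightarrow> real poly) \<Rightarrow> nat \<Rightarrow> real ^ 'm \<Rightarrow> real \<Rightarrow> real \<Rightarrow>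
    (nat \<Rightarrow> real ^ 'm) \<Rightarrow> real \<Rightarrow> real ^ 'm" where
  "sigma1 P s y0 h \<alpha> \<gamma> x =
     y0 + h *\<^sub>R (\<Sum>j<s. integral {0..x} (poly (P j)) *\<^sub>R (\<gamma> j - \<alpha> *\<^sub>R dir s \<gamma> j))"

definition sigma2 :: "nat \<Rightarrow> real ^ 'm \<Rightarrow> real \<Rightarrow> real \<Rightarrow>
    (nat \<Rightarrow> real ^ 'm) \<Rightarrow> real \<Rightarrow> real ^ 'm" where
  "sigma2 s y0 h \<alpha> \<gamma> t = y0 + h *\<^sub>R \<gamma> 0 + ((t - 1) * \<alpha> * h) *\<^sub>R dir s \<gamma> 0"

text \<open>
  With \<open>F = gradient C\<close> these are \<open>\<rho>\<^sub>j(\<sigma>\<^sub>1)\<close> and the mean of \<open>\<nabla>C\<close> along \<open>\<sigma>\<^sub>2\<close>; with \<open>F = f\<close>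
  they are \<open>\<gamma>\<^sub>j(\<sigma>\<^sub>1)\<close> and the mean of \<open>f\<close> along \<open>\<sigma>\<^sub>2\<close>.
\<close>

definition coeff1 :: "(nat \<Rightarrow> real poly) \<Rightarrow> nat \<Rightarrow> (real ^ 'm \<Rightarrow> real ^ 'm) \<Rightarrow> real ^ 'm \<Rightarrow>
    real \<Rightarrow> real \<Rightarrow> (nat \<Rightarrow> real ^ 'm) \<Rightarrow> nat \<Rightarrow> real ^ 'm" where
  "coeff1 P s F y0 h \<alpha> \<gamma> j =
     integral {0..1} (\<lambda>x. poly (P j) x *\<^sub>R F (sigma1 P s y0 h \<alpha> \<gamma> x))"

definition mean2 :: "nat \<Rightarrow> (real ^ 'm \<Rightarrow> real ^ 'm) \<Rightarrow> real ^ 'm \<Rightarrow>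
    real \<Rightarrow> real \<Rightarrow> (nat \<Rightarrow> real ^ 'm) \<Rightarrow> real ^ 'm" where
  "mean2 s F y0 h \<alpha> \<gamma> = integral {0..1} (\<lambda>t. F (sigma2 s y0 h \<alpha> \<gamma> t))"

text \<open>
  Numerator and denominator of the equation for \<open>\<alpha>\<close>.  The general case is
  \<open>F = gradient C\<close>, \<open>B u v = u \<bullet> v\<close>, the Hamiltonian case is \<open>F = f\<close>, \<open>B u v = u \<bullet> (J *v v)\<close>.
\<close>

definition Numer :: "(nat \<Rightarrow> real poly) \<Rightarrow> nat \<Rightarrow> (real ^ 'm \<Rightarrow> real ^ 'm) \<Rightarrow>
    (real ^ 'm \<Rightarrow> real ^ 'm \<Rightarrow> real) \<Rightarrow> real ^ 'm \<Rightarrow> real \<Rightarrow> real \<Rightarrow> (nat \<Rightarrow> real ^ 'm) \<Rightarrow> real" where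
  "Numer P s F B y0 h \<alpha> \<gamma> = (\<Sum>j<s. B (coeff1 P s F y0 h \<alpha> \<gamma> j) (\<gamma> j))"

definition Denom :: "(nat \<Rightarrow> real poly) \<Rightarrow> nat \<Rightarrow> (real ^ 'm \<Rightarrow> real ^ 'm) \<Rightarrow>
    (real ^ 'm \<Rightarrow> real ^ 'm \<Rightarrow> real) \<Rightarrow> real ^ 'm \<Rightarrow> real \<Rightarrow> real \<Rightarrow> (nat \<Rightarrow> real ^ 'm) \<Rightarrow> real" where
  "Denom P s F B y0 h \<alpha> \<gamma> =
     B (coeff1 P s F y0 h \<alpha> \<gamma> 0 - mean2 s F y0 h \<alpha> \<gamma>) (dir s \<gamma> 0) +
     (\<Sum>j\<in>{1..<s}. B (coeff1 P s F y0 h \<alpha> \<gamma> j) (dir s \<gamma> j))"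

text \<open>Since \<open>x / 0 = 0\<close> in HOL, the quotient needs an explicitly nonzero denominator.\<close>

definition equip_system :: "(nat \<Rightarrow> real poly) \<Rightarrow> nat \<Rightarrow> (nat \<Rightarrow> real) \<Rightarrow>
    (real ^ 'm \<Rightarrow> real ^ 'm) \<Rightarrow> (real ^ 'm \<Rightarrow> real ^ 'm) \<Rightarrow> (real ^ 'm \<Rightarrow> real ^ 'm \<Rightarrow> real) \<Rightarrow>
    real ^ 'm \<Rightarrow> real \<Rightarrow> real \<Rightarrow> (nat \<Rightarrow> real ^ 'm) \<Rightarrow> bool" where
  "equip_system P s c f F B y0 h \<alpha> \<gamma> \<longleftrightarrow>
     Denom P s F B y0 h \<alpha> \<gamma> \<noteq> 0 \<and>
     \<alpha> = Numer P s F B y0 h \<alpha> \<gamma> / Denom P s F B y0 h \<alpha> \<gamma> \<and>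
     (\<forall>j<s. \<gamma> j = Psi P s c f y0 h \<alpha> \<gamma> j)"

definition unique_equip_solution :: "(nat \<Rightarrow> real poly) \<Rightarrow> nat \<Rightarrow> (nat \<Rightarrow> real) \<Rightarrow> real \<Rightarrow>
    (real ^ 'm \<Rightarrow> real ^ 'm) \<Rightarrow> (real ^ 'm \<Rightarrow> real ^ 'm) \<Rightarrow> (real ^ 'm \<Rightarrow> real ^ 'm \<Rightarrow> real) \<Rightarrow>
    real ^ 'm \<Rightarrow> real \<Rightarrow> real \<Rightarrow> (nat \<Rightarrow> real ^ 'm) \<Rightarrow> bool" where
  "unique_equip_solution P s c K f F B y0 h \<alpha> \<gamma> \<longleftrightarrow>
     \<bar>\<alpha>\<bar> \<le> K * h\<^sup>2 \<and> equip_system P s c f F B y0 h \<alpha> \<gamma> \<and>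
     (\<forall>\<alpha>' \<gamma>'. \<bar>\<alpha>'\<bar> \<le> K * h\<^sup>2 \<and> equip_system P s c f F B y0 h \<alpha>' \<gamma>' \<longrightarrow>
        \<alpha>' = \<alpha> \<and> (\<forall>j<s. \<gamma>' j = \<gamma> j))"

end

theory Submission
  imports Defs
begin

text \<open>
  Write \<open>S\<close> for the polynomial path \<open>y0 + h \<Sum> (\<integral>\<^sub>0\<^sup>x P\<^sub>j) \<gamma>\<^sub>j\<close> and \<open>Z = S - \<alpha> h (P\<^sub>1 \<gamma>\<^sub>0 - \<gamma>\<^sub>1)\<close>,
  so that the stages are the values of \<open>Z\<close> at the Gauss nodes.  Near \<open>y0\<close> we replace \<open>f\<close> and \<open>C\<close> by
  Taylor polynomials of high degree.  Then \<open>f(Z)\<close> is a polynomial in \<open>x\<close> whose coefficient of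
  \<open>x\<^sup>k\<close> is \<open>O(h\<^sup>k)\<close>; hence \<open>\<gamma>\<^sub>j = O(h\<^sup>j)\<close>, and by Parseval together with the exactness of the Gauss
  quadrature \<open>\<integral> G S' = h \<integral> G f(Z) + O(h\<^bsup>2s+1\<^esup>)\<close> for every \<open>G\<close> with coefficients of the same kind.

  The equation for \<open>\<alpha>\<close> is equivalent to \<open>C(y\<^sub>1) = C(y0)\<close>.  Taking \<open>G = \<nabla>C(S)\<close> and using \<open>\<nabla>C \<bullet> f = 0\<close>
  along \<open>Z\<close>, this gives \<open>\<integral> (\<nabla>C(S) - \<nabla>C(Z)) \<bullet> f(Z) = O(h\<^bsup>2s\<^esup>)\<close>.  The left-hand side is
  \<open>\<alpha> h\<^sup>2 (\<xi> \<kappa> + O(h))\<close>, where \<open>\<xi> = \<integral> x P\<^sub>1 \<noteq> 0\<close> and \<open>\<kappa> = g''(f\<^sub>0, f\<^sub>0) \<bullet> f\<^sub>0\<close> is the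
  nondegeneracy constant (the Hessian \<open>g'\<close> is symmetric, so the other term of the hypothesis vanishes).
  Hence \<open>\<alpha> = O(h\<^bsup>2s-2\<^esup>)\<close>.  Taking for \<open>G\<close> the gradient of the truncated Lie series of a coordinate of
  the flow shows \<open>y\<^sub>1 - y(h) = O(\<alpha> h\<^sup>3) + O(h\<^bsup>2s+1\<^esup>)\<close>.  In the Hamiltonian case the system of
  equations is the one of the general case with \<open>C = H\<close>.
\<close>

subsection \<open>Partial derivatives and polynomial functions\<close>

text \<open>The hypotheses give, for each small h, a solution of the system, but no regularity of
  \<open>\<alpha>\<close> and \<open>\<gamma>\<close> in h, so neither can simply be expanded in h.
  Every estimate is therefore a Landau statement about coefficients in the stage variable x; the
  size condition in \<open>graded\<close> stands in for smooth dependence on the product of h and x.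
  Taylor polynomials make this workable: composed with a polynomial path they keep a degree bounded
  uniformly in h, so every functional becomes a finite sum of O-terms. The obstacle is that the a
  priori bound \<open>\<alpha>\<close> = O(h^2) is the required O(h^(2s-2)) only for s = 2. The
  drift identity has to be solved for \<open>\<alpha>\<close> although its error terms contain
  \<open>\<alpha>\<close>; they carry one more factor h than the leading term and can be absorbed.
  In the final O(\<open>\<alpha>\<close> h^3) the three powers have different origins: one is the
  factor of the skew term in Z, one is the step length, and one comes from integrating the skew term
  against a graded function.\<close>

definition partial :: "'m \<Rightarrow> (real ^ 'm::finite \<Rightarrow> real) \<Rightarrow> real ^ 'm \<Rightarrow> real" where
  "partial i f x = frechet_derivative f (at x) (axis i 1)"

lemma linear_sum_axis:
  fixes D :: "real ^ 'm::finite \<Rightarrow> real"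
  assumes "linear D"
  shows "D v = (\<Sum>i\<in>UNIV. D (axis i 1) * v $ i)"
proof -
  have "D v = D (\<Sum>i\<in>UNIV. v $ i *s axis i 1)"
    by (simp add: basis_expansion)
  also have "\<dots> = (\<Sum>i\<in>UNIV. D (v $ i *\<^sub>R axis i 1))"
    using assms by (simp add: linear_sum scalar_mult_eq_scaleR)
  also have "\<dots> = (\<Sum>i\<in>UNIV. D (axis i 1) * v $ i)"
    using assms by (simp add: linear_cmul mult.commute)
  finally show ?thesis .
qed

lemma differentiable_imp_partials:
  assumes "f differentiable (at x)"
  shows "(f has_derivative (\<lambda>v. \<Sum>i\<in>UNIV. partial i f x * v $ i)) (at x)"
proof -
  have d: "(f has_derivative frechet_derivative f (at x)) (at x)"
    using assms by (simp add: frechet_derivative_works)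
  then have "linear (frechet_derivative f (at x))"
    by (rule has_derivative_linear)
  from linear_sum_axis[OF this] have "frechet_derivative f (at x) = (\<lambda>v. \<Sum>i\<in>UNIV. partial i f x * v $ i)"
    unfolding partial_def by blast
  with d show ?thesis by simp
qed

lemma has_derivative_imp_partial:
  assumes "(f has_derivative D) (at x)"
  shows "partial i f x = D (axis i 1)"
  unfolding partial_def using frechet_derivative_at[OF assms] by simp

lemma partial_add:
  assumes "f differentiable (at x)" "g differentiable (at x)"
  shows "partial i (\<lambda>x. f x + g x) x = partial i f x + partial i g x"
  using has_derivative_imp_partial[OF has_derivative_add[OF differentiable_imp_partials[OF assms(1)]
      differentiable_imp_partials[OF assms(2)]]]
  by (simp add: axis_def if_distrib sum.delta cong: if_cong)

lemma partial_mult: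
  assumes "f differentiable (at x)" "g differentiable (at x)"
  shows "partial i (\<lambda>x. f x * g x) x = partial i f x * g x + f x * partial i g x"
  using has_derivative_imp_partial[OF has_derivative_mult[OF differentiable_imp_partials[OF assms(1)]
      differentiable_imp_partials[OF assms(2)]], of i]
  by (simp add: axis_def if_distrib sum.delta cong: if_cong)

lemma partial_linear: "bounded_linear f \<Longrightarrow> partial i f x = f (axis i 1)"
  by (rule has_derivative_imp_partial) (rule bounded_linear_imp_has_derivative)

lemma partial_const: "partial i (\<lambda>x. k) x = 0"
  by (rule has_derivative_imp_partial[OF has_derivative_const])

lemma partial_sum:
  assumes "finite A" "\<And>k. k \<in> A \<Longrightarrow> f k differentiable (at x)"
  shows "partial i (\<lambda>x. \<Sum>k\<in>A. f k x) x = (\<Sum>k\<in>A. partial i (f k) x)"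
  using assms
proof (induction A rule: finite_induct)
  case empty
  then show ?case by (simp add: partial_const)
next
  case (insert a A)
  have "(\<lambda>x. \<Sum>k\<in>A. f k x) differentiable (at x)"
    using insert by (intro differentiable_sum) auto
  with insert show ?case by (simp add: partial_add)
qed

lemma real_polynomial_differentiable:
  fixes f :: "real ^ 'm::finite \<Rightarrow> real"
  shows "real_polynomial_function f \<Longrightarrow> f differentiable (at x)"
  by (rule differentiable_at_real_polynomial_function)

lemma real_polynomial_partial:
  fixes f :: "real ^ 'm::finite \<Rightarrow> real"
  assumes "real_polynomial_function f"
  shows "real_polynomial_function (partial i f)"
  using assms
proof (induction rule: real_polynomial_function.induct)
  case (linear f)
  then have "partial i f = (\<lambda>x. f (axis i 1))" by (auto simp: partial_linear)
  then show ?case by (simp add: real_polynomial_function.intros(2))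
next
  case (const c)
  have "partial i (\<lambda>x. c) = (\<lambda>x. 0)" by (auto simp: partial_const)
  then show ?case by (simp add: real_polynomial_function.intros(2))
next
  case (add f g)
  then have "partial i (\<lambda>x. f x + g x) = (\<lambda>x. partial i f x + partial i g x)"
    by (intro ext partial_add real_polynomial_differentiable)
  with add show ?case by (simp add: real_polynomial_function.intros(3))
next
  case (mult f g)
  then have "partial i (\<lambda>x. f x * g x) = (\<lambda>x. partial i f x * g x + f x * partial i g x)"
    by (intro ext partial_mult real_polynomial_differentiable)
  with mult show ?case by (auto intro!: real_polynomial_function.intros(3,4))
qed

lemma real_polynomial_partial_commute:
  fixes f :: "real ^ 'm::finite \<Rightarrow> real"
  assumes "real_polynomial_function f"
  shows "partial i (partial j f) x = partial j (partial i f) x"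
  using assms
proof (induction arbitrary: x rule: real_polynomial_function.induct)
  case (linear f)
  then have "partial i f = (\<lambda>x. f (axis i 1))" for i by (auto simp: partial_linear)
  then show ?case by (simp add: partial_const)
next
  case (const c)
  have "partial i (\<lambda>x. c) = (\<lambda>x. 0)" for i :: 'm by (auto simp: partial_const)
  then show ?case by (simp add: partial_const)
next
  case (add f g)
  then have "partial i (\<lambda>x. f x + g x) = (\<lambda>x. partial i f x + partial i g x)" for i
    by (intro ext partial_add real_polynomial_differentiable)
  with add show ?case
    by (simp add: partial_add real_polynomial_differentiable real_polynomial_partial)
next
  case (mult f g)
  then have "partial i (\<lambda>x. f x * g x) = (\<lambda>x. partial i f x * g x + f x * partial i g x)" for i
    by (intro ext partial_mult real_polynomial_differentiable)
  with mult show ?case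
    by (simp add: partial_add partial_mult differentiable_mult real_polynomial_differentiable real_polynomial_partial)
qed

lemma real_polynomial_function_nth [simp]: "real_polynomial_function (\<lambda>x :: real ^ 'm. x $ i)"
  by (intro real_polynomial_function.intros(1) bounded_linear_vec_nth)

lemma real_polynomial_bounded:
  fixes f :: "real ^ 'm::finite \<Rightarrow> real"
  assumes "real_polynomial_function f"
  shows "\<exists>B\<ge>0. \<forall>x. norm x \<le> r \<longrightarrow> \<bar>f x\<bar> \<le> B"
proof -
  have "compact (f ` cball 0 r)"
    using assms by (intro compact_continuous_image continuous_at_imp_continuous_on ballI
        continuous_real_polymonial_function) auto
  then have "bounded (f ` cball 0 r)" by (rule compact_imp_bounded)
  then obtain B where "\<And>y. y \<in> f ` cball 0 r \<Longrightarrow> norm y \<le> B"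
    unfolding bounded_iff by blast
  then have "\<forall>x. norm x \<le> r \<longrightarrow> \<bar>f x\<bar> \<le> max B 0"
    by (force simp: dist_norm intro: max.coboundedI1)
  then show ?thesis by (intro exI[of _ "max B 0"]) auto
qed

lemma abs_sum_partials_le:
  fixes d :: "real ^ 'm::finite"
  assumes "\<And>l. \<bar>A l\<bar> \<le> B"
  shows "\<bar>\<Sum>l\<in>UNIV. A l * d $ l\<bar> \<le> real CARD('m) * B * norm d"
proof -
  have "\<bar>\<Sum>l\<in>UNIV. A l * d $ l\<bar> \<le> (\<Sum>l\<in>(UNIV :: 'm set). B * norm d)"
    using assms by (intro order_trans[OF sum_abs] sum_mono)
      (auto simp: abs_mult intro!: mult_mono component_le_norm_cart order_trans[OF abs_ge_zero assms])
  then show ?thesis by simp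
qed

lemma real_polynomial_partials_bounded:
  fixes f :: "real ^ 'm::finite \<Rightarrow> real"
  assumes "real_polynomial_function f"
  shows "\<exists>B\<ge>0. \<forall>a d. norm a \<le> r \<longrightarrow> \<bar>\<Sum>l\<in>UNIV. partial l f a * d $ l\<bar> \<le> B * norm d"
proof -
  have "\<forall>l. \<exists>B\<ge>0. \<forall>x. norm x \<le> r \<longrightarrow> \<bar>partial l f x\<bar> \<le> B"
    using assms by (intro allI real_polynomial_bounded real_polynomial_partial)
  then obtain B where B: "\<And>l. B l \<ge> 0" "\<And>l x. norm x \<le> r \<Longrightarrow> \<bar>partial l f x\<bar> \<le> B l"
    by metis
  have "\<bar>partial l f x\<bar> \<le> sum B UNIV" if "norm x \<le> r" for l x
    using B(2)[OF that, of l] member_le_sum[of l UNIV B] B(1) by fastforce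
  then show ?thesis
    using B(1) by (intro exI[of _ "real CARD('m) * sum B UNIV"])
      (auto intro!: abs_sum_partials_le sum_nonneg mult_nonneg_nonneg)
qed

text \<open>Induction over the construction of polynomials yields the remainder bound. It is uniform
  in the base point \<open>a\<close> because it is applied at points that move with h and x.\<close>

lemma real_polynomial_taylor2:
  fixes f :: "real ^ 'm::finite \<Rightarrow> real"
  assumes "real_polynomial_function f"
  shows "\<exists>B\<ge>0. \<forall>a d. norm a \<le> r \<longrightarrow> norm d \<le> r \<longrightarrow>
           \<bar>f (a + d) - f a - (\<Sum>l\<in>UNIV. partial l f a * d $ l)\<bar> \<le> B * (norm d)\<^sup>2"
  using assms
proof (induction rule: real_polynomial_function.induct)
  case (linear f)
  then have "f (a + d) - f a - (\<Sum>l\<in>UNIV. partial l f a * d $ l) = 0" for a d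
    using linear_sum_axis[of f d] by (simp add: partial_linear linear_add bounded_linear.linear)
  then show ?case by (intro exI[of _ 0]) simp
next
  case (const c)
  show ?case by (intro exI[of _ 0]) (auto simp: partial_const)
next
  case (add f g)
  then obtain B C where B: "B \<ge> 0" "\<And>a d. norm a \<le> r \<Longrightarrow> norm d \<le> r \<Longrightarrow>
           \<bar>f (a + d) - f a - (\<Sum>l\<in>UNIV. partial l f a * d $ l)\<bar> \<le> B * (norm d)\<^sup>2"
     and C: "C \<ge> 0" "\<And>a d. norm a \<le> r \<Longrightarrow> norm d \<le> r \<Longrightarrow>
           \<bar>g (a + d) - g a - (\<Sum>l\<in>UNIV. partial l g a * d $ l)\<bar> \<le> C * (norm d)\<^sup>2"
    by blast
  have e: "(\<Sum>l\<in>UNIV. partial l (\<lambda>x. f x + g x) a * d $ l) =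
     (\<Sum>l\<in>UNIV. partial l f a * d $ l) + (\<Sum>l\<in>UNIV. partial l g a * d $ l)" for a d
    using add by (simp add: partial_add real_polynomial_differentiable sum.distrib algebra_simps)
  have "\<bar>f (a + d) + g (a + d) - (f a + g a) - (\<Sum>l\<in>UNIV. partial l (\<lambda>x. f x + g x) a * d $ l)\<bar>
      \<le> (B + C) * (norm d)\<^sup>2" if "norm a \<le> r" "norm d \<le> r" for a d
    using B(2)[OF that] C(2)[OF that] e[of a d] unfolding distrib_right by linarith
  then show ?case using B(1) C(1) by (intro exI[of _ "B + C"]) auto
next
  case (mult f g)
  obtain B C where B: "B \<ge> 0" "\<And>a d. norm a \<le> r \<Longrightarrow> norm d \<le> r \<Longrightarrow>
           \<bar>f (a + d) - f a - (\<Sum>l\<in>UNIV. partial l f a * d $ l)\<bar> \<le> B * (norm d)\<^sup>2"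
     and C: "C \<ge> 0" "\<And>a d. norm a \<le> r \<Longrightarrow> norm d \<le> r \<Longrightarrow>
           \<bar>g (a + d) - g a - (\<Sum>l\<in>UNIV. partial l g a * d $ l)\<bar> \<le> C * (norm d)\<^sup>2"
    using mult.IH by blast
  obtain F where F: "F \<ge> 0" "\<And>x. norm x \<le> r \<Longrightarrow> \<bar>f x\<bar> \<le> F"
    using real_polynomial_bounded[OF mult.hyps(1)] by blast
  \<comment> \<open>In the product, \<open>g\<close> is evaluated at \<open>a + d\<close>, hence the
    doubled radius.\<close>
  obtain G where G: "G \<ge> 0" "\<And>x. norm x \<le> r + r \<Longrightarrow> \<bar>g x\<bar> \<le> G"
    using real_polynomial_bounded[OF mult.hyps(2)] by blast
  obtain F' where F': "F' \<ge> 0" "\<And>a d. norm a \<le> r \<Longrightarrow> \<bar>\<Sum>l\<in>UNIV. partial l f a * d $ l\<bar> \<le> F' * norm d"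
    using real_polynomial_partials_bounded[OF mult.hyps(1)] by blast
  obtain G' where G': "G' \<ge> 0" "\<And>a d. norm a \<le> r \<Longrightarrow> \<bar>\<Sum>l\<in>UNIV. partial l g a * d $ l\<bar> \<le> G' * norm d"
    using real_polynomial_partials_bounded[OF mult.hyps(2)] by blast
  have "\<bar>f (a + d) * g (a + d) - f a * g a - (\<Sum>l\<in>UNIV. partial l (\<lambda>x. f x * g x) a * d $ l)\<bar>
      \<le> (B * G + F * C + F' * (G' + C * r)) * (norm d)\<^sup>2" if a: "norm a \<le> r" and d: "norm d \<le> r" for a d
  proof -
    define Df where "Df = (\<Sum>l\<in>UNIV. partial l f a * d $ l)"
    define Dg where "Dg = (\<Sum>l\<in>UNIV. partial l g a * d $ l)"
    define Rf where "Rf = f (a + d) - f a - Df"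
    define Rg where "Rg = g (a + d) - g a - Dg"
    have e: "(\<Sum>l\<in>UNIV. partial l (\<lambda>x. f x * g x) a * d $ l) = Df * g a + f a * Dg"
      using mult.hyps by (simp add: partial_mult real_polynomial_differentiable sum.distrib
          algebra_simps Df_def Dg_def sum_distrib_left sum_distrib_right)
    have Rf: "\<bar>Rf\<bar> \<le> B * (norm d)\<^sup>2" and Rg: "\<bar>Rg\<bar> \<le> C * (norm d)\<^sup>2"
      using B(2)[OF a d] C(2)[OF a d] by (simp_all add: Rf_def Rg_def Df_def Dg_def)
    have nad: "norm (a + d) \<le> r + r" using a d norm_triangle_ineq[of a d] by linarith
    have Df: "\<bar>Df\<bar> \<le> F' * norm d" and Dg: "\<bar>Dg\<bar> \<le> G' * norm d"
      using F'(2)[OF a] G'(2)[OF a] by (auto simp: Df_def Dg_def)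
    have "\<bar>Dg + Rg\<bar> \<le> G' * norm d + C * (norm d)\<^sup>2" using Dg Rg by linarith
    also have "C * (norm d)\<^sup>2 \<le> C * r * norm d"
      using C(1) d by (auto simp: power2_eq_square mult.assoc intro!: mult_left_mono mult_right_mono)
    finally have DR: "\<bar>Dg + Rg\<bar> \<le> (G' + C * r) * norm d" by (simp add: algebra_simps)
    \<comment> \<open>The last product on the right is quadratic in \<open>norm d\<close> because
      each of its two factors is linear in it.\<close>
    have "f (a + d) * g (a + d) - f a * g a - (\<Sum>l\<in>UNIV. partial l (\<lambda>x. f x * g x) a * d $ l)
       = Rf * g (a + d) + f a * Rg + Df * (Dg + Rg)"
      unfolding e Rf_def Rg_def by (simp add: algebra_simps)
    also have "\<bar>\<dots>\<bar> \<le> \<bar>Rf\<bar> * \<bar>g (a + d)\<bar> + \<bar>f a\<bar> * \<bar>Rg\<bar> + \<bar>Df\<bar> * \<bar>Dg + Rg\<bar>"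
      using abs_triangle_ineq[of "Rf * g (a + d) + f a * Rg" "Df * (Dg + Rg)"]
        abs_triangle_ineq[of "Rf * g (a + d)" "f a * Rg"] by (simp add: abs_mult)
    also have "\<dots> \<le> (B * (norm d)\<^sup>2) * G + F * (C * (norm d)\<^sup>2) + (F' * norm d) * ((G' + C * r) * norm d)"
      using Rf Rg Df DR G(2)[OF nad] F(2)[OF a] B(1) C(1) F(1) F'(1) G(1)
      by (intro add_mono mult_mono) auto
    finally show ?thesis by (simp add: algebra_simps power2_eq_square)
  qed
  note bound = this
  \<comment> \<open>For negative \<open>r\<close> the claim is empty, but the constant found above
    could be negative.\<close>
  show ?case
  proof (cases "r \<ge> 0")
    case True
    then have "0 \<le> B * G + F * C + F' * (G' + C * r)"
      using B(1) C(1) F(1) G(1) F'(1) G'(1) by simp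
    with bound show ?thesis by blast
  next
    case False
    then have "\<not> norm a \<le> r" for a :: "real ^ 'm" using norm_ge_zero[of a] by linarith
    then show ?thesis by (intro exI[of _ 0]) simp
  qed
qed

subsection \<open>Power series in several variables\<close>

text \<open>Truncation errors enter in this form only: along a curve at distance O(h) from
  \<open>z\<close>, flatness of order \<open>n\<close> becomes O(h^n), see
  \<open>near_bigo_pow\<close>.\<close>

abbreviation flat_at :: "nat \<Rightarrow> real ^ 'm::finite \<Rightarrow> (real ^ 'm \<Rightarrow> real) \<Rightarrow> bool" where
  "flat_at n z \<phi> \<equiv> \<exists>B\<ge>0. \<exists>\<delta>>0. \<forall>x\<in>ball z \<delta>. \<bar>\<phi> x\<bar> \<le> B * norm (x - z) ^ n"

definition monomial_at :: "real ^ 'm::finite \<Rightarrow> ('m \<Rightarrow> nat) \<Rightarrow> real ^ 'm \<Rightarrow> real" where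
  "monomial_at z k x = (\<Prod>i\<in>UNIV. (x $ i - z $ i) ^ k i)"

text \<open>The index \<open>n\<close> records up to which total degree the series has no terms. It
  measures contact with a Taylor polynomial and drops by one per derivative; \<open>n = 0\<close>
  for every \<open>z\<close> is analyticity.\<close>

definition power_series_at :: "nat \<Rightarrow> real ^ 'm::finite \<Rightarrow> (real ^ 'm \<Rightarrow> real) \<Rightarrow> bool" where
  "power_series_at n z f \<longleftrightarrow> (\<exists>r>0. \<exists>a. (\<forall>k. sum k UNIV < n \<longrightarrow> a k = 0) \<and>
     (\<forall>x\<in>ball z r. ((\<lambda>k. a k * monomial_at z k x) has_sum f x) UNIV))"

lemma abs_monomial_at_le:
  assumes "\<And>i. \<bar>x $ i - z $ i\<bar> \<le> \<rho>"
  shows "\<bar>monomial_at z k x\<bar> \<le> \<rho> ^ sum k UNIV"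
proof -
  have "\<bar>monomial_at z k x\<bar> = (\<Prod>i\<in>UNIV. \<bar>x $ i - z $ i\<bar> ^ k i)"
    by (simp add: monomial_at_def abs_prod power_abs)
  also have "\<dots> \<le> (\<Prod>i\<in>UNIV. \<rho> ^ k i)"
    using assms by (intro prod_mono) (auto intro: power_mono)
  finally show ?thesis by (simp add: power_sum)
qed

text \<open>Unordered real sums converge absolutely, and at the diagonal point \<open>z\<close> +
  (\<open>\<delta>\<close>, ..., \<open>\<delta>\<close>) each monomial equals
  \<open>\<delta>\<close> to its total degree. Convergence at this one point thus dominates the
  series on a whole neighbourhood.\<close>

lemma power_series_at_summable:
  fixes z :: "real ^ 'm::finite"
  assumes "r > 0" "\<forall>x\<in>ball z r. ((\<lambda>k. a k * monomial_at z k x) has_sum f x) UNIV"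
  obtains \<delta> where "\<delta> > 0" "\<delta> < r" "(\<lambda>k. \<bar>a k\<bar> * \<delta> ^ sum k UNIV) summable_on UNIV"
proof -
  \<comment> \<open>With this choice the diagonal displacement has l1-norm r/2 and stays inside the
    ball.\<close>
  define \<delta> where "\<delta> = r / (2 * real CARD('m))"
  have "\<delta> > 0" using \<open>r > 0\<close> by (simp add: \<delta>_def)
  have c1: "real CARD('m) \<ge> 1" by (simp add: Suc_leI)
  have "r * 1 < r * (2 * real CARD('m))" using \<open>r > 0\<close> c1 by (intro mult_strict_left_mono) linarith+
  then have "\<delta> < r" by (simp add: \<delta>_def field_simps)
  define x where "x = z + (\<chi> i. \<delta>)"
  have "norm ((\<chi> i. \<delta>) :: real ^ 'm) \<le> (\<Sum>i\<in>(UNIV :: 'm set). \<bar>\<delta>\<bar>)"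
    using norm_le_l1_cart[of "(\<chi> i. \<delta>) :: real ^ 'm"] by simp
  also have "\<dots> < r" using \<open>\<delta> > 0\<close> \<open>r > 0\<close> by (simp add: \<delta>_def)
  finally have "x \<in> ball z r" by (simp add: x_def dist_norm)
  then have "(\<lambda>k. a k * monomial_at z k x) summable_on UNIV"
    using assms(2) by (auto simp: summable_on_def)
  moreover have "monomial_at z k x = \<delta> ^ sum k UNIV" for k
    by (simp add: monomial_at_def x_def power_sum)
  ultimately have "(\<lambda>k. a k * \<delta> ^ sum k UNIV) summable_on UNIV" by simp
  then have "(\<lambda>k. norm (a k * \<delta> ^ sum k UNIV)) summable_on UNIV"
    by (rule summable_on_iff_abs_summable_on_real[THEN iffD1])
  then have "(\<lambda>k. \<bar>a k\<bar> * \<delta> ^ sum k UNIV) summable_on UNIV"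
    using \<open>\<delta> > 0\<close> by (simp add: abs_mult)
  with \<open>\<delta> > 0\<close> \<open>\<delta> < r\<close> show ?thesis by (rule that)
qed

text \<open>All surviving monomials have total degree at least \<open>n\<close>, so
  (\<open>\<rho>\<close>/\<open>\<delta>\<close>)^n can be split off each of them, and the rest is
  bounded by the absolutely convergent series at \<open>\<delta>\<close>.\<close>

lemma power_series_at_bound:
  fixes z :: "real ^ 'm::finite"
  assumes "power_series_at n z f"
  shows "flat_at n z f"
proof -
  obtain r a where r: "r > 0" and a: "\<And>k. sum k UNIV < n \<Longrightarrow> a k = 0"
    and f: "\<forall>x\<in>ball z r. ((\<lambda>k. a k * monomial_at z k x) has_sum f x) UNIV"
    using assms unfolding power_series_at_def by blast
  obtain \<delta> where \<delta>: "\<delta> > 0" "\<delta> < r" and summ: "(\<lambda>k. \<bar>a k\<bar> * \<delta> ^ sum k UNIV) summable_on UNIV"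
    using power_series_at_summable[OF r f] .
  define M where "M = (\<Sum>\<^sub>\<infinity>k. \<bar>a k\<bar> * \<delta> ^ sum k UNIV)"
  have "M \<ge> 0" unfolding M_def using \<delta> by (intro infsum_nonneg) auto
  have "\<bar>f x\<bar> \<le> M / \<delta> ^ n * norm (x - z) ^ n" if x: "x \<in> ball z \<delta>" for x
  proof -
    define \<rho> where "\<rho> = norm (x - z)"
    have \<rho>: "0 \<le> \<rho>" "\<rho> \<le> \<delta>" using x by (auto simp: \<rho>_def dist_norm norm_minus_commute)
    have comp: "\<bar>x $ i - z $ i\<bar> \<le> \<rho>" for i
      using component_le_norm_cart[of "x - z" i] by (simp add: \<rho>_def)
    have le: "norm (a k * monomial_at z k x) \<le> \<bar>a k\<bar> * \<delta> ^ sum k UNIV * (\<rho> ^ n / \<delta> ^ n)" for k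
    proof (cases "sum k UNIV < n")
      case False
      then have "\<rho> ^ sum k UNIV = \<rho> ^ n * \<rho> ^ (sum k UNIV - n)"
        by (simp flip: power_add)
      also have "\<dots> \<le> \<rho> ^ n * \<delta> ^ (sum k UNIV - n)"
        using \<rho> by (intro mult_left_mono power_mono) auto
      also have "\<dots> = \<delta> ^ sum k UNIV * (\<rho> ^ n / \<delta> ^ n)"
        using False \<delta> by (simp add: power_diff)
      finally have "\<rho> ^ sum k UNIV \<le> \<delta> ^ sum k UNIV * (\<rho> ^ n / \<delta> ^ n)" .
      with abs_monomial_at_le[OF comp, of k] have "\<bar>monomial_at z k x\<bar> \<le> \<delta> ^ sum k UNIV * (\<rho> ^ n / \<delta> ^ n)"
        by linarith
      then show ?thesis unfolding real_norm_def abs_mult mult.assoc by (rule mult_left_mono) simp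
    qed (simp add: a)
    have s: "((\<lambda>k. \<bar>a k\<bar> * \<delta> ^ sum k UNIV * (\<rho> ^ n / \<delta> ^ n)) has_sum M * (\<rho> ^ n / \<delta> ^ n)) UNIV"
      using has_sum_infsum[OF summ] unfolding M_def by (rule has_sum_cmult_left)
    have fx: "((\<lambda>k. a k * monomial_at z k x) has_sum f x) UNIV"
      using f x \<delta> by auto
    have "norm (f x) \<le> M * (\<rho> ^ n / \<delta> ^ n)"
      using norm_infsum_le[OF fx s] le by blast
    then show ?thesis by (simp add: \<rho>_def)
  qed
  with \<delta> \<open>M \<ge> 0\<close> show ?thesis by (intro exI[of _ "M / \<delta> ^ n"] conjI exI[of _ \<delta>] ballI) auto
qed

lemma has_sum_diff_real:
  fixes f g :: "'k \<Rightarrow> real"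
  assumes "(f has_sum a) A" "(g has_sum b) A"
  shows "((\<lambda>k. f k - g k) has_sum (a - b)) A"
  using has_sum_add[OF assms(1) has_sum_uminusI[OF assms(2)]] by simp

text \<open>M-test for derivatives: the mean value inequality bounds each difference quotient by
  \<open>M k\<close>, so outside a finite index set both quotient and derivative are negligible, and
  finite sums can be differentiated term by term.\<close>

lemma has_derivative_has_sum:
  fixes F :: "'k \<Rightarrow> 'a::real_normed_vector \<Rightarrow> real"
  assumes U: "open U" "convex U"
    and F': "\<And>k x. x \<in> U \<Longrightarrow> (F k has_derivative F' k x) (at x)"
    and M: "\<And>k x v. x \<in> U \<Longrightarrow> \<bar>F' k x v\<bar> \<le> M k * norm v" "\<And>k. M k \<ge> 0" "M summable_on UNIV"
    and f: "\<And>x. x \<in> U \<Longrightarrow> ((\<lambda>k. F k x) has_sum f x) UNIV"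
    and x: "x \<in> U"
  shows "(f has_derivative (\<lambda>v. \<Sum>\<^sub>\<infinity>k. F' k x v)) (at x)"
proof -
  have summ': "(\<lambda>k. F' k x v) summable_on UNIV" for v
  proof -
    have "(\<lambda>k. M k * norm v) summable_on UNIV"
      using M(3) by (rule summable_on_cmult_left)
    then have "(\<lambda>k. norm (F' k x v)) summable_on UNIV"
      by (rule Infinite_Sum.abs_summable_on_comparison_test') (simp add: M(1)[OF x])
    then show ?thesis by (rule summable_on_iff_abs_summable_on_real[THEN iffD2])
  qed
  have lin: "bounded_linear (F' k x)" for k
    using F'[OF x] by (rule has_derivative_bounded_linear)
  have tail: "\<bar>(f y - f x - (\<Sum>\<^sub>\<infinity>k. F' k x (y - x))) - (\<Sum>k\<in>K. F k y - F k x - F' k x (y - x))\<bar>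
      \<le> 2 * (\<Sum>\<^sub>\<infinity>k\<in>- K. M k) * norm (y - x)"
    if K: "finite K" and y: "y \<in> U" for K y
  proof -
    have "((\<lambda>k. F k y - F k x - F' k x (y - x)) has_sum (f y - f x - (\<Sum>\<^sub>\<infinity>k. F' k x (y - x)))) UNIV"
      by (intro has_sum_diff_real f y x has_sum_infsum summ')
    moreover have "((\<lambda>k. F k y - F k x - F' k x (y - x)) has_sum (\<Sum>k\<in>K. F k y - F k x - F' k x (y - x))) K"
      using K by (rule has_sum_finite)
    ultimately have 1: "((\<lambda>k. F k y - F k x - F' k x (y - x)) has_sum
        ((f y - f x - (\<Sum>\<^sub>\<infinity>k. F' k x (y - x))) - (\<Sum>k\<in>K. F k y - F k x - F' k x (y - x)))) (- K)"
      unfolding Compl_eq_Diff_UNIV by (rule has_sum_Diff) auto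
    have "M summable_on (- K)" using M(3) by (rule summable_on_subset_banach) auto
    then have 2: "((\<lambda>k. M k * (2 * norm (y - x))) has_sum ((\<Sum>\<^sub>\<infinity>k\<in>- K. M k) * (2 * norm (y - x)))) (- K)"
      by (intro has_sum_cmult_left has_sum_infsum)
    have "norm (F k y - F k x - F' k x (y - x)) \<le> M k * (2 * norm (y - x))" for k
    proof -
      have "norm (F k y - F k x) \<le> M k * norm (y - x)"
      proof (rule differentiable_bound[OF U(2) _ _ y x])
        fix u assume "u \<in> U"
        then show "(F k has_derivative F' k u) (at u within U)"
          by (rule has_derivative_at_withinI[OF F'])
        show "onorm (F' k u) \<le> M k"
          by (rule onorm_bound[OF M(2)]) (simp add: M(1)[OF \<open>u \<in> U\<close>])
      qed
      with M(1)[OF x, of k "y - x"] show ?thesis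
        using abs_triangle_ineq4[of "F k y - F k x" "F' k x (y - x)"] unfolding real_norm_def by linarith
    qed
    with norm_infsum_le[OF 1 2] show ?thesis by (simp add: mult_ac)
  qed
  have bl: "bounded_linear (\<lambda>v. \<Sum>\<^sub>\<infinity>k. F' k x v)"
  proof (rule bounded_linear_intro[where K = "infsum M UNIV"])
    fix u v and c :: real
    show "(\<Sum>\<^sub>\<infinity>k. F' k x (u + v)) = (\<Sum>\<^sub>\<infinity>k. F' k x u) + (\<Sum>\<^sub>\<infinity>k. F' k x v)"
      using summ' by (simp add: linear_add[OF bounded_linear.linear[OF lin]] infsum_add)
    show "(\<Sum>\<^sub>\<infinity>k. F' k x (c *\<^sub>R u)) = c *\<^sub>R (\<Sum>\<^sub>\<infinity>k. F' k x u)"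
      by (simp add: linear_cmul[OF bounded_linear.linear[OF lin]] infsum_cmult_right')
    have "((\<lambda>k. M k * norm u) has_sum (infsum M UNIV * norm u)) UNIV"
      using M(3) by (intro has_sum_cmult_left has_sum_infsum)
    from norm_infsum_le[OF has_sum_infsum[OF summ'[of u]] this] M(1)[OF x]
    show "norm (\<Sum>\<^sub>\<infinity>k. F' k x u) \<le> norm u * infsum M UNIV"
      by (simp add: mult.commute)
  qed
  show ?thesis
    unfolding has_derivative_at_alt
  proof (intro conjI bl allI impI)
    fix e :: real assume "e > 0"
    have "(M has_sum infsum M UNIV) UNIV" using M(3) by (rule has_sum_infsum)
    \<comment> \<open>The tail counts twice, once for the difference and once for the derivative, so
      e/4 costs e/2; the other half is left for the finite sum.\<close>
    from has_sum_finite_approximation[OF this, of "e / 4"] obtain K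
      where K: "finite K" "dist (sum M K) (infsum M UNIV) \<le> e / 4"
      using \<open>e > 0\<close> by auto
    have "(M has_sum (infsum M UNIV - sum M K)) (- K)"
      unfolding Compl_eq_Diff_UNIV using M(3) K
      by (intro has_sum_Diff has_sum_infsum has_sum_finite) auto
    then have "(\<Sum>\<^sub>\<infinity>k\<in>- K. M k) = infsum M UNIV - sum M K" by (rule infsumI)
    then have MK: "(\<Sum>\<^sub>\<infinity>k\<in>- K. M k) \<le> e / 4" using K(2) unfolding dist_real_def by linarith
    have "((\<lambda>y. \<Sum>k\<in>K. F k y) has_derivative (\<lambda>v. \<Sum>k\<in>K. F' k x v)) (at x)"
      using F' x by (intro has_derivative_sum)
    then obtain d where d: "d > 0" and dle: "\<And>y. norm (y - x) < d \<Longrightarrow>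
        norm ((\<Sum>k\<in>K. F k y) - (\<Sum>k\<in>K. F k x) - (\<Sum>k\<in>K. F' k x (y - x))) \<le> e / 2 * norm (y - x)"
      using \<open>e > 0\<close> unfolding has_derivative_at_alt by (meson half_gt_zero)
    obtain d' where d': "d' > 0" "ball x d' \<subseteq> U" using U(1) x open_contains_ball by blast
    have "norm (f y - f x - (\<Sum>\<^sub>\<infinity>k. F' k x (y - x))) \<le> e * norm (y - x)"
      if y: "norm (y - x) < min d d'" for y
    proof -
      have "y \<in> U" using y d' by (auto simp: dist_norm norm_minus_commute subset_iff)
      have "2 * (\<Sum>\<^sub>\<infinity>k\<in>- K. M k) * norm (y - x) \<le> e / 2 * norm (y - x)"
        using MK by (intro mult_right_mono) auto
      then have "\<bar>(f y - f x - (\<Sum>\<^sub>\<infinity>k. F' k x (y - x))) - (\<Sum>k\<in>K. F k y - F k x - F' k x (y - x))\<bar>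
         \<le> e / 2 * norm (y - x)"
        using tail[OF K(1) \<open>y \<in> U\<close>] by linarith
      moreover have "\<bar>\<Sum>k\<in>K. F k y - F k x - F' k x (y - x)\<bar> \<le> e / 2 * norm (y - x)"
        using dle[of y] y by (simp add: sum_subtractf)
      moreover have "e / 2 * norm (y - x) + e / 2 * norm (y - x) = e * norm (y - x)" by simp
      ultimately show ?thesis unfolding real_norm_def by linarith
    qed
    then show "\<exists>d>0. \<forall>y. norm (y - x) < d \<longrightarrow>
        norm (f y - f x - (\<Sum>\<^sub>\<infinity>k. F' k x (y - x))) \<le> e * norm (y - x)"
      using d d' by (intro exI[of _ "min d d'"]) auto
  qed
qed

lemma has_derivative_monomial_at:
  fixes z :: "real ^ 'm::finite"
  shows "(monomial_at z k has_derivative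
     (\<lambda>v. \<Sum>i\<in>UNIV. v $ i * (real (k i) * monomial_at z (k(i := k i - 1)) x))) (at x)"
proof -
  have d: "((\<lambda>x. (x $ i - z $ i) ^ k i) has_derivative
      (\<lambda>v. v $ i * (real (k i) * (x $ i - z $ i) ^ (k i - 1)))) (at x)" for i
    by (auto intro!: derivative_eq_intros bounded_linear_imp_has_derivative[OF bounded_linear_vec_nth])
  have e0: "(\<Prod>j\<in>UNIV - {i}. (x $ j - z $ j) ^ k j) * (x $ i - z $ i) ^ (k i - 1) =
     monomial_at z (k(i := k i - 1)) x" for i
    by (simp add: monomial_at_def prod.remove[of UNIV i] mult.commute)
  have e: "v $ i * (real (k i) * (x $ i - z $ i) ^ (k i - 1)) * (\<Prod>j\<in>UNIV - {i}. (x $ j - z $ j) ^ k j)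
     = v $ i * (real (k i) * monomial_at z (k(i := k i - 1)) x)" for i and v :: "real ^ 'm"
    unfolding e0[symmetric] by (simp only: mult_ac)
  have "((\<lambda>x. \<Prod>i\<in>UNIV. (x $ i - z $ i) ^ k i) has_derivative
     (\<lambda>v. \<Sum>i\<in>UNIV. v $ i * (real (k i) * (x $ i - z $ i) ^ (k i - 1)) * (\<Prod>j\<in>UNIV - {i}. (x $ j - z $ j) ^ k j))) (at x)"
    using d by (rule has_derivative_prod)
  then show ?thesis unfolding e unfolding monomial_at_def[abs_def] .
qed

lemma sum_fun_upd_Suc:
  fixes k :: "'m::finite \<Rightarrow> nat"
  shows "sum (k(i := Suc (k i))) UNIV = Suc (sum k UNIV)"
proof -
  have "sum (k(i := Suc (k i))) UNIV = Suc (k i) + sum k (UNIV - {i})"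
    by (subst sum.remove[of UNIV i]) (auto intro!: sum.cong)
  also have "\<dots> = Suc (sum k UNIV)" by (simp add: sum.remove[of UNIV i])
  finally show ?thesis .
qed

text \<open>Differentiation multiplies a monomial of total degree N by at most N; halving the radius
  pays for this because N is at most 2^N.\<close>

lemma power_series_at_derivative:
  fixes z :: "real ^ 'm::finite"
  assumes "power_series_at n z f"
  shows "\<exists>\<delta>>0. \<forall>x\<in>ball z \<delta>. f differentiable (at x)"
    and "power_series_at (n - 1) z (partial i f)"
proof -
  obtain r a where r: "r > 0" and a: "\<And>k. sum k UNIV < n \<Longrightarrow> a k = 0"
    and f: "\<forall>x\<in>ball z r. ((\<lambda>k. a k * monomial_at z k x) has_sum f x) UNIV"
    using assms unfolding power_series_at_def by blast
  obtain \<delta> where \<delta>: "\<delta> > 0" "\<delta> < r" and summ: "(\<lambda>k. \<bar>a k\<bar> * \<delta> ^ sum k UNIV) summable_on UNIV"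
    using power_series_at_summable[OF r f] .
  define U where "U = ball z (\<delta> / 2)"
  define F' where "F' k x v = a k * (\<Sum>i\<in>UNIV. v $ i * (real (k i) * monomial_at z (k(i := k i - 1)) x))"
    for k x and v :: "real ^ 'm"
  define M where "M k = \<bar>a k\<bar> * \<delta> ^ sum k UNIV * (2 / \<delta>)" for k
  have F': "((\<lambda>x. a k * monomial_at z k x) has_derivative F' k x) (at x)" for k x
    unfolding F'_def by (intro has_derivative_mult_right has_derivative_monomial_at)
  have F'_le: "\<bar>F' k x v\<bar> \<le> M k * norm v" if "x \<in> U" for k x v
  proof -
    have comp: "\<bar>x $ i - z $ i\<bar> \<le> \<delta> / 2" for i
      using component_le_norm_cart[of "x - z" i] that by (auto simp: U_def dist_norm norm_minus_commute)
    have mon: "real (k i) * \<bar>monomial_at z (k(i := k i - 1)) x\<bar> \<le> real (k i) * (\<delta> / 2) ^ (sum k UNIV - 1)" for i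
    proof (cases "k i")
      case (Suc m)
      have "sum k UNIV = Suc (sum (k(i := m)) UNIV)"
        using sum_fun_upd_Suc[of "k(i := m)" i] Suc by (simp add: fun_upd_idem)
      then show ?thesis
        using abs_monomial_at_le[OF comp, of "k(i := m)"] Suc by (auto intro!: mult_left_mono)
    qed simp
    have "\<bar>\<Sum>i\<in>UNIV. v $ i * (real (k i) * monomial_at z (k(i := k i - 1)) x)\<bar>
       \<le> (\<Sum>i\<in>UNIV. norm v * (real (k i) * (\<delta> / 2) ^ (sum k UNIV - 1)))"
    proof (intro order_trans[OF sum_abs] sum_mono)
      fix i
      have "\<bar>v $ i * (real (k i) * monomial_at z (k(i := k i - 1)) x)\<bar>
          = \<bar>v $ i\<bar> * (real (k i) * \<bar>monomial_at z (k(i := k i - 1)) x\<bar>)"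
        by (simp add: abs_mult)
      also have "\<dots> \<le> norm v * (real (k i) * (\<delta> / 2) ^ (sum k UNIV - 1))"
        by (rule mult_mono[OF component_le_norm_cart mon]) auto
      finally show "\<bar>v $ i * (real (k i) * monomial_at z (k(i := k i - 1)) x)\<bar>
        \<le> norm v * (real (k i) * (\<delta> / 2) ^ (sum k UNIV - 1))" .
    qed
    also have "\<dots> = norm v * (real (sum k UNIV) * (\<delta> / 2) ^ (sum k UNIV - 1))"
      by (simp add: sum_distrib_left sum_distrib_right)
    finally have S: "\<bar>\<Sum>i\<in>UNIV. v $ i * (real (k i) * monomial_at z (k(i := k i - 1)) x)\<bar>
      \<le> norm v * (real (sum k UNIV) * (\<delta> / 2) ^ (sum k UNIV - 1))" .
    have "real (sum k UNIV) * (\<delta> / 2) ^ (sum k UNIV - 1) \<le> \<delta> ^ sum k UNIV * (2 / \<delta>)"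
    proof (cases "sum k UNIV")
      case (Suc m)
      have "real (Suc m) \<le> 2 * 2 ^ m"
        by (metis less_exp less_imp_le of_nat_le_iff of_nat_numeral of_nat_power power_Suc)
      then have "real (Suc m) * \<delta> ^ m \<le> 2 * 2 ^ m * \<delta> ^ m"
        using \<delta> by (intro mult_right_mono) auto
      with Suc \<delta> show ?thesis by (simp add: field_simps power_divide)
    qed (use \<delta> in simp)
    then have "norm v * (real (sum k UNIV) * (\<delta> / 2) ^ (sum k UNIV - 1)) \<le> norm v * (\<delta> ^ sum k UNIV * (2 / \<delta>))"
      by (rule mult_left_mono) simp
    with S have "\<bar>\<Sum>i\<in>UNIV. v $ i * (real (k i) * monomial_at z (k(i := k i - 1)) x)\<bar>
        \<le> norm v * (\<delta> ^ sum k UNIV * (2 / \<delta>))" by linarith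
    then have "\<bar>a k\<bar> * \<bar>\<Sum>i\<in>UNIV. v $ i * (real (k i) * monomial_at z (k(i := k i - 1)) x)\<bar>
       \<le> \<bar>a k\<bar> * (norm v * (\<delta> ^ sum k UNIV * (2 / \<delta>)))"
      by (rule mult_left_mono) simp
    then show ?thesis by (simp add: F'_def M_def abs_mult mult_ac)
  qed
  have M: "M k \<ge> 0" for k using \<delta> by (simp add: M_def)
  have Ms: "M summable_on UNIV"
    unfolding M_def using summ by (rule summable_on_cmult_left)
  have fU: "((\<lambda>k. a k * monomial_at z k x) has_sum f x) UNIV" if "x \<in> U" for x
    using f that \<delta> by (auto simp: U_def)
  have df: "(f has_derivative (\<lambda>v. \<Sum>\<^sub>\<infinity>k. F' k x v)) (at x)" if "x \<in> U" for x
    by (rule has_derivative_has_sum[of U _ F' M, OF _ _ F' F'_le M Ms fU that]) (auto simp: U_def)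
  then have "\<forall>x\<in>U. f differentiable (at x)"
    unfolding differentiable_def by blast
  then show "\<exists>\<delta>>0. \<forall>x\<in>ball z \<delta>. f differentiable (at x)"
    using \<delta> unfolding U_def by (intro exI[of _ "\<delta> / 2"]) simp
  \<comment> \<open>Reindexing: the derivative in direction \<open>i\<close> lowers the exponent
    \<open>k i\<close>, so the new coefficient at \<open>k\<close> stems from \<open>u k\<close>.
    Old indices outside \<open>range u\<close> have \<open>k i = 0\<close> and contribute
    nothing.\<close>
  define u where "u k = k(i := Suc (k i))" for k :: "'m \<Rightarrow> nat"
  define b where "b k = a (u k) * real (Suc (k i))" for k
  have "((\<lambda>k. b k * monomial_at z k x) has_sum partial i f x) UNIV" if x: "x \<in> U" for x
  proof -
    have "(\<lambda>k. M k * norm (axis i 1 :: real ^ 'm)) summable_on UNIV"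
      using Ms by (rule summable_on_cmult_left)
    then have "(\<lambda>k. norm (F' k x (axis i 1))) summable_on UNIV"
      by (rule Infinite_Sum.abs_summable_on_comparison_test') (simp only: F'_le[OF x] real_norm_def)
    then have "(\<lambda>k. F' k x (axis i 1)) summable_on UNIV"
      by (rule summable_on_iff_abs_summable_on_real[THEN iffD2])
    then have "((\<lambda>k. F' k x (axis i 1)) has_sum partial i f x) UNIV"
      by (subst has_derivative_imp_partial[OF df[OF x]]) (rule has_sum_infsum)
    moreover have F'a: "F' k x (axis i 1) = a k * (real (k i) * monomial_at z (k(i := k i - 1)) x)" for k
      by (simp add: F'_def axis_def if_distrib if_distribR sum.delta cong: if_cong)
    moreover have "k \<in> range u" if "k i \<noteq> 0" for k
      using that by (intro image_eqI[of _ _ "k(i := k i - 1)"]) (auto simp: u_def)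
    ultimately have "((\<lambda>k. F' k x (axis i 1)) has_sum partial i f x) (range u)"
      by (intro has_sum_cong_neutral[where S = UNIV and T = "range u" and f = "\<lambda>k. F' k x (axis i 1)"
            and g = "\<lambda>k. F' k x (axis i 1)", THEN iffD1, rotated -1]) auto
    moreover have "inj u"
      by (rule injI) (auto simp: u_def fun_eq_iff split: if_splits)
    ultimately have "((\<lambda>k. F' (u k) x (axis i 1)) has_sum partial i f x) UNIV"
      by (simp add: has_sum_reindex o_def)
    moreover have "F' (u k) x (axis i 1) = b k * monomial_at z k x" for k
      unfolding F'a by (simp add: u_def b_def mult_ac)
    ultimately show ?thesis by simp
  qed
  moreover have "b k = 0" if "sum k UNIV < n - 1" for k
    using a[of "u k"] that sum_fun_upd_Suc[of k i] by (simp add: b_def u_def del: fun_upd_apply)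
  ultimately show "power_series_at (n - 1) z (partial i f)"
    unfolding power_series_at_def U_def using \<delta>
    by (intro exI[of _ "\<delta> / 2"] exI[of _ b] conjI) auto
qed

lemma real_polynomial_monomial_at: "real_polynomial_function (monomial_at z k)"
  unfolding monomial_at_def[abs_def]
  by (intro real_polynomial_function_prod real_polynomial_function_power real_polynomial_function_diff
      real_polynomial_function_nth real_polynomial_function.intros(2)) auto

lemma power_series_at_truncate:
  fixes z :: "real ^ 'm::finite"
  assumes "power_series_at 0 z f"
  shows "\<exists>p. real_polynomial_function p \<and> power_series_at n z (\<lambda>x. f x - p x)"
proof -
  obtain r a where r: "r > 0"
    and f: "\<forall>x\<in>ball z r. ((\<lambda>k. a k * monomial_at z k x) has_sum f x) UNIV"
    using assms unfolding power_series_at_def by blast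
  define K where "K = {k :: 'm \<Rightarrow> nat. sum k UNIV < n}"
  have "K \<subseteq> (UNIV \<rightarrow>\<^sub>E {..<n})"
  proof
    fix k assume "k \<in> K"
    moreover have "k i \<le> sum k UNIV" for i by (rule member_le_sum) auto
    ultimately show "k \<in> (UNIV \<rightarrow>\<^sub>E {..<n})"
      by (auto simp: K_def PiE_iff intro: le_less_trans)
  qed
  then have K: "finite K" by (rule finite_subset) (auto intro: finite_PiE)
  define p where "p x = (\<Sum>k\<in>K. a k * monomial_at z k x)" for x
  define b where "b k = (if k \<in> K then 0 else a k)" for k
  have "real_polynomial_function p"
    unfolding p_def[abs_def] using K
    by (intro real_polynomial_function_sum real_polynomial_function.intros(2,4) real_polynomial_monomial_at)
  moreover have "((\<lambda>k. b k * monomial_at z k x) has_sum (f x - p x)) UNIV" if "x \<in> ball z r" for x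
  proof -
    have "((\<lambda>k. a k * monomial_at z k x) has_sum (f x - p x)) (- K)"
      unfolding Compl_eq_Diff_UNIV p_def using f K that
      by (intro has_sum_Diff has_sum_finite) auto
    then show ?thesis
      by (rule has_sum_cong_neutral[THEN iffD1, rotated -1]) (auto simp: b_def)
  qed
  ultimately show ?thesis
    using r unfolding power_series_at_def
    by (intro exI[of _ p] conjI exI[of _ r] exI[of _ b]) (auto simp: b_def K_def)
qed

lemma real_analytic_power_series_at:
  fixes f :: "real ^ 'm::finite \<Rightarrow> real"
  assumes "real_analytic f"
  shows "power_series_at 0 z f"
  using assms unfolding real_analytic_def power_series_at_def monomial_at_def
  by (auto simp: mult.commute)

lemma real_analytic_nth:
  fixes f :: "real ^ 'm::finite \<Rightarrow> real ^ 'n::finite"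
  assumes "real_analytic f"
  shows "real_analytic (\<lambda>x. f x $ j)"
  unfolding real_analytic_def
proof
  fix z
  obtain r a where r: "r > 0" and
    f: "\<forall>x\<in>ball z r. ((\<lambda>k. (\<Prod>i\<in>UNIV. (x $ i - z $ i) ^ k i) *\<^sub>R a k) has_sum f x) UNIV"
    using assms unfolding real_analytic_def by blast
  have "((\<lambda>k. (\<Prod>i\<in>UNIV. (x $ i - z $ i) ^ k i) *\<^sub>R a k $ j) has_sum f x $ j) UNIV" if "x \<in> ball z r" for x
    using has_sum_bounded_linear[OF bounded_linear_vec_nth[of j], OF f[rule_format, OF that]]
    by (simp add: o_def)
  with r show "\<exists>r>0. \<exists>a. \<forall>x\<in>ball z r. ((\<lambda>k. (\<Prod>i\<in>UNIV. (x $ i - z $ i) ^ k i) *\<^sub>R a k) has_sum f x $ j) UNIV"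
    by (intro exI[of _ r] conjI exI[of _ "\<lambda>k. a k $ j"]) auto
qed

subsection \<open>Legendre polynomials and Gauss quadrature\<close>

lemma poly_integrable [simp]: "(\<lambda>x. poly p x) integrable_on {a..b::real}"
  by (intro integrable_continuous_real continuous_intros)

lemma poly_mult_integrable [simp]: "(\<lambda>x. poly p x * poly q x) integrable_on {a..b::real}"
  by (intro integrable_continuous_real continuous_intros)

lemma poly_mult_fun: "poly (p * q) = (\<lambda>x. poly p x * poly q x)"
  by (simp add: fun_eq_iff)

lemma poly_sum_smult: "poly (\<Sum>i\<in>A. Polynomial.smult (a i) (p i)) = (\<lambda>x. \<Sum>i\<in>A. a i * poly (p i) x)"
  by (simp add: fun_eq_iff poly_sum)

lemma poly_eq_sum:
  fixes p :: "'a::comm_semiring_1 poly"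
  shows "degree p \<le> d \<Longrightarrow> poly p x = (\<Sum>k\<le>d. coeff p k * x ^ k)"
  by (subst poly_as_sum_of_monoms'[symmetric, of p d]) (simp_all add: poly_sum poly_monom)

locale legendre =
  fixes P :: "nat \<Rightarrow> real poly"
  assumes legendre: "orthonormal_legendre P"
begin

definition coef :: "nat \<Rightarrow> (real \<Rightarrow> real) \<Rightarrow> real" where
  "coef j F = integral {0..1} (\<lambda>x. poly (P j) x * F x)"

lemma degree_P: "degree (P j) = j" and lead_coeff_P: "lead_coeff (P j) > 0"
  using legendre unfolding orthonormal_legendre_def by blast+

lemma coef_P: "coef i (poly (P j)) = (if i = j then 1 else 0)"
  using legendre by (auto simp: orthonormal_legendre_def coef_def)

lemma coef_add: "coef j (\<lambda>x. poly p x + poly q x) = coef j (poly p) + coef j (poly q)"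
  unfolding coef_def distrib_left by (intro Henstock_Kurzweil_Integration.integral_add) auto

lemma coef_cmult: "coef j (\<lambda>x. a * F x) = a * coef j F"
  unfolding coef_def mult.left_commute[of _ a] by simp

lemma coef_sum: "finite A \<Longrightarrow> coef j (\<lambda>x. \<Sum>k\<in>A. a k * poly (p k) x) = (\<Sum>k\<in>A. a k * coef j (poly (p k)))"
proof -
  assume A: "finite A"
  have "coef j (\<lambda>x. \<Sum>k\<in>A. a k * poly (p k) x) =
      integral {0..1} (\<lambda>x. \<Sum>k\<in>A. a k * (poly (P j) x * poly (p k) x))"
    by (simp add: coef_def sum_distrib_left mult_ac)
  also have "\<dots> = (\<Sum>k\<in>A. integral {0..1} (\<lambda>x. a k * (poly (P j) x * poly (p k) x)))"
    using A by (intro Henstock_Kurzweil_Integration.integral_sum integrable_continuous_real continuous_intros)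
  finally show ?thesis by (simp add: coef_def)
qed

text \<open>The degree bound is phrased through coefficients so that \<open>d = 0\<close> means the
  zero polynomial, which starts the induction.\<close>

lemma legendre_span: "(\<forall>i\<ge>d. coeff q i = 0) \<Longrightarrow> \<exists>a. q = (\<Sum>j<d. Polynomial.smult (a j) (P j))"
proof (induction d arbitrary: q)
  case 0
  then show ?case by (simp add: poly_eq_iff)
next
  case (Suc d)
  define b where "b = coeff q d / lead_coeff (P d)"
  have "coeff (q - Polynomial.smult b (P d)) i = 0" if "i \<ge> d" for i
  proof (cases "i = d")
    case True
    then show ?thesis using lead_coeff_P[of d] by (simp add: b_def degree_P)
  next
    case False
    with that Suc.prems show ?thesis by (simp add: coeff_eq_0 degree_P)
  qed
  then obtain a where "q - Polynomial.smult b (P d) = (\<Sum>j<d. Polynomial.smult (a j) (P j))"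
    using Suc.IH by blast
  then have "q = (\<Sum>j<Suc d. Polynomial.smult ((a(d := b)) j) (P j))"
    by (simp add: algebra_simps)
  then show ?case by blast
qed

lemma legendre_expansion:
  assumes "\<forall>i\<ge>d. coeff q i = 0"
  shows "q = (\<Sum>j<d. Polynomial.smult (coef j (poly q)) (P j))"
proof -
  obtain a where a: "q = (\<Sum>j<d. Polynomial.smult (a j) (P j))"
    using legendre_span[OF assms] by blast
  have "coef j (poly q) = a j" if "j < d" for j
  proof -
    have "coef j (poly q) = coef j (\<lambda>x. \<Sum>i<d. a i * poly (P i) x)"
      unfolding a poly_sum_smult ..
    also have "\<dots> = a j" using that by (simp add: coef_sum coef_P if_distrib sum.delta cong: if_cong)
    finally show ?thesis .
  qed
  then show ?thesis using a by simp
qed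

lemma coef_eq_0: "degree q < j \<Longrightarrow> coef j (poly q) = 0"
proof -
  assume "degree q < j"
  then have "\<forall>i\<ge>j. coeff q i = 0" by (simp add: coeff_eq_0)
  then obtain a where a: "q = (\<Sum>i<j. Polynomial.smult (a i) (P i))"
    using legendre_span by blast
  have "coef j (poly q) = coef j (\<lambda>x. \<Sum>i<j. a i * poly (P i) x)"
    unfolding a poly_sum_smult ..
  also have "\<dots> = 0" by (simp add: coef_sum coef_P)
  finally show ?thesis .
qed

text \<open>Only \<open>p\<close> is expanded in the basis, which is why the degree of
  \<open>q\<close> is free.\<close>

lemma parseval:
  assumes "degree p < d"
  shows "integral {0..1} (\<lambda>x. poly p x * poly q x) = (\<Sum>j<d. coef j (poly p) * coef j (poly q))"
proof -
  have "poly p = (\<lambda>x. \<Sum>j<d. coef j (poly p) * poly (P j) x)"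
    using assms by (subst legendre_expansion[of d p]) (auto simp: coeff_eq_0 poly_sum_smult)
  then have "poly p x = (\<Sum>j<d. coef j (poly p) * poly (P j) x)" for x by metis
  then have "integral {0..1} (\<lambda>x. poly p x * poly q x) =
     integral {0..1} (\<lambda>x. \<Sum>j<d. coef j (poly p) * (poly (P j) x * poly q x))"
    by (simp only: sum_distrib_right mult.assoc)
  also have "\<dots> = (\<Sum>j<d. integral {0..1} (\<lambda>x. coef j (poly p) * (poly (P j) x * poly q x)))"
    by (intro Henstock_Kurzweil_Integration.integral_sum integrable_continuous_real continuous_intros) auto
  finally show ?thesis by (simp add: coef_def)
qed

lemma P_0: "P 0 = [:1:]"
proof -
  obtain a where a: "P 0 = [:a:]" using degree_P[of 0] degree_0_id by metis
  have "a * a = 1" using coef_P[of 0 0] by (simp add: coef_def a)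
  moreover have "a > 0" using lead_coeff_P[of 0] by (simp add: a)
  ultimately show ?thesis by (simp add: a square_eq_1_iff)
qed

lemma integral_P: "integral {0..1} (poly (P j)) = (if j = 0 then 1 else 0)"
  using coef_P[of 0 j] by (auto simp: coef_def P_0)

text \<open>\<open>P 1\<close> is orthogonal to constants, so its unit norm equals its leading
  coefficient, which is positive, times its pairing with x.\<close>

lemma coef_1_id_pos: "coef 1 (\<lambda>x. x) > 0"
proof -
  obtain a q where aq: "P 1 = pCons a q" by (cases "P 1")
  with degree_P[of 1] have "q \<noteq> 0" by auto
  with aq degree_P[of 1] have "degree q = 0" by simp
  then obtain b where "q = [:b:]" by (metis degree_0_id)
  with aq lead_coeff_P[of 1] \<open>q \<noteq> 0\<close> have ab: "P 1 = [:a, b:]" "b > 0" by auto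
  have "coef 1 (poly (P 1)) = coef 1 (\<lambda>x. poly [:a:] x + poly [:0, b:] x)"
    unfolding ab(1) by (rule arg_cong[of _ _ "coef 1"]) (simp add: fun_eq_iff algebra_simps)
  also have "\<dots> = coef 1 (poly [:a:]) + coef 1 (\<lambda>x. b * x)"
    unfolding coef_add by (rule arg_cong[where f = "\<lambda>F. _ + coef 1 F"]) (simp add: fun_eq_iff)
  also have "\<dots> = b * coef 1 (\<lambda>x. x)"
    by (simp add: coef_eq_0 coef_cmult)
  finally have "b * coef 1 (\<lambda>x. x) = 1" by (simp add: coef_P)
  then have "0 < b * coef 1 (\<lambda>x. x)" by linarith
  then show ?thesis using ab(2) zero_less_mult_pos by blast
qed

end

section \<open>Gauss quadrature: location of the nodes and exactness\<close>

locale gauss = legendre +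
  fixes s :: nat and c :: "nat \<Rightarrow> real"
  assumes nodes: "gauss_nodes P s c" and s2: "s \<ge> 2"
begin

text \<open>The Gauss approximation of \<open>coef j F\<close>. The stage equations say that
  \<open>\<gamma>\<close> consists of these numbers for F = f(Z).\<close>

definition quad :: "nat \<Rightarrow> (real \<Rightarrow> real) \<Rightarrow> real" where
  "quad j F = (\<Sum>k<s. weight s c k * poly (P j) (c k) * F (c k))"

lemma inj_nodes: "inj_on c {..<s}"
  using nodes by (auto simp: gauss_nodes_def intro: strict_mono_on_imp_inj_on)

lemma nodes_root: "k < s \<Longrightarrow> poly (P s) (c k) = 0"
  using nodes by (auto simp: gauss_nodes_def)

text \<open>The cofactor has degree below s, so it is orthogonal to \<open>P s\<close>; writing
  \<open>P s\<close> as linear factor times \<open>q\<close> turns this into the vanishing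
  integral.\<close>

lemma node_cofactor:
  assumes "k < s"
  obtains q where "P s = [:- c k, 1:] * q" "q \<noteq> 0"
    "integral {0..1} (\<lambda>x. (x - c k) * (poly q x)\<^sup>2) = 0"
proof -
  have "[:- c k, 1:] dvd P s" using nodes_root[OF assms] by (simp add: poly_eq_0_iff_dvd)
  then obtain q where q: "P s = [:- c k, 1:] * q" by (elim dvdE)
  have "q \<noteq> 0" using q degree_P[of s] s2 by (intro notI) simp
  then have "degree q < s" using degree_P[of s] degree_mult_eq[of "[:- c k, 1:]" q] q by simp
  then have "coef s (poly q) = 0" by (rule coef_eq_0)
  then have "integral {0..1} (\<lambda>x. (x - c k) * (poly q x)\<^sup>2) = 0"
    unfolding coef_def q by (simp add: algebra_simps power2_eq_square)
  with q \<open>q \<noteq> 0\<close> show ?thesis by (rule that)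
qed

lemma integral_poly_eq_0:
  fixes q :: "real poly"
  assumes "integral {0..1} (poly q) = 0" "\<And>x. x \<in> {0..1} \<Longrightarrow> poly q x \<ge> 0"
  shows "q = 0"
proof (rule ccontr)
  assume "q \<noteq> 0"
  have "\<forall>x\<in>{0..1}. poly q x = 0"
    using integral_eq_0_iff[of 0 1 "poly q"] assms by (simp add: continuous_intros)
  then have "{0..1} \<subseteq> {x. poly q x = 0}" by auto
  then have "finite {0..1::real}" using poly_roots_finite[OF \<open>q \<noteq> 0\<close>] finite_subset by blast
  then show False by (simp add: infinite_Icc)
qed

text \<open>For a node outside [0,1] the integrand of \<open>node_cofactor\<close> would have
  constant sign, forcing \<open>q = 0\<close>. The range matters twice:
  \<open>integral {0..x}\<close> is 0 for negative x, and the uniform bounds below hold on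
  [0,1].\<close>

lemma node_range: "k < s \<Longrightarrow> c k \<in> {0..1}"
proof -
  assume "k < s"
  then obtain q where q: "q \<noteq> 0" "integral {0..1} (\<lambda>x. (x - c k) * (poly q x)\<^sup>2) = 0"
    using node_cofactor by metis
  have e: "poly ([:- c k, 1:] * q ^ 2) = (\<lambda>x. (x - c k) * (poly q x)\<^sup>2)"
    "poly ([:c k, - 1:] * q ^ 2) = (\<lambda>x. - ((x - c k) * (poly q x)\<^sup>2))"
    by (auto simp: fun_eq_iff poly_power algebra_simps)
  have "0 \<le> c k"
  proof (rule ccontr)
    assume "\<not> 0 \<le> c k"
    then have "[:- c k, 1:] * q ^ 2 = 0"
      using q(2) by (intro integral_poly_eq_0) (simp_all only: e, auto intro!: mult_nonneg_nonneg)
    then have "q ^ 2 = 0" unfolding mult_eq_0_iff by simp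
    then show False using q(1) by simp
  qed
  moreover have "c k \<le> 1"
  proof (rule ccontr)
    assume "\<not> c k \<le> 1"
    then have "[:c k, - 1:] * q ^ 2 = 0"
      using q(2) by (intro integral_poly_eq_0) (simp_all only: e, auto intro!: mult_nonpos_nonneg)
    then have "q ^ 2 = 0" unfolding mult_eq_0_iff by simp
    then show False using q(1) by simp
  qed
  ultimately show ?thesis by simp
qed

text \<open>Divide by \<open>P s\<close>. The quotient has degree below s, so its product with
  \<open>P s\<close> integrates to zero by orthogonality and vanishes at the nodes; the remainder is
  reproduced by Lagrange interpolation.\<close>

lemma quadrature_exact:
  assumes "degree q < 2 * s"
  shows "(\<Sum>k<s. weight s c k * poly q (c k)) = integral {0..1} (poly q)"
proof -
  define L where "L k = (\<Prod>j\<in>{..<s} - {k}. Polynomial.smult (1 / (c k - c j)) [:- c j, 1:])" for k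
  have L: "poly (L k) x = (\<Prod>j\<in>{..<s} - {k}. (x - c j) / (c k - c j))" for k x
    by (auto simp: L_def poly_prod diff_divide_distrib intro!: prod.cong)
  have weight: "weight s c k = integral {0..1} (poly (L k))" for k
    unfolding weight_def L ..
  have L_node: "poly (L k) (c i) = (if i = k then 1 else 0)" if "i < s" "k < s" for i k
  proof (cases "i = k")
    case True
    have "c k \<noteq> c j" if "j \<in> {..<s} - {k}" for j
      using inj_nodes that \<open>k < s\<close> by (auto simp: inj_on_def)
    then show ?thesis using True by (auto simp: L intro!: prod.neutral)
  next
    case False
    then show ?thesis using that by (auto simp: L intro!: prod_zero)
  qed
  have degL: "degree (L k) < s" if "k < s" for k
  proof -
    have "degree (L k) \<le> (\<Sum>j\<in>{..<s} - {k}. degree (Polynomial.smult (1 / (c k - c j)) [:- c j, 1:]))"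
      unfolding L_def by (rule order_trans[OF degree_prod_sum_le]) auto
    also have "\<dots> \<le> (\<Sum>j\<in>{..<s} - {k}. 1)"
      by (intro sum_mono) auto
    also have "\<dots> < s" using that by simp
    finally show ?thesis .
  qed
  have low: "(\<Sum>k<s. weight s c k * poly r (c k)) = integral {0..1} (poly r)" if r: "degree r < s" for r
  proof -
    have "r = (\<Sum>k<s. Polynomial.smult (poly r (c k)) (L k))"
    proof (rule poly_eqI_degree[of "c ` {..<s}"])
      have card: "card (c ` {..<s}) = s" using inj_nodes by (simp add: card_image)
      then show "degree r < card (c ` {..<s})" using r by simp
      have "degree (\<Sum>k<s. Polynomial.smult (poly r (c k)) (L k)) \<le> s - 1"
        using degL by (intro degree_sum_le) (force intro: order_trans[OF degree_smult_le])+
      then show "degree (\<Sum>k<s. Polynomial.smult (poly r (c k)) (L k)) < card (c ` {..<s})"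
        using card s2 by simp
    next
      fix x assume "x \<in> c ` {..<s}"
      then show "poly r x = poly (\<Sum>k<s. Polynomial.smult (poly r (c k)) (L k)) x"
        by (auto simp: poly_sum L_node if_distrib sum.delta cong: if_cong)
    qed
    then have "integral {0..1} (poly r) = integral {0..1} (\<lambda>x. \<Sum>k<s. poly r (c k) * poly (L k) x)"
      by (metis (no_types, lifting) poly_smult poly_sum sum.cong)
    also have "\<dots> = (\<Sum>k<s. integral {0..1} (\<lambda>x. poly r (c k) * poly (L k) x))"
      by (intro Henstock_Kurzweil_Integration.integral_sum integrable_continuous_real continuous_intros) auto
    finally show ?thesis by (simp add: weight mult.commute)
  qed
  define d where "d = q div P s"
  define r where "r = q mod P s"
  have q: "q = P s * d + r" by (simp add: d_def r_def)
  have Ps: "P s \<noteq> 0" using degree_P[of s] s2 by auto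
  have r: "degree r < s"
    using degree_mod_less[OF Ps, of q] degree_P[of s] s2 by (auto simp: r_def)
  have "degree d < s"
  proof (cases "d = 0")
    case False
    then have "degree (P s * d) = s + degree d" using Ps by (simp add: degree_mult_eq degree_P)
    moreover have "degree (P s * d) \<le> max (degree q) (degree r)"
      using degree_diff_le_max[of q r] by (simp add: q)
    ultimately show ?thesis using assms r by auto
  qed (use s2 in simp)
  then have "coef s (poly d) = 0" by (rule coef_eq_0)
  have "poly q = (\<lambda>x. poly (P s) x * poly d x + poly r x)"
    by (subst q) (simp add: fun_eq_iff)
  then have "integral {0..1} (poly q) = integral {0..1} (\<lambda>x. poly (P s) x * poly d x + poly r x)"
    by simp
  also have "\<dots> = coef s (poly d) + integral {0..1} (poly r)"
    unfolding coef_def by (intro Henstock_Kurzweil_Integration.integral_add) auto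
  also have "\<dots> = (\<Sum>k<s. weight s c k * poly r (c k))"
    using low[OF r] \<open>coef s (poly d) = 0\<close> by simp
  also have "\<dots> = (\<Sum>k<s. weight s c k * poly q (c k))"
    by (intro sum.cong) (auto simp: q nodes_root)
  finally show ?thesis by simp
qed

lemma quad_eq_coef: "j + degree q < 2 * s \<Longrightarrow> quad j (poly q) = coef j (poly q)"
proof -
  assume "j + degree q < 2 * s"
  then have "degree (P j * q) < 2 * s"
    using degree_mult_le[of "P j" q] degree_P[of j] by simp
  from quadrature_exact[OF this] show ?thesis
    by (simp add: quad_def coef_def mult.assoc poly_mult_fun)
qed

lemma quad_cmult: "quad j (\<lambda>x. a * F x) = a * quad j F"
  by (simp add: quad_def sum_distrib_left mult_ac)

lemma quad_sum: "quad j (\<lambda>x. \<Sum>k\<in>A. F k x) = (\<Sum>k\<in>A. quad j (F k))"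
  by (simp add: quad_def sum_distrib_left) (rule sum.swap)

end

subsection \<open>Polynomial families graded by powers of the step size\<close>

abbreviation bigo_pow :: "nat \<Rightarrow> (real \<Rightarrow> real) set" where
  "bigo_pow n \<equiv> O[at_right 0](\<lambda>h. h ^ n)"

lemma eventually_small: "eventually (\<lambda>h::real. 0 < h \<and> h < 1) (at_right 0)"
  using eventually_at_right_real[of 0 1] by simp

lemma bigo_powI:
  assumes "f \<in> bigo_pow j" "i \<le> j"
  shows "f \<in> bigo_pow i"
proof (rule landau_o.big_trans[OF assms(1)])
  show "(\<lambda>h::real. h ^ j) \<in> bigo_pow i"
  proof (rule bigoI[of _ 1])
    show "\<forall>\<^sub>F h in at_right 0. norm (h ^ j :: real) \<le> 1 * norm (h ^ i)"
      by (rule eventually_mono[OF eventually_small]) (use assms(2) in \<open>auto intro: power_decreasing\<close>)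
  qed
qed

lemma bigo_pow_mult:
  assumes "f \<in> bigo_pow i" "g \<in> bigo_pow j" "k \<le> i + j"
  shows "(\<lambda>h. f h * g h) \<in> bigo_pow k"
  using landau_o.big_mult[OF assms(1,2)] unfolding power_add[symmetric] by (rule bigo_powI) (rule assms(3))

lemma bigo_pow_const [simp]: "(\<lambda>h. k) \<in> bigo_pow 0"
  by simp

lemma bigo_pow_id: "(\<lambda>h. h ^ k) \<in> bigo_pow k" by simp

text \<open>Modelled on smooth functions of the product h x, whose coefficient of x^k is O(h^k). The
  cap \<open>n\<close> lets a bootstrap start from mere boundedness, and the degree bound, uniform
  in h, keeps all sums over coefficients finite.\<close>

definition graded :: "nat \<Rightarrow> (real \<Rightarrow> real \<Rightarrow> real) \<Rightarrow> bool" where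
  "graded n F \<longleftrightarrow> (\<exists>q d. (\<forall>h x. F h x = poly (q h) x) \<and> (\<forall>h. degree (q h) \<le> d) \<and>
     (\<forall>k. (\<lambda>h. coeff (q h) k) \<in> bigo_pow (min k n)))"

lemma gradedI:
  assumes "\<And>h x. F h x = poly (q h) x" "\<And>h. degree (q h) \<le> d"
    "\<And>k. (\<lambda>h. coeff (q h) k) \<in> bigo_pow (min k n)"
  shows "graded n F"
  using assms unfolding graded_def by blast

lemma graded_mono:
  assumes "graded n F" "m \<le> n"
  shows "graded m F"
proof -
  have "(\<lambda>h. a h) \<in> bigo_pow (min k m)" if "a \<in> bigo_pow (min k n)" for a k
    using that by (rule bigo_powI) (use assms(2) in auto)
  then show ?thesis using assms(1) unfolding graded_def by blast
qed

lemma graded_add: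
  assumes "graded n F" "graded n G"
  shows "graded n (\<lambda>h x. F h x + G h x)"
proof -
  obtain p d where p: "\<And>h x. F h x = poly (p h) x" "\<And>h. degree (p h) \<le> d"
    "\<And>k. (\<lambda>h. coeff (p h) k) \<in> bigo_pow (min k n)"
    using assms(1) unfolding graded_def by blast
  obtain q e where q: "\<And>h x. G h x = poly (q h) x" "\<And>h. degree (q h) \<le> e"
    "\<And>k. (\<lambda>h. coeff (q h) k) \<in> bigo_pow (min k n)"
    using assms(2) unfolding graded_def by blast
  show ?thesis
  proof (rule gradedI[of _ "\<lambda>h. p h + q h" "max d e"])
    show "degree (p h + q h) \<le> max d e" for h
      using p(2)[of h] q(2)[of h] by (intro degree_add_le) auto
  qed (use p(1,3) q(1,3) in \<open>auto intro: sum_in_bigo\<close>)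
qed

lemma graded_mult:
  assumes "graded n F" "graded n G"
  shows "graded n (\<lambda>h x. F h x * G h x)"
proof -
  obtain p d where p: "\<And>h x. F h x = poly (p h) x" "\<And>h. degree (p h) \<le> d"
    "\<And>k. (\<lambda>h. coeff (p h) k) \<in> bigo_pow (min k n)"
    using assms(1) unfolding graded_def by blast
  obtain q e where q: "\<And>h x. G h x = poly (q h) x" "\<And>h. degree (q h) \<le> e"
    "\<And>k. (\<lambda>h. coeff (q h) k) \<in> bigo_pow (min k n)"
    using assms(2) unfolding graded_def by blast
  show ?thesis
  proof (rule gradedI[of _ "\<lambda>h. p h * q h" "d + e"])
    show "degree (p h * q h) \<le> d + e" for h
      using p(2)[of h] q(2)[of h] degree_mult_le[of "p h" "q h"] by linarith
    \<comment> \<open>In the convolution, \<open>min i n + min (k - i) n\<close> is at least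
      \<open>min k n\<close>.\<close>
    show "(\<lambda>h. coeff (p h * q h) k) \<in> bigo_pow (min k n)" for k
      unfolding coeff_mult
      by (intro big_sum_in_bigo bigo_pow_mult[OF p(3) q(3)]) auto
  qed (use p(1) q(1) in auto)
qed

lemma graded_sum:
  assumes "finite A" "\<And>k. k \<in> A \<Longrightarrow> graded n (F k)"
  shows "graded n (\<lambda>h x. \<Sum>k\<in>A. F k h x)"
  using assms
proof (induction A rule: finite_induct)
  case empty
  show ?case by (rule gradedI[of _ "\<lambda>h. 0" 0]) auto
next
  case (insert a A)
  then show ?case by (simp add: graded_add)
qed

lemma graded_scaled_poly:
  assumes "a \<in> bigo_pow (min d n)" "degree q \<le> d"
  shows "graded n (\<lambda>h x. a h * poly q x)"
proof (rule gradedI[of _ "\<lambda>h. Polynomial.smult (a h) q" d])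
  show "degree (Polynomial.smult (a h) q) \<le> d" for h
    using degree_smult_le[of "a h" q] assms(2) by linarith
  show "(\<lambda>h. coeff (Polynomial.smult (a h) q) k) \<in> bigo_pow (min k n)" for k
  proof (cases "k \<le> d")
    case True
    then have "a \<in> bigo_pow (min k n)" by (intro bigo_powI[OF assms(1)]) auto
    then have "(\<lambda>h. a h * coeff q k) \<in> bigo_pow (min k n)" by simp
    then show ?thesis by simp
  next
    case False
    with assms(2) have "coeff q k = 0" by (intro coeff_eq_0) auto
    then show ?thesis by simp
  qed
qed simp

lemma graded_fun_h: "a \<in> bigo_pow 0 \<Longrightarrow> graded n (\<lambda>h x. a h)"
  using graded_scaled_poly[of a 0 n "[:1:]"] by simp

text \<open>This closure property is what the Taylor polynomials are for: sums and products preserve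
  both the uniform degree bound and the grading.\<close>

lemma graded_poly_fun:
  fixes Z :: "real \<Rightarrow> real \<Rightarrow> real ^ 'm::finite"
  assumes "real_polynomial_function \<phi>" "\<And>i. graded n (\<lambda>h x. Z h x $ i)"
  shows "graded n (\<lambda>h x. \<phi> (Z h x))"
  using assms(1)
proof (induction rule: real_polynomial_function.induct)
  case (linear f)
  then have "(\<lambda>h x. f (Z h x)) = (\<lambda>h x. \<Sum>i\<in>UNIV. f (axis i 1) * Z h x $ i)"
    using linear_sum_axis[OF bounded_linear.linear] by blast
  then show ?case
    using assms(2) by (simp only:) (intro graded_sum graded_mult graded_fun_h, auto)
next
  case (const c)
  show ?case by (rule graded_fun_h) simp
qed (auto intro: graded_add graded_mult)

text \<open>The gauge \<open>e\<close> is an arbitrary function because sizes are also measured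
  against \<open>\<alpha> h * h\<close> while the size of \<open>\<alpha>\<close> is still unknown.
  The interval [0,1] contains the nodes and is the range of integration.\<close>

definition ubig :: "(real \<Rightarrow> real \<Rightarrow> real) \<Rightarrow> (real \<Rightarrow> real) \<Rightarrow> bool" where
  "ubig F e \<longleftrightarrow> (\<exists>B\<ge>0. \<forall>\<^sub>F h in at_right 0. \<forall>x\<in>{0..1}. \<bar>F h x\<bar> \<le> B * \<bar>e h\<bar>)"

lemma ubigI:
  assumes "\<forall>\<^sub>F h in at_right 0. \<forall>x\<in>{0..1}. \<bar>F h x\<bar> \<le> B * \<bar>e h\<bar>"
  shows "ubig F e"
proof -
  have "B * \<bar>e h\<bar> \<le> max B 0 * \<bar>e h\<bar>" for h by (rule mult_right_mono) auto
  then have "\<forall>\<^sub>F h in at_right 0. \<forall>x\<in>{0..1}. \<bar>F h x\<bar> \<le> max B 0 * \<bar>e h\<bar>"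
    using assms by (auto elim!: eventually_mono intro: order_trans)
  then show ?thesis unfolding ubig_def by (intro exI[of _ "max B 0"]) simp
qed

lemma ubigE:
  assumes "ubig F e"
  obtains B where "B \<ge> 0" "\<forall>\<^sub>F h in at_right 0. \<forall>x\<in>{0..1}. \<bar>F h x\<bar> \<le> B * \<bar>e h\<bar>"
  using assms unfolding ubig_def by blast

lemma ubig_trans:
  assumes "ubig F e" "e \<in> O[at_right 0](e')"
  shows "ubig F e'"
proof -
  obtain B where B: "B \<ge> 0" "\<forall>\<^sub>F h in at_right 0. \<forall>x\<in>{0..1}. \<bar>F h x\<bar> \<le> B * \<bar>e h\<bar>"
    using assms(1) by (rule ubigE)
  obtain C where "C > 0" and C: "\<forall>\<^sub>F h in at_right 0. norm (e h) \<le> C * norm (e' h)"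
    using assms(2) by (rule landau_o.bigE)
  show ?thesis
  proof (rule ubigI[of _ "B * C"])
    show "\<forall>\<^sub>F h in at_right 0. \<forall>x\<in>{0..1}. \<bar>F h x\<bar> \<le> B * C * \<bar>e' h\<bar>"
      using B(2) C
    proof eventually_elim
      case (elim h)
      have "B * \<bar>e h\<bar> \<le> B * C * \<bar>e' h\<bar>"
        using mult_left_mono[OF elim(2) B(1)] by (simp add: mult.assoc)
      with elim(1) show ?case by force
    qed
  qed
qed

lemma ubig_pow_mono: "ubig F (\<lambda>h. h ^ j) \<Longrightarrow> i \<le> j \<Longrightarrow> ubig F (\<lambda>h. h ^ i)"
  by (erule ubig_trans) (rule bigo_powI[OF bigo_pow_id])

lemma ubig_add:
  assumes "ubig F e" "ubig G e"
  shows "ubig (\<lambda>h x. F h x + G h x) e"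
proof -
  obtain B where B: "\<forall>\<^sub>F h in at_right 0. \<forall>x\<in>{0..1}. \<bar>F h x\<bar> \<le> B * \<bar>e h\<bar>"
    using assms(1) by (rule ubigE)
  obtain C where C: "\<forall>\<^sub>F h in at_right 0. \<forall>x\<in>{0..1}. \<bar>G h x\<bar> \<le> C * \<bar>e h\<bar>"
    using assms(2) by (rule ubigE)
  have "\<forall>\<^sub>F h in at_right 0. \<forall>x\<in>{0..1}. \<bar>F h x + G h x\<bar> \<le> (B + C) * \<bar>e h\<bar>"
    using B C by eventually_elim (force simp: algebra_simps)
  then show ?thesis by (rule ubigI)
qed

lemma ubig_uminus: "ubig F e \<Longrightarrow> ubig (\<lambda>h x. - F h x) e"
  by (simp add: ubig_def)

lemma ubig_diff: "ubig F e \<Longrightarrow> ubig G e \<Longrightarrow> ubig (\<lambda>h x. F h x - G h x) e"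
  using ubig_add[of F e "\<lambda>h x. - G h x"] by (simp add: ubig_uminus)

lemma ubig_sum:
  assumes "finite A" "\<And>k. k \<in> A \<Longrightarrow> ubig (F k) e"
  shows "ubig (\<lambda>h x. \<Sum>k\<in>A. F k h x) e"
  using assms
proof (induction A rule: finite_induct)
  case empty
  show ?case by (rule ubigI[of _ 0]) simp
qed (simp add: ubig_add)

lemma ubig_mult:
  assumes "ubig F e" "ubig G e'"
  shows "ubig (\<lambda>h x. F h x * G h x) (\<lambda>h. e h * e' h)"
proof -
  obtain B where B: "B \<ge> 0" "\<forall>\<^sub>F h in at_right 0. \<forall>x\<in>{0..1}. \<bar>F h x\<bar> \<le> B * \<bar>e h\<bar>"
    using assms(1) by (rule ubigE)
  obtain C where C: "C \<ge> 0" "\<forall>\<^sub>F h in at_right 0. \<forall>x\<in>{0..1}. \<bar>G h x\<bar> \<le> C * \<bar>e' h\<bar>"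
    using assms(2) by (rule ubigE)
  have "\<forall>\<^sub>F h in at_right 0. \<forall>x\<in>{0..1}. \<bar>F h x * G h x\<bar> \<le> (B * C) * \<bar>e h * e' h\<bar>"
    using B(2) C(2)
  proof eventually_elim
    case (elim h)
    show ?case
    proof
      fix x :: real assume "x \<in> {0..1}"
      with elim have "\<bar>F h x\<bar> * \<bar>G h x\<bar> \<le> (B * \<bar>e h\<bar>) * (C * \<bar>e' h\<bar>)"
        using B(1) C(1) by (intro mult_mono) auto
      then show "\<bar>F h x * G h x\<bar> \<le> (B * C) * \<bar>e h * e' h\<bar>"
        by (simp add: abs_mult mult_ac)
    qed
  qed
  then show ?thesis by (rule ubigI)
qed

lemma ubig_mult_pow:
  "ubig F (\<lambda>h. h ^ i) \<Longrightarrow> ubig G (\<lambda>h. h ^ j) \<Longrightarrow> k \<le> i + j \<Longrightarrow> ubig (\<lambda>h x. F h x * G h x) (\<lambda>h. h ^ k)"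
  using ubig_mult[of F "\<lambda>h. h ^ i" G "\<lambda>h. h ^ j"] by (simp flip: power_add add: ubig_pow_mono)

lemma ubig_fun_h:
  assumes "a \<in> O[at_right 0](e)"
  shows "ubig (\<lambda>h x. a h) e"
proof -
  obtain C where C: "\<forall>\<^sub>F h in at_right 0. norm (a h) \<le> C * norm (e h)"
    using assms by (rule landau_o.bigE)
  show ?thesis
    by (rule ubigI[of _ C]) (use C in \<open>eventually_elim, simp\<close>)
qed

lemma ubig_fun_x:
  assumes "continuous_on {0..1} f"
  shows "ubig (\<lambda>h x. f x) (\<lambda>h. h ^ 0)"
proof -
  have "bounded (f ` {0..1})"
    using assms by (intro compact_imp_bounded compact_continuous_image) auto
  then obtain B where "\<And>x. x \<in> {0..1} \<Longrightarrow> \<bar>f x\<bar> \<le> B"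
    unfolding bounded_iff by (metis imageI real_norm_def)
  then show ?thesis by (intro ubigI[of _ B]) simp
qed

lemma bigo_eval:
  assumes "ubig F e" "x \<in> {0..1}"
  shows "(\<lambda>h. F h x) \<in> O[at_right 0](e)"
proof -
  obtain B where B: "B \<ge> 0" "\<forall>\<^sub>F h in at_right 0. \<forall>x\<in>{0..1}. \<bar>F h x\<bar> \<le> B * \<bar>e h\<bar>"
    using assms(1) by (rule ubigE)
  show ?thesis
    by (rule bigoI[of _ B]) (use B(2) assms(2) in \<open>auto elim!: eventually_mono\<close>)
qed

text \<open>No integrability is needed here: the integral of a non-integrable function is \<open>0\<close>.\<close>

lemma bigo_integral:
  assumes "ubig F e"
  shows "(\<lambda>h. integral {0..1} (F h)) \<in> O[at_right 0](e)"
proof -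
  obtain B where B: "B \<ge> 0" "\<forall>\<^sub>F h in at_right 0. \<forall>x\<in>{0..1}. \<bar>F h x\<bar> \<le> B * \<bar>e h\<bar>"
    using assms by (rule ubigE)
  have le: "\<bar>integral {0..1} f\<bar> \<le> K" if "\<And>x. x \<in> {0..1} \<Longrightarrow> \<bar>f x\<bar> \<le> K" "K \<ge> 0" for f :: "real \<Rightarrow> real" and K
  proof (cases "f integrable_on {0..1}")
    case True
    then have "norm (integral {0..1} f) \<le> integral {0..1} (\<lambda>x::real. K)"
      using that by (intro integral_norm_bound_integral) auto
    then show ?thesis by simp
  next
    case False
    then show ?thesis using that(2) by (simp add: not_integrable_integral)
  qed
  show ?thesis
    by (rule bigoI[of _ B]) (use B in \<open>auto elim!: eventually_mono intro!: le mult_nonneg_nonneg\<close>)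
qed

lemma graded_ubig:
  assumes "graded n F"
  shows "ubig F (\<lambda>h. h ^ 0)"
proof -
  obtain q d where q: "\<And>h x. F h x = poly (q h) x" "\<And>h. degree (q h) \<le> d"
    "\<And>k. (\<lambda>h. coeff (q h) k) \<in> bigo_pow (min k n)"
    using assms unfolding graded_def by blast
  have "F h x = (\<Sum>k\<le>d. coeff (q h) k * x ^ k)" for h x
    using q(1,2) by (simp add: poly_eq_sum)
  moreover have "ubig (\<lambda>h x. \<Sum>k\<le>d. coeff (q h) k * x ^ k) (\<lambda>h. h ^ 0)"
    by (intro ubig_sum ubig_mult_pow[where i = 0 and j = 0] ubig_fun_h ubig_fun_x bigo_powI[OF q(3)] continuous_intros) auto
  ultimately show ?thesis by presburger
qed

section \<open>Legendre coefficients and Gauss quadrature of graded families\<close>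

context gauss
begin

text \<open>A linear functional that kills the powers below \<open>m\<close> sees only coefficients
  of index at least \<open>m\<close>, and these are small. It is used for \<open>coef j\<close>, for
  \<open>quad j\<close> and for their difference.\<close>

lemma graded_functional:
  assumes "graded n F" and T: "\<And>a d. T (\<lambda>x. \<Sum>k\<le>d. a k * x ^ k) = (\<Sum>k\<le>d. a k * T (\<lambda>x. x ^ k))"
    and T0: "\<And>k. k < m \<Longrightarrow> T (\<lambda>x. x ^ k) = 0"
  shows "(\<lambda>h. T (F h)) \<in> bigo_pow (min m n)"
proof -
  obtain q d where q: "\<And>h x. F h x = poly (q h) x" "\<And>h. degree (q h) \<le> d"
    "\<And>k. (\<lambda>h. coeff (q h) k) \<in> bigo_pow (min k n)"
    using assms(1) unfolding graded_def by blast
  have "F h = (\<lambda>x. \<Sum>k\<le>d. coeff (q h) k * x ^ k)" for h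
    using q(1,2) by (simp add: fun_eq_iff poly_eq_sum)
  then have "T (F h) = (\<Sum>k\<le>d. coeff (q h) k * T (\<lambda>x. x ^ k))" for h
    by (simp only: T)
  moreover have "(\<lambda>h. \<Sum>k\<le>d. coeff (q h) k * T (\<lambda>x. x ^ k)) \<in> bigo_pow (min m n)"
  proof (rule big_sum_in_bigo)
    fix k
    show "(\<lambda>h. coeff (q h) k * T (\<lambda>x. x ^ k)) \<in> bigo_pow (min m n)"
    proof (cases "k < m")
      case True
      then show ?thesis by (simp add: T0)
    next
      case False
      then have "(\<lambda>h. coeff (q h) k) \<in> bigo_pow (min m n)"
        by (intro bigo_powI[OF q(3)[of k]]) auto
      then show ?thesis by (simp only: cmult_in_bigo_iff' simp_thms)
    qed
  qed
  ultimately show ?thesis by simp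
qed

lemma coef_power_sum: "coef j (\<lambda>x. \<Sum>k\<le>d. a k * x ^ k) = (\<Sum>k\<le>d. a k * coef j (\<lambda>x. x ^ k))"
  using coef_sum[of "{..d}" j a "\<lambda>k. monom 1 k"] by (simp add: poly_monom[abs_def])

lemma quad_power_sum: "quad j (\<lambda>x. \<Sum>k\<le>d. a k * x ^ k) = (\<Sum>k\<le>d. a k * quad j (\<lambda>x. x ^ k))"
  by (simp add: quad_sum quad_cmult)

lemma coef_power_eq_0: "k < j \<Longrightarrow> coef j (\<lambda>x. x ^ k) = 0"
  using coef_eq_0[of "monom 1 k" j] by (simp add: poly_monom[abs_def] degree_monom_eq)

lemma quad_eq_coef_power: "j + k < 2 * s \<Longrightarrow> quad j (\<lambda>x. x ^ k) = coef j (\<lambda>x. x ^ k)"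
  using quad_eq_coef[of j "monom 1 k"] by (simp add: poly_monom[abs_def] degree_monom_eq)

lemma graded_coef: "graded n F \<Longrightarrow> (\<lambda>h. coef j (F h)) \<in> bigo_pow (min j n)"
  by (rule graded_functional[OF _ coef_power_sum coef_power_eq_0])

text \<open>For k < j < s the quadrature is exact on x^k, so \<open>quad j\<close> kills the same
  low powers as \<open>coef j\<close>.\<close>

lemma graded_quad: "graded n F \<Longrightarrow> j < s \<Longrightarrow> (\<lambda>h. quad j (F h)) \<in> bigo_pow (min j n)"
  by (rule graded_functional[OF _ quad_power_sum]) (auto simp: quad_eq_coef_power coef_power_eq_0)

text \<open>The difference kills x^k as long as j + k < 2s, by Gauss exactness.\<close>

lemma graded_quad_error:
  assumes "graded n F" "2 * s \<le> n"
  shows "(\<lambda>h. quad j (F h) - coef j (F h)) \<in> bigo_pow (2 * s - j)"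
proof -
  have "(\<lambda>h. quad j (F h) - coef j (F h)) \<in> bigo_pow (min (2 * s - j) n)"
    by (rule graded_functional[OF assms(1)])
      (auto simp: quad_eq_coef_power quad_power_sum coef_power_sum right_diff_distrib sum_subtractf)
  with assms(2) show ?thesis by simp
qed

text \<open>The superconvergence mechanism: with coefficients of size \<open>h ^ j\<close> against quadrature errors
  of size \<open>h ^ (2 * s - j)\<close>, the truncated and perturbed Parseval sum is still exact up to order
  \<open>2 * s\<close>.\<close>

lemma quad_parseval:
  assumes G: "graded n G" and F: "graded n F" and n: "2 * s \<le> n"
  shows "(\<lambda>h. (\<Sum>j<s. coef j (G h) * quad j (F h)) - integral {0..1} (\<lambda>x. G h x * F h x)) \<in> bigo_pow (2 * s)"
proof -
  obtain q d where q: "\<And>h x. G h x = poly (q h) x" "\<And>h. degree (q h) \<le> d"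
    using G unfolding graded_def by blast
  obtain p where p: "\<And>h x. F h x = poly (p h) x"
    using F unfolding graded_def by blast
  have GF: "G h = poly (q h)" "F h = poly (p h)" for h using q(1) p by auto
  \<comment> \<open>Below s a coefficient O(h^j) meets a quadrature error O(h^(2s-j)); from s on
    both coefficients are O(h^s) or smaller.\<close>
  have split: "{..<s + Suc d} = {..<s} \<union> {s..<s + Suc d}" by auto
  have "integral {0..1} (\<lambda>x. G h x * F h x) =
      (\<Sum>j<s. coef j (G h) * coef j (F h)) + (\<Sum>j\<in>{s..<s + Suc d}. coef j (G h) * coef j (F h))" for h
    unfolding GF using q(2)[of h]
    by (subst parseval[of _ "s + Suc d"], simp, subst split, subst sum.union_disjoint) auto
  then have "(\<Sum>j<s. coef j (G h) * quad j (F h)) - integral {0..1} (\<lambda>x. G h x * F h x) =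
      (\<Sum>j<s. coef j (G h) * (quad j (F h) - coef j (F h))) - (\<Sum>j\<in>{s..<s + Suc d}. coef j (G h) * coef j (F h))" for h
    by (simp add: right_diff_distrib sum_subtractf)
  moreover have "(\<lambda>h. (\<Sum>j<s. coef j (G h) * (quad j (F h) - coef j (F h))) -
      (\<Sum>j\<in>{s..<s + Suc d}. coef j (G h) * coef j (F h))) \<in> bigo_pow (2 * s)"
    using n by (intro sum_in_bigo big_sum_in_bigo bigo_pow_mult[OF graded_coef[OF G] graded_quad_error[OF F]]
        bigo_pow_mult[OF graded_coef[OF G] graded_coef[OF F]]) auto
  ultimately show ?thesis by simp
qed

end

subsection \<open>The collocation polynomial\<close>

text \<open>The explicit primitive makes the path polynomial on the whole line, whereas
  \<open>integral {0..x}\<close> would be 0 for negative x.\<close>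

definition antideriv :: "real poly \<Rightarrow> real poly" where
  "antideriv p = (\<Sum>k\<le>degree p. monom (coeff p k / real (Suc k)) (Suc k))"

lemma pderiv_antideriv: "pderiv (antideriv p) = p"
proof (rule poly_eqI)
  fix n
  have "coeff (antideriv p) (Suc n) = coeff p n / real (Suc n)"
    by (simp add: antideriv_def coeff_sum sum.delta coeff_eq_0)
  then show "coeff (pderiv (antideriv p)) n = coeff p n"
    by (simp add: coeff_pderiv)
qed

lemma degree_antideriv: "degree (antideriv p) \<le> Suc (degree p)"
  unfolding antideriv_def by (intro degree_sum_le) (auto intro: order_trans[OF degree_monom_le])

lemma poly_antideriv_0: "poly (antideriv p) 0 = 0"
  by (simp add: antideriv_def poly_sum poly_monom)

lemma integral_eq_antideriv:
  assumes "0 \<le> x"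
  shows "integral {0..x} (poly p) = poly (antideriv p) x"
proof -
  have "(poly p has_integral poly (antideriv p) x - poly (antideriv p) 0) {0..x}"
  proof (rule fundamental_theorem_of_calculus[OF assms])
    fix t
    have "(poly (antideriv p) has_real_derivative poly p t) (at t within {0..x})"
      using poly_DERIV[of "antideriv p" t] by (simp add: pderiv_antideriv has_field_derivative_at_within)
    then show "(poly (antideriv p) has_vector_derivative poly p t) (at t within {0..x})"
      by (simp add: has_real_derivative_iff_has_vector_derivative)
  qed
  then show ?thesis by (simp add: poly_antideriv_0 integral_unique)
qed

lemma graded_continuous: "graded n F \<Longrightarrow> continuous_on A (F h)"
proof -
  assume "graded n F"
  then obtain q where "\<And>x. F h x = poly (q h) x" unfolding graded_def by blast
  then have "F h = poly (q h)" by blast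
  then show ?thesis by (simp add: continuous_intros)
qed

lemma graded_integrable: "graded n F \<Longrightarrow> F h integrable_on {a..b}"
  by (intro integrable_continuous_real graded_continuous)

text \<open>Flatness is a bound in \<open>norm (x - y0)\<close>; a curve within O(h) of
  \<open>y0\<close> eventually stays in the ball where that bound holds, and turns it into a power
  of h.\<close>

lemma near_bigo_pow:
  fixes U :: "real \<Rightarrow> real \<Rightarrow> real ^ 'm::finite"
  assumes U: "ubig (\<lambda>h x. norm (U h x - y0)) (\<lambda>h. h ^ 1)"
    and \<phi>: "flat_at n y0 \<phi>"
  shows "ubig (\<lambda>h x. \<phi> (U h x)) (\<lambda>h. h ^ n)"
proof -
  obtain B where B: "B \<ge> 0" "\<forall>\<^sub>F h in at_right 0. \<forall>x\<in>{0..1}. \<bar>norm (U h x - y0)\<bar> \<le> B * \<bar>h ^ 1\<bar>"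
    using U by (rule ubigE)
  obtain C \<delta> where C: "C \<ge> 0" "\<delta> > 0" "\<And>x. x \<in> ball y0 \<delta> \<Longrightarrow> \<bar>\<phi> x\<bar> \<le> C * norm (x - y0) ^ n"
    using \<phi> by blast
  have "\<forall>\<^sub>F h in at_right 0. (0::real) < h \<and> h < \<delta> / (B + 1)"
    using eventually_at_right_real[of 0 "\<delta> / (B + 1)"] B(1) C(2) by simp
  with B(2) have "\<forall>\<^sub>F h in at_right 0. \<forall>x\<in>{0..1}. \<bar>\<phi> (U h x)\<bar> \<le> (C * B ^ n) * \<bar>h ^ n\<bar>"
  proof eventually_elim
    case (elim h)
    show ?case
    proof
      fix x :: real assume x: "x \<in> {0..1}"
      have d: "norm (U h x - y0) \<le> B * h" using elim x by auto
      also have "B * h \<le> (B + 1) * h" using elim by (intro mult_right_mono) auto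
      also have "(B + 1) * h < \<delta>" using elim B(1) by (simp add: field_simps)
      finally have "U h x \<in> ball y0 \<delta>" by (simp add: dist_norm norm_minus_commute)
      then have "\<bar>\<phi> (U h x)\<bar> \<le> C * norm (U h x - y0) ^ n" by (rule C(3))
      also have "\<dots> \<le> C * (B * h) ^ n" using d C(1) by (intro mult_left_mono power_mono) auto
      finally show "\<bar>\<phi> (U h x)\<bar> \<le> (C * B ^ n) * \<bar>h ^ n\<bar>"
        using elim by (simp add: power_mult_distrib)
    qed
  qed
  then show ?thesis by (rule ubigI)
qed

lemma ubig_norm_components:
  fixes U :: "real \<Rightarrow> real \<Rightarrow> real ^ 'm::finite"
  assumes "\<And>i. ubig (\<lambda>h x. U h x $ i) e"
  shows "ubig (\<lambda>h x. norm (U h x)) e"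
proof -
  have "ubig (\<lambda>h x. \<Sum>i\<in>UNIV. \<bar>U h x $ i\<bar>) e"
    using assms by (intro ubig_sum) (auto simp: ubig_def)
  then obtain B where "\<forall>\<^sub>F h in at_right 0. \<forall>x\<in>{0..1}. \<bar>\<Sum>i\<in>UNIV. \<bar>U h x $ i\<bar>\<bar> \<le> B * \<bar>e h\<bar>"
    by (rule ubigE)
  then have "\<forall>\<^sub>F h in at_right 0. \<forall>x\<in>{0..1}. \<bar>norm (U h x)\<bar> \<le> B * \<bar>e h\<bar>"
    by eventually_elim (use norm_le_l1_cart order_trans in \<open>fastforce simp: sum_nonneg\<close>)
  then show ?thesis by (rule ubigI)
qed

text \<open>The gauge \<open>e\<close> stays abstract since it will be
  \<open>\<alpha> h * h\<close>. Its boundedness provides one radius for which the Taylor constant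
  holds for all small h.\<close>

lemma taylor2_ubig:
  fixes U D :: "real \<Rightarrow> real \<Rightarrow> real ^ 'm::finite"
  assumes \<phi>: "real_polynomial_function \<phi>"
    and U: "ubig (\<lambda>h x. norm (U h x)) (\<lambda>h. h ^ 0)"
    and D: "ubig (\<lambda>h x. norm (D h x)) e" and e: "e \<in> bigo_pow 0"
  shows "ubig (\<lambda>h x. \<phi> (U h x + D h x) - \<phi> (U h x) - (\<Sum>l\<in>UNIV. partial l \<phi> (U h x) * D h x $ l)) (\<lambda>h. (e h)\<^sup>2)"
proof -
  obtain A where A: "A \<ge> 0" "\<forall>\<^sub>F h in at_right 0. \<forall>x\<in>{0..1}. \<bar>norm (U h x)\<bar> \<le> A * \<bar>h ^ 0\<bar>"
    using U by (rule ubigE)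
  obtain B where B: "B \<ge> 0" "\<forall>\<^sub>F h in at_right 0. \<forall>x\<in>{0..1}. \<bar>norm (D h x)\<bar> \<le> B * \<bar>e h\<bar>"
    using D by (rule ubigE)
  obtain E where E: "E > 0" "\<forall>\<^sub>F h in at_right 0. norm (e h) \<le> E * norm (h ^ 0)"
    using e by (rule landau_o.bigE)
  obtain M where M: "M \<ge> 0" "\<And>a d. norm a \<le> max A (B * E) \<Longrightarrow> norm d \<le> max A (B * E) \<Longrightarrow>
      \<bar>\<phi> (a + d) - \<phi> a - (\<Sum>l\<in>UNIV. partial l \<phi> a * d $ l)\<bar> \<le> M * (norm d)\<^sup>2"
    using real_polynomial_taylor2[OF \<phi>] by blast
  have "\<forall>\<^sub>F h in at_right 0. \<forall>x\<in>{0..1}. \<bar>\<phi> (U h x + D h x) - \<phi> (U h x) -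
      (\<Sum>l\<in>UNIV. partial l \<phi> (U h x) * D h x $ l)\<bar> \<le> (M * B\<^sup>2) * \<bar>(e h)\<^sup>2\<bar>"
    using A(2) B(2) E(2)
  proof eventually_elim
    case (elim h)
    show ?case
    proof
      fix x :: real assume x: "x \<in> {0..1}"
      have u: "norm (U h x) \<le> A" and d: "norm (D h x) \<le> B * \<bar>e h\<bar>" using elim x by auto
      have "B * \<bar>e h\<bar> \<le> B * E" using elim(3) B(1) by (intro mult_left_mono) auto
      with u d have "\<bar>\<phi> (U h x + D h x) - \<phi> (U h x) - (\<Sum>l\<in>UNIV. partial l \<phi> (U h x) * D h x $ l)\<bar>
          \<le> M * (norm (D h x))\<^sup>2" by (intro M(2)) auto
      also have "\<dots> \<le> M * (B * \<bar>e h\<bar>)\<^sup>2" using d M(1) by (intro mult_left_mono power_mono) auto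
      finally show "\<bar>\<phi> (U h x + D h x) - \<phi> (U h x) -
          (\<Sum>l\<in>UNIV. partial l \<phi> (U h x) * D h x $ l)\<bar> \<le> (M * B\<^sup>2) * \<bar>(e h)\<^sup>2\<bar>"
        by (simp add: power_mult_distrib mult.assoc)
    qed
  qed
  then show ?thesis by (rule ubigI)
qed

context gauss
begin

lemma bigo_coef: "ubig F e \<Longrightarrow> (\<lambda>h. coef j (F h)) \<in> O[at_right 0](e)"
proof -
  assume "ubig F e"
  then have "ubig (\<lambda>h x. poly (P j) x * F h x) (\<lambda>h. h ^ 0 * e h)"
    by (intro ubig_mult ubig_fun_x continuous_intros)
  from bigo_integral[OF this] show ?thesis by (simp add: coef_def)
qed

lemma bigo_quad: "ubig F e \<Longrightarrow> (\<lambda>h. quad j (F h)) \<in> O[at_right 0](e)"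
  unfolding quad_def using bigo_eval[OF _ node_range] by (intro big_sum_in_bigo) fastforce

definition collocation :: "real ^ 'm \<Rightarrow> real \<Rightarrow> (nat \<Rightarrow> real ^ 'm) \<Rightarrow> real \<Rightarrow> real ^ 'm" where
  "collocation y0 h \<gamma> x = y0 + h *\<^sub>R (\<Sum>j<s. poly (antideriv (P j)) x *\<^sub>R \<gamma> j)"

text \<open>At a node this is the row of the matrix product of \<open>P_mat\<close> and
  \<open>W_mat\<close> applied to \<open>\<gamma>\<close>: \<open>W_mat\<close> moves column 1 to
  column 0 and minus column 0, which is constantly 1, to column 1.\<close>

definition skew :: "(nat \<Rightarrow> real ^ 'm) \<Rightarrow> real \<Rightarrow> real ^ 'm" where
  "skew \<gamma> x = poly (P 1) x *\<^sub>R \<gamma> 0 - \<gamma> 1"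

lemma stage_matrix_apply:
  assumes "k < s"
  shows "y0 + h *\<^sub>R kron_apply (I_mat P s c - \<alpha> \<cdot>\<^sub>m (P_mat P s c * W_mat s)) \<gamma> k =
    collocation y0 h \<gamma> (c k) - (\<alpha> * h) *\<^sub>R skew \<gamma> (c k)"
proof -
  define M where "M = P_mat P s c * W_mat s"
  have dim: "dim_row M = s" "dim_col M = s" by (simp_all add: M_def P_mat_def W_mat_def)
  have M: "M $$ (k, j) = (if j = 0 then poly (P 1) (c k) else 0) - (if j = 1 then 1 else 0)" if "j < s" for j
  proof -
    have "M $$ (k, j) = (\<Sum>l<s. poly (P l) (c k) * (if l = 1 \<and> j = 0 then 1 else if l = 0 \<and> j = 1 then - 1 else 0))"
      using assms that by (simp add: M_def P_mat_def W_mat_def scalar_prod_def lessThan_atLeast0)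
    also have "\<dots> = (\<Sum>l<s. (if l = 1 then (if j = 0 then poly (P 1) (c k) else 0) else 0) -
        (if l = 0 then (if j = 1 then 1 else 0) else 0))"
      by (intro sum.cong) (auto simp: P_0)
    also have "\<dots> = (if j = 0 then poly (P 1) (c k) else 0) - (if j = 1 then 1 else 0)"
      using s2 by (simp add: sum_subtractf sum.delta)
    finally show ?thesis .
  qed
  have "kron_apply (I_mat P s c - \<alpha> \<cdot>\<^sub>m M) \<gamma> k =
     (\<Sum>j<s. poly (antideriv (P j)) (c k) *\<^sub>R \<gamma> j - \<alpha> *\<^sub>R (M $$ (k, j) *\<^sub>R \<gamma> j))"
    unfolding kron_apply_def using assms node_range[OF assms] dim
    by (intro sum.cong) (auto simp: I_mat_def integral_eq_antideriv algebra_simps)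
  also have "\<dots> = (\<Sum>j<s. poly (antideriv (P j)) (c k) *\<^sub>R \<gamma> j) - \<alpha> *\<^sub>R (\<Sum>j<s. M $$ (k, j) *\<^sub>R \<gamma> j)"
    by (simp add: sum_subtractf scaleR_sum_right)
  also have "(\<Sum>j<s. M $$ (k, j) *\<^sub>R \<gamma> j) =
      (\<Sum>j<s. (if j = 0 then poly (P 1) (c k) *\<^sub>R \<gamma> 0 else 0) - (if j = 1 then \<gamma> 1 else 0))"
    by (intro sum.cong) (auto simp: M)
  also have "\<dots> = skew \<gamma> (c k)"
    using s2 by (simp add: sum_subtractf sum.delta skew_def)
  finally show ?thesis
    unfolding M_def collocation_def by (simp add: scaleR_diff_right mult.commute)
qed

lemma Psi_eq:
  assumes "j < s"
  shows "Psi P s c f y0 h \<alpha> \<gamma> j =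
    (\<Sum>k<s. (weight s c k * poly (P j) (c k)) *\<^sub>R f (collocation y0 h \<gamma> (c k) - (\<alpha> * h) *\<^sub>R skew \<gamma> (c k)))"
proof -
  define M where "M = transpose_mat (P_mat P s c) * Omega_mat s c"
  have dim: "dim_col M = s" by (simp add: M_def Omega_mat_def)
  have M: "M $$ (j, k) = weight s c k * poly (P j) (c k)" if "k < s" for k
  proof -
    have "M $$ (j, k) = (\<Sum>l<s. poly (P j) (c l) * (if l = k then weight s c l else 0))"
      using assms that by (simp add: M_def P_mat_def Omega_mat_def scalar_prod_def lessThan_atLeast0)
    also have "\<dots> = weight s c k * poly (P j) (c k)"
      using that by (simp add: if_distrib sum.delta mult.commute cong: if_cong)
    finally show ?thesis .
  qed
  show ?thesis
    unfolding Psi_def M_def[symmetric] kron_apply_def[of M] dim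
    by (intro sum.cong refl) (simp add: M stage_matrix_apply)
qed

lemma collocation_0: "collocation y0 h \<gamma> 0 = y0"
  by (simp add: collocation_def poly_antideriv_0)

text \<open>Only \<open>P 0\<close> has non-zero mean. The unperturbed path therefore ends at the
  numerical solution, although the stages lie on the perturbed one.\<close>

lemma collocation_1: "collocation y0 h \<gamma> 1 = y0 + h *\<^sub>R \<gamma> 0"
proof -
  have "poly (antideriv (P j)) 1 = (if j = 0 then 1 else 0)" for j
    using integral_eq_antideriv[of 1 "P j"] integral_P[of j] by simp
  then show ?thesis
    using s2 by (simp add: collocation_def if_distrib[of "\<lambda>t. t *\<^sub>R _"] sum.delta cong: if_cong)
qed

lemma collocation_nth:
  "collocation y0 h \<gamma> x $ i = y0 $ i + (\<Sum>j<s. (h * \<gamma> j $ i) * poly (antideriv (P j)) x)"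
  by (simp add: collocation_def sum_distrib_left mult_ac)

lemma has_derivative_collocation:
  "(collocation y0 h \<gamma> has_vector_derivative h *\<^sub>R (\<Sum>j<s. poly (P j) x *\<^sub>R \<gamma> j)) (at x within A)"
proof -
  have "((\<lambda>x. poly (antideriv (P j)) x) has_real_derivative poly (P j) x) (at x within A)" for j
    using poly_DERIV[of "antideriv (P j)" x] by (simp add: pderiv_antideriv has_field_derivative_at_within)
  then show ?thesis
    unfolding collocation_def
    by (auto intro!: derivative_eq_intros simp: has_real_derivative_iff_has_vector_derivative pderiv_antideriv)
qed

end

subsection \<open>Size of the stage coefficients\<close>

text \<open>Here \<open>p i\<close> is a Taylor polynomial of component \<open>i\<close> of
  \<open>f\<close>, and the method enters through its stage equations and \<open>\<alpha>\<close> =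
  O(h^2). The equation for \<open>\<alpha>\<close> comes in later, as the conservation assumption of
  \<open>alpha_order\<close>.\<close>

locale equip_run = gauss P s c
  for P :: "nat \<Rightarrow> real poly" and s :: nat and c :: "nat \<Rightarrow> real" +
  fixes f :: "real ^ 'm::finite \<Rightarrow> real ^ 'm" and p :: "'m \<Rightarrow> real ^ 'm \<Rightarrow> real"
    and y0 :: "real ^ 'm" and \<alpha> :: "real \<Rightarrow> real" and \<gamma> :: "real \<Rightarrow> nat \<Rightarrow> real ^ 'm" and L :: real
  assumes lipschitz: "L-lipschitz_on UNIV f"
    and poly_p: "\<And>i. real_polynomial_function (p i)"
    and p_approx: "\<And>i. flat_at (2 * s + 2) y0 (\<lambda>x. f x $ i - p i x)"
    and alpha: "\<alpha> \<in> bigo_pow 2"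
    and stages: "\<forall>\<^sub>F h in at_right 0. \<forall>j<s. \<gamma> h j = Psi P s c f y0 h (\<alpha> h) (\<gamma> h) j"
begin

definition S :: "real \<Rightarrow> real \<Rightarrow> real ^ 'm" where
  "S h x = collocation y0 h (\<gamma> h) x"

definition Z :: "real \<Rightarrow> real \<Rightarrow> real ^ 'm" where
  "Z h x = S h x - (\<alpha> h * h) *\<^sub>R skew (\<gamma> h) x"

lemma gamma_quad: "\<forall>\<^sub>F h in at_right 0. \<forall>j<s. \<forall>i. \<gamma> h j $ i = quad j (\<lambda>x. f (Z h x) $ i)"
  using stages
proof eventually_elim
  case (elim h)
  show ?case
  proof (intro allI impI)
    fix j i assume "j < s"
    then have "\<gamma> h j = (\<Sum>k<s. (weight s c k * poly (P j) (c k)) *\<^sub>R f (Z h (c k)))"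
      using elim Psi_eq[of j] by (simp add: Z_def S_def)
    then have "\<gamma> h j $ i = (\<Sum>k<s. (weight s c k * poly (P j) (c k)) *\<^sub>R f (Z h (c k))) $ i" by simp
    then show "\<gamma> h j $ i = quad j (\<lambda>x. f (Z h x) $ i)"
      by (simp add: quad_def)
  qed
qed

lemma S_nth: "S h x $ i = y0 $ i + (\<Sum>j<s. (h * \<gamma> h j $ i) * poly (antideriv (P j)) x)"
  by (simp add: S_def collocation_nth)

lemma Z_nth: "Z h x $ i = S h x $ i - (\<alpha> h * h * \<gamma> h 0 $ i) * poly (P 1) x + \<alpha> h * h * \<gamma> h 1 $ i"
  by (simp add: Z_def skew_def algebra_simps)

lemma alpha_h: "(\<lambda>h. \<alpha> h * h) \<in> bigo_pow 3"
  using bigo_pow_mult[OF alpha bigo_pow_id[of 1], of 3] by simp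

text \<open>The bound is linear in the sum of the coefficient norms and carries a factor h, so that
  the Lipschitz estimate can absorb that sum for small h.\<close>

lemma bounded_stages:
  "\<exists>M\<ge>0. \<forall>h x. \<bar>\<alpha> h\<bar> \<le> 1 \<longrightarrow> 0 \<le> h \<longrightarrow> x \<in> {0..1} \<longrightarrow>
     norm (Z h x - y0) \<le> h * (M * (\<Sum>j<s. norm (\<gamma> h j)))"
proof -
  have "\<exists>B. \<forall>x\<in>{0..1}. \<bar>poly q x\<bar> \<le> B" for q :: "real poly"
  proof -
    have "bounded (poly q ` {0..1})"
      by (intro compact_imp_bounded compact_continuous_image continuous_intros) auto
    then show ?thesis unfolding bounded_iff by (metis imageI real_norm_def)
  qed
  then have "\<forall>q::real poly. \<exists>B. \<forall>x\<in>{0..1}. \<bar>poly q x\<bar> \<le> B" by blast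
  from choice[OF this] obtain B :: "real poly \<Rightarrow> real"
    where "\<forall>q. \<forall>x\<in>{0..1}. \<bar>poly q x\<bar> \<le> B q" ..
  then have B: "\<bar>poly q x\<bar> \<le> B q" if "x \<in> {0..1}" for q x using that by blast
  have Bp: "B q \<ge> 0" for q using B[of 0 q] by (meson abs_ge_zero atLeastAtMost_iff order_trans zero_le_one order_refl)
  define A where "A = (\<Sum>j<s. B (antideriv (P j)))"
  define M where "M = A + (B (P 1) + 1)"
  have "A \<ge> 0" unfolding A_def by (intro sum_nonneg Bp)
  have "norm (Z h x - y0) \<le> h * (M * (\<Sum>j<s. norm (\<gamma> h j)))"
    if a: "\<bar>\<alpha> h\<bar> \<le> 1" and h: "0 \<le> h" and x: "x \<in> {0..1}" for h x
  proof -
    define G where "G = (\<Sum>j<s. norm (\<gamma> h j))"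
    have G: "norm (\<gamma> h j) \<le> G" if "j < s" for j
      unfolding G_def using that by (intro member_le_sum) auto
    have "norm (\<Sum>j<s. poly (antideriv (P j)) x *\<^sub>R \<gamma> h j) \<le> (\<Sum>j<s. B (antideriv (P j)) * G)"
      using B[OF x] G Bp by (intro order_trans[OF norm_sum] sum_mono) (auto intro!: mult_mono)
    then have 1: "norm (\<Sum>j<s. poly (antideriv (P j)) x *\<^sub>R \<gamma> h j) \<le> A * G"
      by (simp add: A_def sum_distrib_right)
    have "norm (skew (\<gamma> h) x) \<le> norm (poly (P 1) x *\<^sub>R \<gamma> h 0) + norm (\<gamma> h 1)"
      unfolding skew_def by (rule norm_triangle_ineq4)
    also have "\<dots> \<le> B (P 1) * G + G"
      using B[OF x] G s2 Bp by (auto intro!: add_mono mult_mono)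
    finally have 2: "norm (skew (\<gamma> h) x) \<le> (B (P 1) + 1) * G" by (simp add: algebra_simps)
    have 3: "norm (\<alpha> h *\<^sub>R skew (\<gamma> h) x) \<le> 1 * ((B (P 1) + 1) * G)"
      unfolding norm_scaleR real_norm_def by (rule mult_mono[OF a 2]) auto
    have "Z h x - y0 = h *\<^sub>R ((\<Sum>j<s. poly (antideriv (P j)) x *\<^sub>R \<gamma> h j) - \<alpha> h *\<^sub>R skew (\<gamma> h) x)"
      by (simp add: Z_def S_def collocation_def scaleR_diff_right mult.commute)
    then have "norm (Z h x - y0) = h * norm ((\<Sum>j<s. poly (antideriv (P j)) x *\<^sub>R \<gamma> h j) - \<alpha> h *\<^sub>R skew (\<gamma> h) x)"
      using h by simp
    also have "norm ((\<Sum>j<s. poly (antideriv (P j)) x *\<^sub>R \<gamma> h j) - \<alpha> h *\<^sub>R skew (\<gamma> h) x)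
        \<le> A * G + 1 * ((B (P 1) + 1) * G)"
      by (intro order_trans[OF norm_triangle_ineq4] add_mono 1 3)
    also have "\<dots> = M * G" by (simp add: M_def algebra_simps)
    finally show ?thesis using h by (simp add: G_def mult_left_mono)
  qed
  moreover have "M \<ge> 0" using \<open>A \<ge> 0\<close> Bp[of "P 1"] by (simp add: M_def)
  ultimately show ?thesis by blast
qed

text \<open>Lipschitz continuity bounds every solution of the stage equations, however it was found.\<close>

lemma gamma_bounded: "j < s \<Longrightarrow> (\<lambda>h. \<gamma> h j $ i) \<in> bigo_pow 0"
proof -
  assume j: "j < s"
  obtain M where M: "M \<ge> 0" "\<And>h x. \<bar>\<alpha> h\<bar> \<le> 1 \<Longrightarrow> 0 \<le> h \<Longrightarrow> x \<in> {0..1} \<Longrightarrow>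
     norm (Z h x - y0) \<le> h * (M * (\<Sum>j<s. norm (\<gamma> h j)))"
    using bounded_stages by blast
  define A where "A = (\<Sum>j<s. \<Sum>k<s. \<bar>weight s c k * poly (P j) (c k)\<bar>)"
  have "A \<ge> 0" unfolding A_def by (intro sum_nonneg) auto
  have L: "L \<ge> 0" using lipschitz by (rule lipschitz_on_nonneg)
  \<comment> \<open>Below \<open>r\<close> the product of A, L, M and h is at most 1/2, which lets
    half of G be absorbed; the summand 1 guards against a zero denominator.\<close>
  define r where "r = 1 / (2 * A * L * M + 1)"
  have "r > 0" using \<open>A \<ge> 0\<close> L M(1) by (simp add: r_def add_nonneg_pos)
  have "\<forall>\<^sub>F h in at_right 0. norm (\<alpha> h) \<le> 1"
  proof -
    have "\<alpha> \<in> bigo_pow 1" using alpha by (rule bigo_powI) simp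
    then have "\<alpha> \<in> O[at_right 0](\<lambda>h. h)" by simp
    moreover have "(\<lambda>h::real. h) \<in> o[at_right 0](\<lambda>_. 1)"
      by (rule smalloI_tendsto) (auto intro: tendsto_eq_intros)
    ultimately have "\<alpha> \<in> o[at_right 0](\<lambda>_. 1)" by (rule landau_o.big_small_trans)
    from landau_o.smallD[OF this, of 1] show ?thesis by simp
  qed
  moreover have "\<forall>\<^sub>F h in at_right 0. 0 < h \<and> h < r"
    using eventually_at_right_real[OF \<open>r > 0\<close>] by simp
  ultimately have "\<forall>\<^sub>F h in at_right 0. \<bar>\<gamma> h j $ i\<bar> \<le> (2 * A * norm (f y0)) * 1"
    using stages
  proof eventually_elim
    case (elim h)
    define G where "G = (\<Sum>j<s. norm (\<gamma> h j))"
    define R where "R = norm (f y0) + L * (h * (M * G))"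
    have "G \<ge> 0" unfolding G_def by (intro sum_nonneg) auto
    have fZ: "norm (f (Z h (c k))) \<le> R" if "k < s" for k
    proof -
      have "norm (f (Z h (c k)) - f y0) \<le> L * norm (Z h (c k) - y0)"
        using lipschitz_on_normD[OF lipschitz] by simp
      also have "\<dots> \<le> L * (h * (M * G))"
        unfolding G_def using elim node_range[OF that] by (intro mult_left_mono M(2) L) auto
      finally show ?thesis unfolding R_def
        using norm_triangle_ineq2[of "f (Z h (c k))" "f y0"] by linarith
    qed
    have "norm (\<gamma> h j) \<le> (\<Sum>k<s. \<bar>weight s c k * poly (P j) (c k)\<bar> * R)" if "j < s" for j
    proof -
      have "\<gamma> h j = (\<Sum>k<s. (weight s c k * poly (P j) (c k)) *\<^sub>R f (Z h (c k)))"
        using elim(3) Psi_eq[OF that, of f y0 h "\<alpha> h" "\<gamma> h"] that by (simp add: Z_def S_def)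
      also have "norm \<dots> \<le> (\<Sum>k<s. \<bar>weight s c k * poly (P j) (c k)\<bar> * R)"
        by (intro order_trans[OF norm_sum] sum_mono) (auto intro!: mult_left_mono fZ)
      finally show ?thesis .
    qed
    then have "G \<le> (\<Sum>j<s. \<Sum>k<s. \<bar>weight s c k * poly (P j) (c k)\<bar> * R)"
      unfolding G_def by (intro sum_mono) auto
    also have "\<dots> = A * R"
      by (simp add: A_def sum_distrib_right)
    also have "\<dots> = A * norm (f y0) + (A * L * M * h) * G"
      by (simp add: R_def algebra_simps)
    also have "A * L * M * h \<le> 1 / 2"
    proof -
      have "(A * L * M) * h \<le> (A * L * M) * r"
        using elim L M(1) \<open>A \<ge> 0\<close> by (intro mult_left_mono) auto
      also have "\<dots> \<le> 1 / 2" using L M(1) \<open>A \<ge> 0\<close> unfolding r_def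
        by (simp add: divide_le_eq add_nonneg_pos)
      finally show ?thesis .
    qed
    finally have "G \<le> A * norm (f y0) + 1 / 2 * G"
      using \<open>G \<ge> 0\<close> by (simp add: mult_right_mono)
    then have "G \<le> 2 * A * norm (f y0)" by simp
    moreover have "\<bar>\<gamma> h j $ i\<bar> \<le> norm (\<gamma> h j)" by (rule component_le_norm_cart)
    moreover have "norm (\<gamma> h j) \<le> G" unfolding G_def using j by (intro member_le_sum) auto
    ultimately show ?case by simp
  qed
  then show ?thesis by (intro bigoI[of _ "2 * A * norm (f y0)"]) simp
qed

text \<open>Integration in x raises the degree of \<open>P j\<close> by one and the step size
  supplies the matching power of h. This gain from \<open>n\<close> to \<open>Suc n\<close> drives
  the bootstrap.\<close>

lemma graded_S:
  assumes "\<And>j i. j < s \<Longrightarrow> (\<lambda>h. \<gamma> h j $ i) \<in> bigo_pow (min j n)"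
  shows "graded (Suc n) (\<lambda>h x. S h x $ i)"
proof -
  have "graded (Suc n) (\<lambda>h x. (h * \<gamma> h j $ i) * poly (antideriv (P j)) x)" if "j < s" for j
  proof (rule graded_scaled_poly[where d = "Suc j"])
    show "(\<lambda>h. h * \<gamma> h j $ i) \<in> bigo_pow (min (Suc j) (Suc n))"
      using bigo_pow_mult[OF bigo_pow_id[of 1] assms[OF that], of "Suc (min j n)" i] by simp
    show "degree (antideriv (P j)) \<le> Suc j"
      using degree_antideriv[of "P j"] by (simp add: degree_P)
  qed
  then show ?thesis
    unfolding S_nth by (intro graded_add graded_sum graded_fun_h) auto
qed

text \<open>The perturbation has degree 1 in x and size O(h^3), so it satisfies the grading at every
  cap.\<close>

lemma graded_Z:
  assumes "\<And>j i. j < s \<Longrightarrow> (\<lambda>h. \<gamma> h j $ i) \<in> bigo_pow (min j n)"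
  shows "graded (Suc n) (\<lambda>h x. Z h x $ i)"
proof -
  have "(\<lambda>h. \<alpha> h * h * \<gamma> h j $ i) \<in> bigo_pow 3" if "j < s" for j
    using bigo_pow_mult[OF alpha_h gamma_bounded[OF that]] by simp
  then have g: "(\<lambda>h. \<alpha> h * h * \<gamma> h j $ i) \<in> bigo_pow k" if "j < s" "k \<le> 3" for j k
    using that bigo_powI by blast
  have "graded (Suc n) (\<lambda>h x. - (\<alpha> h * h * \<gamma> h 0 $ i) * poly (P 1) x)"
    using g[of 0 1] s2 by (intro graded_scaled_poly[where d = 1]) (auto simp: degree_P)
  moreover have "graded (Suc n) (\<lambda>h x. \<alpha> h * h * \<gamma> h 1 $ i)"
    using g[of 1 0] s2 by (intro graded_fun_h) auto
  moreover have "Z h x $ i = (S h x $ i + - (\<alpha> h * h * \<gamma> h 0 $ i) * poly (P 1) x) + \<alpha> h * h * \<gamma> h 1 $ i" for h x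
    unfolding Z_nth by simp
  ultimately show ?thesis
    by (simp only:) (intro graded_add graded_S assms, auto)
qed

lemma near_S: "ubig (\<lambda>h x. norm (S h x - y0)) (\<lambda>h. h ^ 1)"
proof (rule ubig_norm_components)
  fix i
  have "ubig (\<lambda>h x. \<Sum>j<s. (h * \<gamma> h j $ i) * poly (antideriv (P j)) x) (\<lambda>h. h ^ 1)"
  proof (rule ubig_sum, simp, rule ubig_mult_pow[where i = 1 and j = 0 and k = 1])
    fix j assume "j \<in> {..<s}"
    then have "(\<lambda>h. h * \<gamma> h j $ i) \<in> bigo_pow 1"
      using bigo_pow_mult[OF bigo_pow_id[of 1] gamma_bounded[of j i], of 1] by simp
    then show "ubig (\<lambda>h x. h * \<gamma> h j $ i) (\<lambda>h. h ^ 1)" by (rule ubig_fun_h)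
    show "ubig (\<lambda>h x. poly (antideriv (P j)) x) (\<lambda>h. h ^ 0)"
      by (rule ubig_fun_x) (intro continuous_intros)
  qed simp
  then show "ubig (\<lambda>h x. (S h x - y0) $ i) (\<lambda>h. h ^ 1)" by (simp add: S_nth)
qed

lemma skew_bounded: "ubig (\<lambda>h x. norm (skew (\<gamma> h) x)) (\<lambda>h. h ^ 0)"
proof (rule ubig_norm_components)
  fix i
  show "ubig (\<lambda>h x. skew (\<gamma> h) x $ i) (\<lambda>h. h ^ 0)"
    unfolding skew_def vector_minus_component vector_scaleR_component real_scaleR_def using s2
    by (intro ubig_diff ubig_mult_pow[where i = 0 and j = 0] ubig_fun_h ubig_fun_x gamma_bounded continuous_intros) auto
qed

lemma skew_small: "ubig (\<lambda>h x. norm ((k * \<alpha> h * h) *\<^sub>R skew (\<gamma> h) x)) (\<lambda>h. \<alpha> h * h)"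
proof -
  have "ubig (\<lambda>h x. \<bar>k * \<alpha> h * h\<bar> * norm (skew (\<gamma> h) x)) (\<lambda>h. (\<alpha> h * h) * h ^ 0)"
    by (intro ubig_mult skew_bounded ubig_fun_h bigoI[of _ "\<bar>k\<bar>"]) (simp add: abs_mult)
  then show ?thesis by simp
qed

lemma near_Z: "ubig (\<lambda>h x. norm (Z h x - y0)) (\<lambda>h. h ^ 1)"
proof -
  have "ubig (\<lambda>h x. norm ((1 * \<alpha> h * h) *\<^sub>R skew (\<gamma> h) x)) (\<lambda>h. h ^ 1)"
    by (rule ubig_trans[OF skew_small]) (rule bigo_powI[OF alpha_h], simp)
  from ubig_add[OF near_S this] obtain B where
    "\<forall>\<^sub>F h in at_right 0. \<forall>x\<in>{0..1}. \<bar>norm (S h x - y0) + norm ((1 * \<alpha> h * h) *\<^sub>R skew (\<gamma> h) x)\<bar> \<le> B * \<bar>h ^ 1\<bar>"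
    by (rule ubigE)
  then have "\<forall>\<^sub>F h in at_right 0. \<forall>x\<in>{0..1}. \<bar>norm (Z h x - y0)\<bar> \<le> B * \<bar>h ^ 1\<bar>"
  proof eventually_elim
    case (elim h)
    show ?case
    proof
      fix x :: real assume "x \<in> {0..1}"
      with elim have "norm (S h x - y0) + norm ((1 * \<alpha> h * h) *\<^sub>R skew (\<gamma> h) x) \<le> B * \<bar>h ^ 1\<bar>"
        by fastforce
      moreover have "norm (Z h x - y0) = norm ((S h x - y0) - (1 * \<alpha> h * h) *\<^sub>R skew (\<gamma> h) x)"
        by (rule arg_cong[of _ _ norm]) (simp add: Z_def)
      ultimately show "\<bar>norm (Z h x - y0)\<bar> \<le> B * \<bar>h ^ 1\<bar>"
        using norm_triangle_ineq4[of "S h x - y0" "(1 * \<alpha> h * h) *\<^sub>R skew (\<gamma> h) x"]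
        unfolding abs_norm_cancel by linarith
    qed
  qed
  then show ?thesis by (rule ubigI)
qed

lemma gamma_approx:
  assumes "j < s"
  shows "(\<lambda>h. \<gamma> h j $ i - quad j (\<lambda>x. p i (Z h x))) \<in> bigo_pow (2 * s + 2)"
proof -
  have "(\<lambda>h. quad j (\<lambda>x. f (Z h x) $ i - p i (Z h x))) \<in> bigo_pow (2 * s + 2)"
    by (intro bigo_quad near_bigo_pow[OF near_Z, where \<phi> = "\<lambda>x. f x $ i - p i x"] p_approx)
  moreover have c: "\<forall>\<^sub>F h in at_right 0. \<gamma> h j $ i - quad j (\<lambda>x. p i (Z h x)) =
      quad j (\<lambda>x. f (Z h x) $ i - p i (Z h x))"
    using gamma_quad
    by eventually_elim (simp add: assms quad_def right_diff_distrib sum_subtractf)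
  ultimately show ?thesis using landau_o.big.in_cong[OF c] by blast
qed

text \<open>Bootstrap: bounds on \<open>\<gamma>\<close> capped at \<open>n\<close> make Z, and
  hence p(Z), graded up to \<open>n + 1\<close>, and quadrature returns bounds capped at
  \<open>n + 1\<close>. The truncation error of \<open>f\<close> limits how far this goes.\<close>

lemma gamma_graded_aux:
  "n \<le> 2 * s + 2 \<Longrightarrow> j < s \<Longrightarrow> (\<lambda>h. \<gamma> h j $ i) \<in> bigo_pow (min j n)"
proof (induction n arbitrary: j i)
  case 0
  then show ?case using gamma_bounded by simp
next
  case (Suc n)
  have "graded (Suc n) (\<lambda>h x. Z h x $ i)" for i
    using Suc by (intro graded_Z) auto
  then have a: "(\<lambda>h. quad j (\<lambda>x. p i (Z h x))) \<in> bigo_pow (min j (Suc n))"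
    by (intro graded_quad[OF graded_poly_fun[OF poly_p]] Suc.prems(2))
  have "(\<lambda>h. \<gamma> h j $ i - quad j (\<lambda>x. p i (Z h x))) \<in> bigo_pow (min j (Suc n))"
    using Suc.prems by (intro bigo_powI[OF gamma_approx]) auto
  from sum_in_bigo(1)[OF this a] show ?case by simp
qed

lemma gamma_order: "j < s \<Longrightarrow> (\<lambda>h. \<gamma> h j $ i) \<in> bigo_pow j"
  using gamma_graded_aux[of "2 * s + 2" j i] by (simp add: min_def)

lemma S_graded: "graded (2 * s) (\<lambda>h x. S h x $ i)"
  by (intro graded_mono[OF graded_S[of "2 * s + 2"]] gamma_graded_aux) auto

lemma Z_graded: "graded (2 * s) (\<lambda>h x. Z h x $ i)"
  by (intro graded_mono[OF graded_Z[of "2 * s + 2"]] gamma_graded_aux) auto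

lemma poly_S_graded: "real_polynomial_function \<phi> \<Longrightarrow> graded (2 * s) (\<lambda>h x. \<phi> (S h x))"
  by (rule graded_poly_fun[OF _ S_graded])

lemma poly_Z_graded: "real_polynomial_function \<phi> \<Longrightarrow> graded (2 * s) (\<lambda>h x. \<phi> (Z h x))"
  by (rule graded_poly_fun[OF _ Z_graded])

text \<open>Passing from the quadratures of p(Z) to the actual \<open>\<gamma>\<close> costs only
  the truncation error of \<open>gamma_approx\<close>.\<close>

lemma perturbed_parseval:
  assumes G: "graded (2 * s) G"
  shows "(\<lambda>h. (\<Sum>j<s. coef j (G h) * \<gamma> h j $ i) - integral {0..1} (\<lambda>x. G h x * p i (Z h x))) \<in> bigo_pow (2 * s)"
proof -
  have "(\<lambda>h. \<Sum>j<s. coef j (G h) * (\<gamma> h j $ i - quad j (\<lambda>x. p i (Z h x)))) \<in> bigo_pow (2 * s)"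
    by (intro big_sum_in_bigo bigo_pow_mult[OF graded_coef[OF G] gamma_approx]) auto
  from sum_in_bigo(1)[OF this quad_parseval[OF G poly_Z_graded[OF poly_p[of i]] order_refl]]
  show ?thesis by (simp add: right_diff_distrib sum_subtractf)
qed

end

lemma bigo_pow_cancel:
  assumes "(\<lambda>h. h * F h) \<in> bigo_pow (Suc n)"
  shows "F \<in> bigo_pow n"
proof -
  obtain B where B: "\<forall>\<^sub>F h in at_right 0. norm (h * F h) \<le> B * norm (h ^ Suc n)"
    using assms by (rule landau_o.bigE)
  have "\<forall>\<^sub>F h in at_right 0. norm (F h) \<le> B * norm (h ^ n)"
    using B eventually_small by eventually_elim (auto simp: abs_mult mult.left_commute)
  then show ?thesis by (rule bigoI)
qed

lemma bigo_prod_diff: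
  assumes "(\<lambda>h. a h - A h) \<in> bigo_pow 2" "b \<in> bigo_pow 0" "A \<in> bigo_pow 1" "(\<lambda>h. b h - B h) \<in> bigo_pow 1"
  shows "(\<lambda>h. a h * b h - A h * B h) \<in> bigo_pow 2"
proof -
  have "(\<lambda>h. (a h - A h) * b h + A h * (b h - B h)) \<in> bigo_pow 2"
    by (intro sum_in_bigo bigo_pow_mult[OF assms(1,2)] bigo_pow_mult[OF assms(3,4)]) auto
  then show ?thesis by (simp add: algebra_simps)
qed

lemma real_polynomial_lipschitz_at:
  fixes \<phi> :: "real ^ 'm::finite \<Rightarrow> real"
  assumes "real_polynomial_function \<phi>"
  shows "flat_at 1 y0 (\<lambda>x. \<phi> x - \<phi> y0)"
proof -
  \<comment> \<open>The radius must admit both the base point \<open>y0\<close> and increments of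
    norm up to 1.\<close>
  obtain A where A: "A \<ge> 0" "\<And>a d. norm a \<le> max 1 (norm y0) \<Longrightarrow> norm d \<le> max 1 (norm y0) \<Longrightarrow>
      \<bar>\<phi> (a + d) - \<phi> a - (\<Sum>l\<in>UNIV. partial l \<phi> a * d $ l)\<bar> \<le> A * (norm d)\<^sup>2"
    using real_polynomial_taylor2[OF assms] by blast
  obtain B where B: "B \<ge> 0" "\<And>a d. norm a \<le> norm y0 \<Longrightarrow> \<bar>\<Sum>l\<in>UNIV. partial l \<phi> a * d $ l\<bar> \<le> B * norm d"
    using real_polynomial_partials_bounded[OF assms] by blast
  have "\<bar>\<phi> x - \<phi> y0\<bar> \<le> (A + B) * norm (x - y0) ^ 1" if "x \<in> ball y0 1" for x
  proof -
    have n: "norm (x - y0) \<le> 1" using that by (simp add: dist_norm norm_minus_commute)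
    have "\<bar>\<phi> (y0 + (x - y0)) - \<phi> y0 - (\<Sum>l\<in>UNIV. partial l \<phi> y0 * (x - y0) $ l)\<bar> \<le> A * (norm (x - y0))\<^sup>2"
      using n by (intro A(2)) auto
    also have "A * (norm (x - y0))\<^sup>2 \<le> A * norm (x - y0)"
      using n A(1) by (intro mult_left_mono) (auto simp: power2_eq_square mult_left_le_one_le)
    finally show ?thesis using B(2)[of y0 "x - y0"] by (simp add: algebra_simps)
  qed
  then show ?thesis using A(1) B(1) by (intro exI[of _ "A + B"] conjI exI[of _ 1]) auto
qed

context gauss
begin

lemma coef_diff:
  assumes "continuous_on {0..1} F" "continuous_on {0..1} G"
  shows "coef j (\<lambda>x. F x - G x) = coef j F - coef j G"
  unfolding coef_def right_diff_distrib
  by (intro Henstock_Kurzweil_Integration.integral_diff integrable_continuous_real continuous_intros assms)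

lemma coef_const: "coef j (\<lambda>x. k) = (if j = 0 then k else 0)"
  using coef_cmult[of j k "\<lambda>x. 1"] integral_P[of j] by (simp add: coef_def)

lemma coef_0: "coef 0 F = integral {0..1} F"
  by (simp add: coef_def P_0)

lemma quad_diff: "quad j (\<lambda>x. F x - G x) = quad j F - quad j G"
  by (simp add: quad_def right_diff_distrib sum_subtractf)

lemma quad_const: "j < s \<Longrightarrow> quad j (\<lambda>x. k) = (if j = 0 then k else 0)"
  using quad_cmult[of j k "\<lambda>x. 1"] quad_eq_coef_power[of j 0] coef_const[of j 1] by simp

lemma quad_1_id: "quad 1 (\<lambda>x. x) = coef 1 (\<lambda>x. x)"
  using quad_eq_coef_power[of 1 1] s2 by simp

end

section \<open>Increments of polynomial functions along the collocation path\<close>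

context equip_run
begin

lemma has_derivative_along_S:
  assumes "real_polynomial_function \<phi>"
  shows "((\<lambda>x. \<phi> (S h x)) has_real_derivative
     (\<Sum>i\<in>UNIV. partial i \<phi> (S h x) * (h * (\<Sum>j<s. poly (P j) x * \<gamma> h j $ i)))) (at x within A)"
proof -
  define v where "v = h *\<^sub>R (\<Sum>j<s. poly (P j) x *\<^sub>R \<gamma> h j)"
  have "(S h has_derivative (\<lambda>t. t *\<^sub>R v)) (at x within A)"
    using has_derivative_collocation[of y0 h "\<gamma> h" x A]
    unfolding S_def[abs_def] v_def has_vector_derivative_def .
  from has_derivative_compose[OF this differentiable_imp_partials[OF real_polynomial_differentiable[OF assms]]]
  have "((\<lambda>x. \<phi> (S h x)) has_derivative (\<lambda>t. \<Sum>i\<in>UNIV. partial i \<phi> (S h x) * (t *\<^sub>R v) $ i)) (at x within A)" .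
  moreover have "(\<lambda>t. \<Sum>i\<in>UNIV. partial i \<phi> (S h x) * (t *\<^sub>R v) $ i) =
      (*) (\<Sum>i\<in>UNIV. partial i \<phi> (S h x) * (h * (\<Sum>j<s. poly (P j) x * \<gamma> h j $ i)))"
    by (simp add: v_def fun_eq_iff sum_distrib_left sum_distrib_right mult_ac)
  ultimately show ?thesis by (simp add: has_field_derivative_def)
qed

text \<open>Product rule for u \<open>\<phi>\<close>(S). Since S' is h times the Legendre sum of the
  \<open>\<gamma>\<close>, its part of the integral is h times a sum of \<open>coef j\<close> times
  \<open>\<gamma>\<close>, which \<open>perturbed_parseval\<close> replaces by an integral with
  p(Z). The factor h yields the last order. The weight is u = 1 for the drift of the invariant and a
  power of h (1 - x) for the Lie series.\<close>

lemma increment: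
  assumes \<phi>: "real_polynomial_function \<phi>" and u: "graded (2 * s) u"
    and u': "\<And>h x. (u h has_real_derivative u' h x) (at x)" and cont: "\<And>h. continuous_on {0..1} (u' h)"
  shows "(\<lambda>h. (u h 1 * \<phi> (S h 1) - u h 0 * \<phi> (S h 0)) - integral {0..1} (\<lambda>x. u' h x * \<phi> (S h x))
     - h * integral {0..1} (\<lambda>x. u h x * (\<Sum>i\<in>UNIV. partial i \<phi> (S h x) * p i (Z h x)))) \<in> bigo_pow (Suc (2 * s))"
proof -
  define G where "G i h x = u h x * partial i \<phi> (S h x)" for i h x
  have G: "graded (2 * s) (G i)" for i
    unfolding G_def[abs_def] by (intro graded_mult u poly_S_graded real_polynomial_partial \<phi>)
  note cG = graded_continuous[OF G]
  have c\<phi>: "continuous_on {0..1} (\<lambda>x. \<phi> (S h x))" for h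
    using graded_continuous[OF poly_S_graded[OF \<phi>]] .
  have 1: "u h 1 * \<phi> (S h 1) - u h 0 * \<phi> (S h 0) = integral {0..1} (\<lambda>x. u' h x * \<phi> (S h x))
     + h * (\<Sum>i\<in>UNIV. \<Sum>j<s. coef j (G i h) * \<gamma> h j $ i)" for h
  proof -
    define D where "D x = (\<Sum>i\<in>UNIV. partial i \<phi> (S h x) * (h * (\<Sum>j<s. poly (P j) x * \<gamma> h j $ i)))" for x
    have "((\<lambda>x. u h x * \<phi> (S h x)) has_real_derivative u' h x * \<phi> (S h x) + D x * u h x) (at x within {0..1})" for x
      unfolding D_def by (intro DERIV_mult has_derivative_along_S \<phi> has_field_derivative_at_within[OF u'])
    then have h1: "((\<lambda>x. u' h x * \<phi> (S h x) + D x * u h x) has_integral u h 1 * \<phi> (S h 1) - u h 0 * \<phi> (S h 0)) {0..1}"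
      by (intro fundamental_theorem_of_calculus)
        (simp_all add: has_real_derivative_iff_has_vector_derivative[symmetric])
    have e: "D x * u h x = (\<Sum>i\<in>UNIV. \<Sum>j<s. (h * \<gamma> h j $ i) * (poly (P j) x * G i h x))" for x
      by (simp add: D_def G_def sum_distrib_left sum_distrib_right mult_ac)
    have h2: "integral {0..1} (\<lambda>x. u' h x * \<phi> (S h x) + (\<Sum>i\<in>UNIV. \<Sum>j<s. (h * \<gamma> h j $ i) * (poly (P j) x * G i h x))) =
      integral {0..1} (\<lambda>x. u' h x * \<phi> (S h x)) +
        (\<Sum>i\<in>UNIV. \<Sum>j<s. integral {0..1} (\<lambda>x. (h * \<gamma> h j $ i) * (poly (P j) x * G i h x)))"
    proof -
      have "integral {0..1} (\<lambda>x. \<Sum>j<s. (h * \<gamma> h j $ i) * (poly (P j) x * G i h x)) =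
          (\<Sum>j<s. integral {0..1} (\<lambda>x. (h * \<gamma> h j $ i) * (poly (P j) x * G i h x)))" for i
        by (intro Henstock_Kurzweil_Integration.integral_sum integrable_continuous_real continuous_intros cG) auto
      moreover have "integral {0..1} (\<lambda>x. \<Sum>i\<in>UNIV. \<Sum>j<s. (h * \<gamma> h j $ i) * (poly (P j) x * G i h x)) =
          (\<Sum>i\<in>UNIV. integral {0..1} (\<lambda>x. \<Sum>j<s. (h * \<gamma> h j $ i) * (poly (P j) x * G i h x)))"
        by (intro Henstock_Kurzweil_Integration.integral_sum integrable_continuous_real continuous_intros cG) auto
      ultimately show ?thesis
        by (subst Henstock_Kurzweil_Integration.integral_add)
          (auto intro!: integrable_continuous_real continuous_intros cont c\<phi> cG)
    qed
    have h3: "integral {0..1} (\<lambda>x. (h * \<gamma> h j $ i) * (poly (P j) x * G i h x)) = h * (coef j (G i h) * \<gamma> h j $ i)" for i j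
      unfolding coef_def by (subst integral_mult_right) (simp only: mult_ac)
    show ?thesis
      using integral_unique[OF h1[unfolded e]] unfolding h2 h3 sum_distrib_left by simp
  qed
  have 2: "integral {0..1} (\<lambda>x. u h x * (\<Sum>i\<in>UNIV. partial i \<phi> (S h x) * p i (Z h x))) =
      (\<Sum>i\<in>UNIV. integral {0..1} (\<lambda>x. G i h x * p i (Z h x)))" for h
  proof -
    have "u h x * (\<Sum>i\<in>UNIV. partial i \<phi> (S h x) * p i (Z h x)) = (\<Sum>i\<in>UNIV. G i h x * p i (Z h x))" for x
      by (simp add: G_def sum_distrib_left mult_ac)
    moreover have "integral {0..1} (\<lambda>x. \<Sum>i\<in>UNIV. G i h x * p i (Z h x)) =
        (\<Sum>i\<in>UNIV. integral {0..1} (\<lambda>x. G i h x * p i (Z h x)))"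
      by (intro Henstock_Kurzweil_Integration.integral_sum
          graded_integrable[OF graded_mult[OF G poly_Z_graded[OF poly_p]]]) auto
    ultimately show ?thesis by simp
  qed
  have "(\<lambda>h. h ^ 1 * (\<Sum>i\<in>UNIV. (\<Sum>j<s. coef j (G i h) * \<gamma> h j $ i) -
      integral {0..1} (\<lambda>x. G i h x * p i (Z h x)))) \<in> bigo_pow (Suc (2 * s))"
    by (intro bigo_pow_mult[OF bigo_pow_id, of _ "2 * s"] big_sum_in_bigo perturbed_parseval G) auto
  then show ?thesis by (simp add: 1 2 sum_subtractf right_diff_distrib)
qed

lemma bounded_S: "ubig (\<lambda>h x. norm (S h x)) (\<lambda>h. h ^ 0)"
  by (intro ubig_norm_components graded_ubig[OF S_graded])

lemma bounded_Z: "ubig (\<lambda>h x. norm (Z h x)) (\<lambda>h. h ^ 0)"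
  by (intro ubig_norm_components graded_ubig[OF Z_graded])

lemma alpha_h_0: "(\<lambda>h. \<alpha> h * h) \<in> bigo_pow 0"
  by (rule bigo_powI[OF alpha_h]) simp

text \<open>Two base points are needed: the invariance relation is exploited along Z, the Lie series
  along S.\<close>

lemma expand_at_Z:
  assumes "real_polynomial_function \<phi>"
  shows "ubig (\<lambda>h x. \<phi> (S h x) - \<phi> (Z h x) - \<alpha> h * h * (\<Sum>l\<in>UNIV. partial l \<phi> (Z h x) * skew (\<gamma> h) x $ l))
    (\<lambda>h. (\<alpha> h * h)\<^sup>2)"
proof -
  have "S h x = Z h x + (1 * \<alpha> h * h) *\<^sub>R skew (\<gamma> h) x" for h x by (simp add: Z_def)
  with taylor2_ubig[OF assms bounded_Z skew_small[of 1] alpha_h_0] show ?thesis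
    by (simp add: sum_distrib_left mult_ac)
qed

lemma expand_at_S:
  assumes "real_polynomial_function \<phi>"
  shows "ubig (\<lambda>h x. \<phi> (Z h x) - \<phi> (S h x) + \<alpha> h * h * (\<Sum>l\<in>UNIV. partial l \<phi> (S h x) * skew (\<gamma> h) x $ l))
    (\<lambda>h. (\<alpha> h * h)\<^sup>2)"
proof -
  have "Z h x = S h x + (- 1 * \<alpha> h * h) *\<^sub>R skew (\<gamma> h) x" for h x by (simp add: Z_def)
  with taylor2_ubig[OF assms bounded_S skew_small[of "- 1"] alpha_h_0] show ?thesis
    by (simp add: sum_distrib_left mult_ac sum_negf)
qed

lemma integral_skew:
  assumes "graded n G"
  shows "integral {0..1} (\<lambda>x. G h x * skew (\<gamma> h) x $ l) = coef 1 (G h) * \<gamma> h 0 $ l - coef 0 (G h) * \<gamma> h 1 $ l"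
proof -
  have "integral {0..1} (\<lambda>x. G h x * skew (\<gamma> h) x $ l) =
    integral {0..1} (\<lambda>x. (\<gamma> h 0 $ l) * (poly (P 1) x * G h x) - (\<gamma> h 1 $ l) * G h x)"
    by (simp add: skew_def algebra_simps)
  also have "\<dots> = \<gamma> h 0 $ l * coef 1 (G h) - \<gamma> h 1 $ l * coef 0 (G h)"
    unfolding coef_0 unfolding coef_def
    by (subst Henstock_Kurzweil_Integration.integral_diff)
      (auto intro!: integrable_continuous_real continuous_intros graded_continuous[OF assms])
  finally show ?thesis by simp
qed

text \<open>In \<open>integral_skew\<close> each term pairs an index-0 with an index-1 coefficient,
  and every index-1 coefficient is O(h). Pointwise the skew term is merely bounded, so the gained
  power comes from integrating.\<close>

lemma integral_skew_small:
  assumes "graded (2 * s) G"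
  shows "(\<lambda>h. integral {0..1} (\<lambda>x. G h x * skew (\<gamma> h) x $ l)) \<in> bigo_pow 1"
  unfolding integral_skew[OF assms] using s2
  by (intro sum_in_bigo bigo_pow_mult[OF graded_coef[OF assms] gamma_order]) auto

end

subsection \<open>Size of the parameter\<close>

context equip_run
begin

lemma gamma_0_expand: "(\<lambda>h. \<gamma> h 0 $ i - p i y0) \<in> bigo_pow 1"
proof -
  have "(\<lambda>h. quad 0 (\<lambda>x. p i (Z h x) - p i y0)) \<in> bigo_pow 1"
    by (intro bigo_quad near_bigo_pow[OF near_Z, where \<phi> = "\<lambda>x. p i x - p i y0"]
        real_polynomial_lipschitz_at poly_p)
  moreover have "(\<lambda>h. \<gamma> h 0 $ i - quad 0 (\<lambda>x. p i (Z h x))) \<in> bigo_pow 1"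
    using s2 by (intro bigo_powI[OF gamma_approx]) auto
  ultimately have "(\<lambda>h. \<gamma> h 0 $ i - quad 0 (\<lambda>x. p i (Z h x)) + quad 0 (\<lambda>x. p i (Z h x) - p i y0)) \<in> bigo_pow 1"
    by (rule sum_in_bigo(1)[rotated])
  then show ?thesis using s2 by (simp add: quad_diff quad_const)
qed

text \<open>Only the constant part of \<open>\<gamma>\<close> with index 0 reaches first order: the
  higher coefficients are O(h) and get another h, and the perturbation is O(h^3).\<close>

lemma Z_expand:
  "ubig (\<lambda>h x. (Z h x - y0) $ i - h * x * p i y0) (\<lambda>h. h ^ 2)"
proof -
  have PI: "ubig (\<lambda>h x. poly q x) (\<lambda>h. h ^ 0)" for q
    by (rule ubig_fun_x) (intro continuous_intros)
  have split: "(\<Sum>j<s. F j) = F 0 + (\<Sum>j\<in>{1..<s}. F j)" for F :: "nat \<Rightarrow> real"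
    using s2 sum.atLeast_Suc_lessThan[of 0 s F] by (simp add: lessThan_atLeast0)
  have antideriv_P0: "poly (antideriv (P 0)) x = x" for x
    by (simp add: P_0 antideriv_def poly_monom)
  have "(Z h x - y0) $ i - h * x * p i y0 = h * (\<gamma> h 0 $ i - p i y0) * poly [:0, 1:] x
     + (\<Sum>j\<in>{1..<s}. (h * \<gamma> h j $ i) * poly (antideriv (P j)) x)
     - (\<alpha> h * h * \<gamma> h 0 $ i) * poly (P 1) x + (\<alpha> h * h * \<gamma> h 1 $ i) * poly [:1:] x" for h x
    unfolding vector_minus_component Z_nth S_nth split antideriv_P0
    by (simp add: algebra_simps)
  moreover have "(\<lambda>h. h * (\<gamma> h 0 $ i - p i y0)) \<in> bigo_pow 2"
    using bigo_pow_mult[OF bigo_pow_id[of 1] gamma_0_expand, of 2 i] by simp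
  moreover have "(\<lambda>h. h * \<gamma> h j $ i) \<in> bigo_pow 2" if "1 \<le> j" "j < s" for j
    using bigo_pow_mult[OF bigo_pow_id[of 1] gamma_order[of j i], of 2] that by simp
  moreover have "(\<lambda>h. \<alpha> h * h * \<gamma> h j $ i) \<in> bigo_pow 2" if "j < s" for j
    using bigo_pow_mult[OF alpha_h gamma_bounded[OF that], of 2] by simp
  ultimately show ?thesis
    using s2 by (simp only:) (intro ubig_add ubig_diff ubig_sum ubig_mult_pow[where i = 2 and j = 0 and k = 2, OF ubig_fun_h PI]; simp)
qed

lemma poly_Z_expand:
  assumes "real_polynomial_function \<phi>"
  shows "ubig (\<lambda>h x. \<phi> (Z h x) - \<phi> y0 - h * x * (\<Sum>l\<in>UNIV. partial l \<phi> y0 * p l y0)) (\<lambda>h. h ^ 2)"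
proof -
  have "ubig (\<lambda>h x. norm y0) (\<lambda>h. h ^ 0)" by (rule ubig_fun_h) simp
  from taylor2_ubig[OF assms this near_Z]
  have "ubig (\<lambda>h x. \<phi> (Z h x) - \<phi> y0 - (\<Sum>l\<in>UNIV. partial l \<phi> y0 * (Z h x - y0) $ l)) (\<lambda>h. h ^ 2)"
    using bigo_powI[OF bigo_pow_id[of 1], of 0] by simp
  moreover have "ubig (\<lambda>h x. \<Sum>l\<in>UNIV. partial l \<phi> y0 * ((Z h x - y0) $ l - h * x * p l y0)) (\<lambda>h. h ^ 2)"
    by (intro ubig_sum ubig_mult_pow[where i = 0 and j = 2] Z_expand ubig_fun_h) auto
  ultimately have "ubig (\<lambda>h x. (\<phi> (Z h x) - \<phi> y0 - (\<Sum>l\<in>UNIV. partial l \<phi> y0 * (Z h x - y0) $ l)) +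
     (\<Sum>l\<in>UNIV. partial l \<phi> y0 * ((Z h x - y0) $ l - h * x * p l y0))) (\<lambda>h. h ^ 2)"
    by (rule ubig_add)
  moreover have "\<phi> (Z h x) - \<phi> y0 - h * x * (\<Sum>l\<in>UNIV. partial l \<phi> y0 * p l y0) =
      (\<phi> (Z h x) - \<phi> y0 - (\<Sum>l\<in>UNIV. partial l \<phi> y0 * (Z h x - y0) $ l)) +
      (\<Sum>l\<in>UNIV. partial l \<phi> y0 * ((Z h x - y0) $ l - h * x * p l y0))" for h x
  proof -
    have "(\<Sum>l\<in>UNIV. partial l \<phi> y0 * (h * x * p l y0)) = h * x * (\<Sum>l\<in>UNIV. partial l \<phi> y0 * p l y0)"
      unfolding sum_distrib_left by (simp only: mult_ac)
    then show ?thesis unfolding right_diff_distrib sum_subtractf by simp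
  qed
  ultimately show ?thesis by (simp only:)
qed

lemma coef_1_poly_Z:
  assumes "real_polynomial_function \<phi>"
  shows "(\<lambda>h. coef 1 (\<lambda>x. \<phi> (Z h x)) - h * (coef 1 (\<lambda>x. x) * (\<Sum>l\<in>UNIV. partial l \<phi> y0 * p l y0))) \<in> bigo_pow 2"
proof -
  define D where "D = (\<Sum>l\<in>UNIV. partial l \<phi> y0 * p l y0)"
  have "coef 1 (\<lambda>x. \<phi> (Z h x) - \<phi> y0 - h * x * D) = coef 1 (\<lambda>x. \<phi> (Z h x)) - h * (coef 1 (\<lambda>x. x) * D)" for h
    using coef_cmult[of 1 "h * D" "\<lambda>x. x"]
    by (subst coef_diff, (intro continuous_intros graded_continuous[OF poly_Z_graded[OF assms]])+,
        subst coef_diff, (intro continuous_intros graded_continuous[OF poly_Z_graded[OF assms]])+)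
      (simp add: coef_const mult_ac)
  then show ?thesis using bigo_coef[OF poly_Z_expand[OF assms], of 1] by (simp add: D_def)
qed

lemma coef_0_poly_Z:
  assumes "real_polynomial_function \<phi>"
  shows "(\<lambda>h. coef 0 (\<lambda>x. \<phi> (Z h x)) - \<phi> y0) \<in> bigo_pow 1"
proof -
  have "(\<lambda>h. coef 0 (\<lambda>x. \<phi> (Z h x) - \<phi> y0)) \<in> bigo_pow 1"
    by (intro bigo_coef near_bigo_pow[OF near_Z, where \<phi> = "\<lambda>x. \<phi> x - \<phi> y0"]
        real_polynomial_lipschitz_at assms)
  then show ?thesis
    by (simp add: coef_diff coef_const continuous_intros graded_continuous[OF poly_Z_graded[OF assms]])
qed

text \<open>Since s is at least 2, Gauss quadrature integrates x times \<open>P 1\<close> exactly,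
  so the same constant \<open>coef 1 (\<lambda>x. x)\<close> appears as in
  \<open>coef_1_poly_Z\<close>. The inner sum is component \<open>i\<close> of f'(y0) f(y0).\<close>

lemma gamma_1_expand:
  "(\<lambda>h. \<gamma> h 1 $ i - h * (coef 1 (\<lambda>x. x) * (\<Sum>l\<in>UNIV. partial l (p i) y0 * p l y0))) \<in> bigo_pow 2"
proof -
  define D where "D = (\<Sum>l\<in>UNIV. partial l (p i) y0 * p l y0)"
  have "quad 1 (\<lambda>x. p i (Z h x) - p i y0 - h * x * D) = quad 1 (\<lambda>x. p i (Z h x)) - h * (coef 1 (\<lambda>x. x) * D)" for h
    using quad_cmult[of 1 "h * D" "\<lambda>x. x"] quad_1_id s2 by (simp add: quad_diff quad_const mult_ac)
  then have "(\<lambda>h. quad 1 (\<lambda>x. p i (Z h x)) - h * (coef 1 (\<lambda>x. x) * D)) \<in> bigo_pow 2"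
    using bigo_quad[OF poly_Z_expand[OF poly_p[of i]], of 1] by (simp add: D_def)
  moreover have "(\<lambda>h. \<gamma> h 1 $ i - quad 1 (\<lambda>x. p i (Z h x))) \<in> bigo_pow 2"
    using s2 by (intro bigo_powI[OF gamma_approx]) auto
  ultimately have "(\<lambda>h. (\<gamma> h 1 $ i - quad 1 (\<lambda>x. p i (Z h x))) + (quad 1 (\<lambda>x. p i (Z h x)) - h * (coef 1 (\<lambda>x. x) * D))) \<in> bigo_pow 2"
    by (rule sum_in_bigo(1)[rotated])
  then show ?thesis by (simp add: D_def)
qed

text \<open>Leading terms inserted into the antisymmetric formula of \<open>integral_skew\<close>:
  the derivative of T along the field, paired with the field, minus T paired with the derivative of
  the field along itself.\<close>

lemma integral_skew_expand:
  assumes T: "\<And>l. real_polynomial_function (T l)"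
  defines "\<kappa> \<equiv> (\<Sum>l\<in>UNIV. (\<Sum>m\<in>UNIV. partial m (T l) y0 * p m y0) * p l y0
      - T l y0 * (\<Sum>m\<in>UNIV. partial m (p l) y0 * p m y0))"
  shows "(\<lambda>h. integral {0..1} (\<lambda>x. \<Sum>l\<in>UNIV. T l (Z h x) * skew (\<gamma> h) x $ l) - h * (coef 1 (\<lambda>x. x) * \<kappa>)) \<in> bigo_pow 2"
proof -
  define \<xi> where "\<xi> = coef 1 (\<lambda>x. x)"
  define DT where "DT l = (\<Sum>m\<in>UNIV. partial m (T l) y0 * p m y0)" for l
  define Dp where "Dp l = (\<Sum>m\<in>UNIV. partial m (p l) y0 * p m y0)" for l
  have csk: "continuous_on {0..1} (\<lambda>x. skew (\<gamma> h) x $ l)" for h l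
    unfolding skew_def vector_minus_component vector_scaleR_component by (intro continuous_intros)
  have "integral {0..1} (\<lambda>x. \<Sum>l\<in>UNIV. T l (Z h x) * skew (\<gamma> h) x $ l) =
      (\<Sum>l\<in>UNIV. coef 1 (\<lambda>x. T l (Z h x)) * \<gamma> h 0 $ l - \<gamma> h 1 $ l * coef 0 (\<lambda>x. T l (Z h x)))" for h
  proof -
    have "integral {0..1} (\<lambda>x. \<Sum>l\<in>UNIV. T l (Z h x) * skew (\<gamma> h) x $ l) =
        (\<Sum>l\<in>UNIV. integral {0..1} (\<lambda>x. T l (Z h x) * skew (\<gamma> h) x $ l))"
      by (intro Henstock_Kurzweil_Integration.integral_sum integrable_continuous_real continuous_intros csk
          graded_continuous[OF poly_Z_graded[OF T]]) auto
    then show ?thesis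
      by (simp add: integral_skew[OF poly_Z_graded[OF T]] mult.commute[of "coef 0 _"])
  qed
  moreover have "h * (coef 1 (\<lambda>x. x) * \<kappa>) = (\<Sum>l\<in>UNIV. h * (\<xi> * DT l) * p l y0 - h * (\<xi> * Dp l) * T l y0)" for h
  proof -
    have "\<kappa> = (\<Sum>l\<in>UNIV. DT l * p l y0 - T l y0 * Dp l)"
      unfolding \<kappa>_def DT_def Dp_def ..
    then show ?thesis
      unfolding \<xi>_def[symmetric] by (simp add: sum_distrib_left sum_subtractf right_diff_distrib mult_ac)
  qed
  ultimately have "integral {0..1} (\<lambda>x. \<Sum>l\<in>UNIV. T l (Z h x) * skew (\<gamma> h) x $ l) - h * (coef 1 (\<lambda>x. x) * \<kappa>) =
     (\<Sum>l\<in>UNIV. (coef 1 (\<lambda>x. T l (Z h x)) * \<gamma> h 0 $ l - h * (\<xi> * DT l) * p l y0) -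
        (\<gamma> h 1 $ l * coef 0 (\<lambda>x. T l (Z h x)) - h * (\<xi> * Dp l) * T l y0))" for h
    by (simp add: sum_subtractf)
  moreover have hk: "(\<lambda>h. h * k) \<in> bigo_pow 1" for k :: real
    using bigo_pow_mult[OF bigo_pow_id[of 1] bigo_pow_const[of k], of 1] by simp
  have "(\<lambda>h. \<Sum>l\<in>UNIV. (coef 1 (\<lambda>x. T l (Z h x)) * \<gamma> h 0 $ l - h * (\<xi> * DT l) * p l y0) -
        (\<gamma> h 1 $ l * coef 0 (\<lambda>x. T l (Z h x)) - h * (\<xi> * Dp l) * T l y0)) \<in> bigo_pow 2"
  proof (rule big_sum_in_bigo, rule sum_in_bigo(2); rule bigo_prod_diff)
    fix l
    show "(\<lambda>h. \<gamma> h 0 $ l - p l y0) \<in> bigo_pow 1" by (rule gamma_0_expand)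
    show "(\<lambda>h. h * (\<xi> * DT l)) \<in> bigo_pow 1" "(\<lambda>h. h * (\<xi> * Dp l)) \<in> bigo_pow 1" by (rule hk)+
    show "(\<lambda>h. coef 1 (\<lambda>x. T l (Z h x)) - h * (\<xi> * DT l)) \<in> bigo_pow 2"
      unfolding \<xi>_def DT_def by (intro coef_1_poly_Z T)
    show "(\<lambda>h. \<gamma> h 1 $ l - h * (\<xi> * Dp l)) \<in> bigo_pow 2"
      unfolding \<xi>_def Dp_def by (rule gamma_1_expand)
    show "(\<lambda>h. coef 0 (\<lambda>x. T l (Z h x)) - T l y0) \<in> bigo_pow 1" by (intro coef_0_poly_Z T)
    show "(\<lambda>h. \<gamma> h 0 $ l) \<in> bigo_pow 0" using s2 by (intro gamma_bounded) auto
    show "(\<lambda>h. coef 0 (\<lambda>x. T l (Z h x))) \<in> bigo_pow 0"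
      using graded_coef[OF poly_Z_graded[OF T], of 0 l] by simp
  qed
  ultimately show ?thesis by simp
qed

text \<open>T is the Hessian of \<open>E\<close> applied to the field. Differentiating T along the
  field produces a Hessian term, which symmetry cancels against the subtracted one, and the third
  derivative of \<open>E\<close>, which remains.\<close>

lemma contraction_symmetry:
  assumes E: "real_polynomial_function E"
  defines "T \<equiv> \<lambda>l x. \<Sum>i\<in>UNIV. p i x * partial l (partial i E) x"
  shows "(\<Sum>l\<in>UNIV. (\<Sum>m\<in>UNIV. partial m (T l) y0 * p m y0) * p l y0
      - T l y0 * (\<Sum>m\<in>UNIV. partial m (p l) y0 * p m y0)) =
    (\<Sum>i\<in>UNIV. \<Sum>l\<in>UNIV. \<Sum>m\<in>UNIV. p i y0 * p l y0 * p m y0 * partial m (partial l (partial i E)) y0)"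
proof -
  have d: "partial m (T l) y0 = (\<Sum>i\<in>UNIV. partial m (p i) y0 * partial l (partial i E) y0
      + p i y0 * partial m (partial l (partial i E)) y0)" for m l
    unfolding T_def
    by (simp add: partial_sum partial_mult differentiable_mult real_polynomial_differentiable
        poly_p real_polynomial_partial E)
  have "(\<Sum>l\<in>UNIV. T l y0 * (\<Sum>m\<in>UNIV. partial m (p l) y0 * p m y0)) =
     (\<Sum>l\<in>UNIV. \<Sum>i\<in>UNIV. \<Sum>m\<in>UNIV. p i y0 * partial l (partial i E) y0 * (partial m (p l) y0 * p m y0))"
    by (simp add: T_def sum_product)
  also have "\<dots> = (\<Sum>i\<in>UNIV. \<Sum>l\<in>UNIV. \<Sum>m\<in>UNIV. p i y0 * partial i (partial l E) y0 * (partial m (p l) y0 * p m y0))"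
    by (subst sum.swap) (simp add: real_polynomial_partial_commute[OF E])
  finally have A: "(\<Sum>l\<in>UNIV. T l y0 * (\<Sum>m\<in>UNIV. partial m (p l) y0 * p m y0)) =
     (\<Sum>l\<in>UNIV. \<Sum>i\<in>UNIV. \<Sum>m\<in>UNIV. p l y0 * partial l (partial i E) y0 * (partial m (p i) y0 * p m y0))" .
  have "(\<Sum>l\<in>UNIV. (\<Sum>m\<in>UNIV. partial m (T l) y0 * p m y0) * p l y0) =
     (\<Sum>l\<in>UNIV. \<Sum>m\<in>UNIV. \<Sum>i\<in>UNIV. p l y0 * partial l (partial i E) y0 * (partial m (p i) y0 * p m y0)
        + p i y0 * p l y0 * p m y0 * partial m (partial l (partial i E)) y0)"
    by (simp add: d sum_distrib_right sum_distrib_left algebra_simps)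
  also have "\<dots> = (\<Sum>l\<in>UNIV. \<Sum>m\<in>UNIV. \<Sum>i\<in>UNIV. p l y0 * partial l (partial i E) y0 * (partial m (p i) y0 * p m y0))
     + (\<Sum>l\<in>UNIV. \<Sum>m\<in>UNIV. \<Sum>i\<in>UNIV. p i y0 * p l y0 * p m y0 * partial m (partial l (partial i E)) y0)"
    by (simp add: sum.distrib)
  also have "(\<Sum>l\<in>UNIV. \<Sum>m\<in>UNIV. \<Sum>i\<in>UNIV. p l y0 * partial l (partial i E) y0 * (partial m (p i) y0 * p m y0)) =
     (\<Sum>l\<in>UNIV. \<Sum>i\<in>UNIV. \<Sum>m\<in>UNIV. p l y0 * partial l (partial i E) y0 * (partial m (p i) y0 * p m y0))"
    by (rule sum.cong[OF refl]) (rule sum.swap)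
  also have "(\<Sum>l\<in>UNIV. \<Sum>m\<in>UNIV. \<Sum>i\<in>UNIV. p i y0 * p l y0 * p m y0 * partial m (partial l (partial i E)) y0) =
     (\<Sum>l\<in>UNIV. \<Sum>i\<in>UNIV. \<Sum>m\<in>UNIV. p i y0 * p l y0 * p m y0 * partial m (partial l (partial i E)) y0)"
    by (rule sum.cong[OF refl]) (rule sum.swap)
  also have "\<dots> = (\<Sum>i\<in>UNIV. \<Sum>l\<in>UNIV. \<Sum>m\<in>UNIV. p i y0 * p l y0 * p m y0 * partial m (partial l (partial i E)) y0)"
    by (rule sum.swap)
  finally show ?thesis unfolding sum_subtractf A by simp
qed

text \<open>Up to \<open>O(h ^ (2 * s + 1))\<close>, the drift of \<open>E\<close> over one step is \<open>\<alpha> * h ^ 3\<close> times a factor that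
  tends to the nonzero constant \<open>\<xi> * \<kappa>\<close>; a conserving step therefore has a small \<open>\<alpha>\<close>.\<close>

lemma alpha_order:
  assumes E: "real_polynomial_function E"
    and conserved: "(\<lambda>h. E (S h 1) - E y0) \<in> bigo_pow (Suc (2 * s))"
    and invariant: "flat_at (2 * s) y0 (\<lambda>x. \<Sum>i\<in>UNIV. partial i E x * p i x)"
    and nondegenerate:
      "(\<Sum>i\<in>UNIV. \<Sum>l\<in>UNIV. \<Sum>m\<in>UNIV. p i y0 * p l y0 * p m y0 * partial m (partial l (partial i E)) y0) \<noteq> 0"
  shows "\<alpha> \<in> bigo_pow (2 * s - 2)"
proof -
  define T where "T l x = (\<Sum>i\<in>UNIV. p i x * partial l (partial i E) x)" for l x
  define \<kappa> where "\<kappa> = (\<Sum>i\<in>UNIV. \<Sum>l\<in>UNIV. \<Sum>m\<in>UNIV. p i y0 * p l y0 * p m y0 * partial m (partial l (partial i E)) y0)"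
  define \<xi> where "\<xi> = coef 1 (\<lambda>x. x)"
  have pE: "real_polynomial_function (partial i E)" for i by (intro real_polynomial_partial E)
  have T: "real_polynomial_function (T l)" for l
    unfolding T_def[abs_def]
    by (intro real_polynomial_function_sum real_polynomial_function.intros(4) real_polynomial_partial pE poly_p) auto
  \<comment> \<open>I pairs p(Z) with the gradient at S and is tied to the drift of
    \<open>E\<close>; I' takes the gradient at Z, where invariance makes it small. J is the
    first-order coefficient of their difference in \<open>\<alpha> h * h\<close>.\<close>
  define I where "I h = integral {0..1} (\<lambda>x. \<Sum>i\<in>UNIV. partial i E (S h x) * p i (Z h x))" for h
  define I' where "I' h = integral {0..1} (\<lambda>x. \<Sum>i\<in>UNIV. partial i E (Z h x) * p i (Z h x))" for h
  define J where "J h = integral {0..1} (\<lambda>x. \<Sum>l\<in>UNIV. T l (Z h x) * skew (\<gamma> h) x $ l)" for h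
  have "(\<lambda>h. (1 * E (S h 1) - 1 * E (S h 0)) - integral {0..1} (\<lambda>x. 0 * E (S h x))
      - h * integral {0..1} (\<lambda>x. 1 * (\<Sum>i\<in>UNIV. partial i E (S h x) * p i (Z h x)))) \<in> bigo_pow (Suc (2 * s))"
    by (rule increment[OF E, where u = "\<lambda>h x. 1" and u' = "\<lambda>h x. 0"]) (auto intro: graded_fun_h)
  moreover have "S h 0 = y0" for h by (simp add: S_def collocation_0)
  ultimately have "(\<lambda>h. (E (S h 1) - E y0) - h * I h) \<in> bigo_pow (Suc (2 * s))"
    by (simp add: I_def)
  from sum_in_bigo(2)[OF conserved this]
  have "(\<lambda>h. h * I h) \<in> bigo_pow (Suc (2 * s))" by simp
  then have I: "I \<in> bigo_pow (2 * s)" by (rule bigo_pow_cancel)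
  have I': "I' \<in> bigo_pow (2 * s)"
    unfolding I'_def
    by (intro bigo_integral near_bigo_pow[OF near_Z, where \<phi> = "\<lambda>x. \<Sum>i\<in>UNIV. partial i E x * p i x"] invariant)
  note gc = graded_continuous[OF poly_Z_graded] graded_continuous[OF poly_S_graded]
  have csk: "continuous_on {0..1} (\<lambda>x. skew (\<gamma> h) x $ l)" for h l
    unfolding skew_def vector_minus_component vector_scaleR_component by (intro continuous_intros)
  have "(\<Sum>i\<in>UNIV. p i (Z h x) * (partial i E (S h x) - partial i E (Z h x)
        - \<alpha> h * h * (\<Sum>l\<in>UNIV. partial l (partial i E) (Z h x) * skew (\<gamma> h) x $ l))) =
     (\<Sum>i\<in>UNIV. partial i E (S h x) * p i (Z h x)) - (\<Sum>i\<in>UNIV. partial i E (Z h x) * p i (Z h x))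
       - \<alpha> h * h * (\<Sum>l\<in>UNIV. T l (Z h x) * skew (\<gamma> h) x $ l)" for h x
  proof -
    have "(\<Sum>l\<in>UNIV. T l (Z h x) * skew (\<gamma> h) x $ l) =
        (\<Sum>i\<in>UNIV. p i (Z h x) * (\<Sum>l\<in>UNIV. partial l (partial i E) (Z h x) * skew (\<gamma> h) x $ l))"
      unfolding T_def sum_distrib_left sum_distrib_right mult.assoc by (rule sum.swap)
    then show ?thesis by (simp add: right_diff_distrib sum_subtractf sum_distrib_left mult_ac)
  qed
  moreover have "ubig (\<lambda>h x. \<Sum>i\<in>UNIV. p i (Z h x) * (partial i E (S h x) - partial i E (Z h x)
        - \<alpha> h * h * (\<Sum>l\<in>UNIV. partial l (partial i E) (Z h x) * skew (\<gamma> h) x $ l))) (\<lambda>h. h ^ 0 * (\<alpha> h * h)\<^sup>2)"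
    by (intro ubig_sum ubig_mult graded_ubig[OF poly_Z_graded] poly_p expand_at_Z pE) auto
  ultimately have "ubig (\<lambda>h x. (\<Sum>i\<in>UNIV. partial i E (S h x) * p i (Z h x)) - (\<Sum>i\<in>UNIV. partial i E (Z h x) * p i (Z h x))
       - \<alpha> h * h * (\<Sum>l\<in>UNIV. T l (Z h x) * skew (\<gamma> h) x $ l)) (\<lambda>h. (\<alpha> h * h)\<^sup>2)"
    by simp
  note bigo_integral[OF this]
  moreover have "integral {0..1} (\<lambda>x. (\<Sum>i\<in>UNIV. partial i E (S h x) * p i (Z h x)) - (\<Sum>i\<in>UNIV. partial i E (Z h x) * p i (Z h x))
       - \<alpha> h * h * (\<Sum>l\<in>UNIV. T l (Z h x) * skew (\<gamma> h) x $ l)) = I h - I' h - \<alpha> h * h * J h" for h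
  proof -
    have "(\<lambda>x. \<Sum>i\<in>UNIV. partial i E (S h x) * p i (Z h x)) integrable_on {0..1}"
      "(\<lambda>x. \<Sum>i\<in>UNIV. partial i E (Z h x) * p i (Z h x)) integrable_on {0..1}"
      "(\<lambda>x. \<alpha> h * h * (\<Sum>l\<in>UNIV. T l (Z h x) * skew (\<gamma> h) x $ l)) integrable_on {0..1}"
      by (intro integrable_continuous_real continuous_intros gc csk pE poly_p T)+
    then show ?thesis
      by (simp add: Henstock_Kurzweil_Integration.integral_diff integrable_diff I_def I'_def J_def)
  qed
  ultimately have R1: "(\<lambda>h. I h - I' h - \<alpha> h * h * J h) \<in> O[at_right 0](\<lambda>h. (\<alpha> h * h)\<^sup>2)"
    by simp
  have "(\<lambda>h. J h - h * (\<xi> * \<kappa>)) \<in> bigo_pow 2"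
    using integral_skew_expand[of T, OF T] contraction_symmetry[OF E]
    unfolding J_def \<xi>_def \<kappa>_def T_def by simp
  then have R2: "(\<lambda>h. \<alpha> h * h * (J h - h * (\<xi> * \<kappa>))) \<in> O[at_right 0](\<lambda>h. \<alpha> h * h * h ^ 2)"
    by (intro landau_o.big_mult) auto
  \<comment> \<open>The a priori bound is spent on one factor only; the gauge has to keep the other
    \<open>\<alpha>\<close>, for which the relation is to be solved.\<close>
  have "(\<lambda>h. (\<alpha> h * h) * (\<alpha> h * h)) \<in> O[at_right 0](\<lambda>h. \<alpha> h * h * h ^ 2)"
    by (intro landau_o.big_mult bigo_powI[OF alpha_h]) auto
  then have R3: "(\<lambda>h. I h - I' h - \<alpha> h * h * J h) \<in> O[at_right 0](\<lambda>h. \<alpha> h * h * h ^ 2)"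
    using landau_o.big_trans[OF R1] by (simp add: power2_eq_square)
  have "\<xi> * \<kappa> \<noteq> 0" using nondegenerate coef_1_id_pos by (simp add: \<xi>_def \<kappa>_def)
  define k where "k = \<bar>\<xi> * \<kappa>\<bar>"
  have "k > 0" using \<open>\<xi> * \<kappa> \<noteq> 0\<close> by (simp add: k_def)
  have "(\<lambda>h. (I h - I' h - \<alpha> h * h * J h) + \<alpha> h * h * (J h - h * (\<xi> * \<kappa>))) \<in> O[at_right 0](\<lambda>h. \<alpha> h * h * h ^ 2)"
    by (intro sum_in_bigo R2 R3)
  then have R: "(\<lambda>h. (I h - I' h) - \<alpha> h * h * h * (\<xi> * \<kappa>)) \<in> O[at_right 0](\<lambda>h. \<alpha> h * h * h ^ 2)"
    by (simp add: algebra_simps)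
  obtain B where B: "B > 0" "\<forall>\<^sub>F h in at_right 0. norm ((I h - I' h) - \<alpha> h * h * h * (\<xi> * \<kappa>)) \<le> B * norm (\<alpha> h * h * h ^ 2)"
    using R by (rule landau_o.bigE)
  have "(\<lambda>h. I h - I' h) \<in> bigo_pow (2 * s)" by (intro sum_in_bigo I I')
  then obtain B' where B': "B' > 0" "\<forall>\<^sub>F h in at_right 0. norm (I h - I' h) \<le> B' * norm (h ^ (2 * s))"
    by (rule landau_o.bigE)
  \<comment> \<open>Below this threshold the error B |\<open>\<alpha>\<close>| h^3 is at most half
    of the leading term k |\<open>\<alpha>\<close>| h^2, so the latter is controlled by I - I', and
    dividing by h^2 gives the exponent 2s - 2.\<close>
  have "\<forall>\<^sub>F h in at_right 0. 0 < h \<and> h < k / (2 * B)"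
    using eventually_at_right_real[of 0 "k / (2 * B)"] \<open>k > 0\<close> B(1) by simp
  with B(2) B'(2) have "\<forall>\<^sub>F h in at_right 0. norm (\<alpha> h) \<le> (2 * B' / k) * norm (h ^ (2 * s - 2))"
  proof eventually_elim
    case (elim h)
    have h: "h > 0" "B * h \<le> k / 2" using elim B(1) by (auto simp: field_simps)
    define a where "a = \<bar>\<alpha> h\<bar> * h\<^sup>2"
    have "\<bar>\<alpha> h * h * h * (\<xi> * \<kappa>)\<bar> = k * a"
      using h by (simp add: k_def a_def abs_mult power2_eq_square)
    moreover have "B * norm (\<alpha> h * h * h ^ 2) = (B * h) * a"
      using h by (simp add: a_def abs_mult power2_eq_square)
    moreover have "(B * h) * a \<le> k / 2 * a" using h by (intro mult_right_mono) (auto simp: a_def)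
    moreover have "\<bar>\<alpha> h * h * h * (\<xi> * \<kappa>)\<bar> \<le> \<bar>I h - I' h\<bar> + B * norm (\<alpha> h * h * h ^ 2)"
      using elim(1) unfolding real_norm_def by linarith
    moreover have "\<bar>I h - I' h\<bar> \<le> B' * h ^ (2 * s)" using elim(2) h by simp
    ultimately have "k * a \<le> B' * h ^ (2 * s) + k / 2 * a" by linarith
    moreover have "h ^ (2 * s) = h ^ (2 * s - 2) * h\<^sup>2"
      unfolding power_add[symmetric] by (rule arg_cong[of _ _ "(^) h"]) (use s2 in simp)
    ultimately have "(k / 2 * \<bar>\<alpha> h\<bar>) * h\<^sup>2 \<le> (B' * h ^ (2 * s - 2)) * h\<^sup>2"
      by (simp add: a_def algebra_simps)
    then have "k / 2 * \<bar>\<alpha> h\<bar> \<le> B' * h ^ (2 * s - 2)"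
      using h by (simp add: mult_le_cancel_right)
    then show ?case using \<open>k > 0\<close> h by (simp add: field_simps)
  qed
  then show ?thesis by (rule bigoI)
qed

end

subsection \<open>Lie series and the local error\<close>

lemma graded_power: "graded n F \<Longrightarrow> graded n (\<lambda>h x. F h x ^ k)"
  by (induction k) (auto intro: graded_mult graded_fun_h)

lemma ubig_antiderivative:
  assumes F: "\<And>h x. h > 0 \<Longrightarrow> x \<in> {0..1} \<Longrightarrow> (F h has_real_derivative F' h x) (at x within {0..1})"
    and F0: "\<And>h. F h 0 = 0" and F': "ubig F' e"
  shows "ubig F e"
proof -
  obtain B where B: "B \<ge> 0" "\<forall>\<^sub>F h in at_right 0. \<forall>x\<in>{0..1}. \<bar>F' h x\<bar> \<le> B * \<bar>e h\<bar>"
    using F' by (rule ubigE)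
  have "\<forall>\<^sub>F h in at_right 0. \<forall>x\<in>{0..1}. \<bar>F h x\<bar> \<le> B * \<bar>e h\<bar>"
    using B(2) eventually_small
  proof eventually_elim
    case (elim h)
    show ?case
    proof
      fix x :: real assume x: "x \<in> {0..1}"
      have "norm (F h x - F h 0) \<le> B * \<bar>e h\<bar> * norm (x - 0)"
      proof (rule field_differentiable_bound[of "{0..1}" "F h" "F' h"])
        show "\<And>z. z \<in> {0..1} \<Longrightarrow> (F h has_real_derivative F' h z) (at z within {0..1})"
          using F elim(2) by blast
        show "\<And>z. z \<in> {0..1} \<Longrightarrow> norm (F' h z) \<le> B * \<bar>e h\<bar>"
          using elim(1) by auto
      qed (use x in auto)
      also have "\<dots> \<le> B * \<bar>e h\<bar> * 1" using x B(1) by (intro mult_left_mono) auto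
      finally show "\<bar>F h x\<bar> \<le> B * \<bar>e h\<bar>" by (simp add: F0)
    qed
  qed
  then show ?thesis by (rule ubigI)
qed

lemma has_derivative_exp_series:
  fixes a :: "nat \<Rightarrow> real"
  shows "((\<lambda>x. \<Sum>k<Suc n. (h * x) ^ k / fact k * a k) has_real_derivative
    h * (\<Sum>k<n. (h * x) ^ k / fact k * a (Suc k))) (at x within A)"
proof -
  have d: "((\<lambda>x. (h * x) ^ Suc k / fact (Suc k) * a (Suc k)) has_real_derivative
      h * ((h * x) ^ k / fact k * a (Suc k))) (at x within A)" for k
  proof -
    have "((\<lambda>x. h * x) has_real_derivative h) (at x within A)"
      by (auto intro!: derivative_eq_intros)
    from DERIV_cmult_right[OF DERIV_cdivide[OF DERIV_power_Suc[OF this]]]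
    have "((\<lambda>x. (h * x) ^ Suc k / fact (Suc k) * a (Suc k)) has_real_derivative
        (1 + real k) * (h * (h * x) ^ k) / fact (Suc k) * a (Suc k)) (at x within A)" .
    moreover have "(1 + real k) * (h * (h * x) ^ k) / fact (Suc k) = h * ((h * x) ^ k / fact k)"
    proof -
      have "1 + real k \<noteq> 0" by linarith
      then show ?thesis
        unfolding fact_Suc of_nat_Suc times_divide_eq_right by (rule mult_divide_mult_cancel_left)
    qed
    ultimately show ?thesis by (simp add: mult.assoc)
  qed
  have "((\<lambda>x. a 0 + (\<Sum>k<n. (h * x) ^ Suc k / fact (Suc k) * a (Suc k))) has_real_derivative
    (0 + (\<Sum>k<n. h * ((h * x) ^ k / fact k * a (Suc k))))) (at x within A)"
    by (intro DERIV_add DERIV_const DERIV_sum d)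
  then show ?thesis
    unfolding sum.lessThan_Suc_shift by (simp add: sum_distrib_left)
qed

section \<open>Common Lie series of the exact flow and of the method\<close>

context equip_run
begin

text \<open>Lie derivative along the truncated field \<open>p\<close>, so that iterates of a
  polynomial remain polynomials; at \<open>y0\<close> they are the Taylor coefficients of
  \<open>\<phi>\<close> along the flow.\<close>

definition lie :: "(real ^ 'm \<Rightarrow> real) \<Rightarrow> real ^ 'm \<Rightarrow> real" where
  "lie \<phi> x = (\<Sum>i\<in>UNIV. partial i \<phi> x * p i x)"

lemma poly_lie: "real_polynomial_function \<phi> \<Longrightarrow> real_polynomial_function (lie \<phi>)"
  unfolding lie_def[abs_def]
  by (intro real_polynomial_function_sum real_polynomial_function.intros(4) real_polynomial_partial poly_p) auto

lemma poly_lie_pow: "real_polynomial_function \<phi> \<Longrightarrow> real_polynomial_function ((lie ^^ k) \<phi>)"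
  by (induction k) (auto intro: poly_lie)

text \<open>The x-derivative of the remainder of \<open>\<phi>\<close> is h times the remainder of
  \<open>lie \<phi>\<close> one order lower, up to truncation error. Induction over \<open>n\<close>
  for all \<open>\<phi>\<close> thus uses first derivatives of \<open>y\<close> only.\<close>

lemma flow_expansion:
  assumes y: "solves_ivp f y0 y"
  shows "real_polynomial_function \<phi> \<Longrightarrow> n \<le> 2 * s + 2 \<Longrightarrow>
    ubig (\<lambda>h x. \<phi> (y (h * x)) - (\<Sum>k<n. (h * x) ^ k / fact k * (lie ^^ k) \<phi> y0)) (\<lambda>h. h ^ n)"
proof (induction n arbitrary: \<phi>)
  have y_0: "y 0 = y0" and y': "\<And>t. t \<ge> 0 \<Longrightarrow> (y has_vector_derivative f (y t)) (at t within {0..})"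
    using y by (auto simp: solves_ivp_def)
  \<comment> \<open>The one-sided derivative at time 0 alone bounds the distance from
    \<open>y0\<close> linearly in time.\<close>
  have near: "ubig (\<lambda>h x. norm (y (h * x) - y0)) (\<lambda>h. h ^ 1)"
  proof -
    have "(y has_derivative (\<lambda>t. t *\<^sub>R f y0)) (at 0 within {0..})"
      using y'[of 0] by (simp add: has_vector_derivative_def y_0)
    then have "\<forall>e>0. \<exists>d>0. \<forall>t\<in>{0..}. norm (t - 0) < d \<longrightarrow>
        norm (y t - y 0 - (t - 0) *\<^sub>R f y0) \<le> e * norm (t - 0)"
      unfolding has_derivative_within_alt by (rule conjunct2)
    from spec[OF this, of 1] have "\<exists>d>0. \<forall>t\<in>{0..}. norm (t - 0) < d \<longrightarrow>
        norm (y t - y 0 - (t - 0) *\<^sub>R f y0) \<le> 1 * norm (t - 0)"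
      by simp
    then obtain d where d: "d > 0" "\<And>t. t \<in> {0..} \<Longrightarrow> norm (t - 0) < d \<Longrightarrow>
        norm (y t - y 0 - (t - 0) *\<^sub>R f y0) \<le> 1 * norm (t - 0)"
      by blast
    have "\<forall>\<^sub>F h in at_right 0. 0 < h \<and> h < d"
      using eventually_at_right_real[OF d(1)] by simp
    then have "\<forall>\<^sub>F h in at_right 0. \<forall>x\<in>{0..1}. \<bar>norm (y (h * x) - y0)\<bar> \<le> (1 + norm (f y0)) * \<bar>h ^ 1\<bar>"
    proof eventually_elim
      case (elim h)
      show ?case
      proof
        fix x :: real assume x: "x \<in> {0..1}"
        have hx: "0 \<le> h * x" "h * x \<le> h" using elim x by (auto simp: mult_left_le)
        then have "norm (y (h * x) - y0 - (h * x) *\<^sub>R f y0) \<le> h * x"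
          using d(2)[of "h * x"] elim y_0 le_less_trans[of "h * x" h d] by simp
        then have "norm (y (h * x) - y0) \<le> h * x + norm ((h * x) *\<^sub>R f y0)"
          using norm_triangle_ineq2[of "y (h * x) - y0" "(h * x) *\<^sub>R f y0"] by linarith
        also have "\<dots> = (h * x) * (1 + norm (f y0))" using hx by (simp add: algebra_simps)
        also have "\<dots> \<le> h * (1 + norm (f y0))" using hx by (intro mult_right_mono) auto
        finally show "\<bar>norm (y (h * x) - y0)\<bar> \<le> (1 + norm (f y0)) * \<bar>h ^ 1\<bar>"
          using elim by (simp add: mult.commute)
      qed
    qed
    then show ?thesis by (rule ubigI)
  qed
  have bounded: "ubig (\<lambda>h x. \<phi> (y (h * x))) (\<lambda>h. h ^ 0)" if "real_polynomial_function \<phi>" for \<phi>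
  proof -
    have "ubig (\<lambda>h x. \<phi> (y (h * x)) - \<phi> y0) (\<lambda>h. h ^ 0)"
      by (rule ubig_pow_mono[OF near_bigo_pow[OF near, where \<phi> = "\<lambda>x. \<phi> x - \<phi> y0" and n = 1]])
        (use real_polynomial_lipschitz_at[OF that] in auto)
    moreover have "ubig (\<lambda>h x. \<phi> y0) (\<lambda>h. h ^ 0)" by (rule ubig_fun_h) simp
    ultimately have "ubig (\<lambda>h x. \<phi> (y (h * x)) - \<phi> y0 + \<phi> y0) (\<lambda>h. h ^ 0)" by (rule ubig_add)
    then show ?thesis by simp
  qed
  {
    case 0
    then show ?case using bounded by simp
  next
    case (Suc n)
    define F where "F h x = \<phi> (y (h * x)) - (\<Sum>k<Suc n. (h * x) ^ k / fact k * (lie ^^ k) \<phi> y0)" for h x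
    \<comment> \<open>The chain rule involves the true field \<open>f\<close>; the first sum is the
      cost of replacing it by \<open>p\<close>, the rest is the remainder of
      \<open>lie \<phi>\<close>.\<close>
    define G where "G h x = (\<Sum>i\<in>UNIV. partial i \<phi> (y (h * x)) * (f (y (h * x)) $ i - p i (y (h * x))))
      + (lie \<phi> (y (h * x)) - (\<Sum>k<n. (h * x) ^ k / fact k * (lie ^^ k) (lie \<phi>) y0))" for h x
    have "ubig F (\<lambda>h. h ^ Suc n)"
    proof (rule ubig_antiderivative[where F' = "\<lambda>h x. h * G h x"])
      show "F h 0 = 0" for h
        unfolding F_def sum.lessThan_Suc_shift by (simp add: y_0)
      show "ubig (\<lambda>h x. h * G h x) (\<lambda>h. h ^ Suc n)"
        unfolding G_def
      proof (rule ubig_mult_pow[where i = 1 and j = n], goal_cases)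
        case 2
        have "ubig (\<lambda>h x. partial i \<phi> (y (h * x)) * (f (y (h * x)) $ i - p i (y (h * x)))) (\<lambda>h. h ^ n)" for i
          using Suc.prems
          by (intro ubig_mult_pow[where i = 0 and j = "2 * s + 2"] bounded real_polynomial_partial
              near_bigo_pow[OF near, where \<phi> = "\<lambda>x. f x $ i - p i x"] p_approx) auto
        moreover have "ubig (\<lambda>h x. lie \<phi> (y (h * x)) - (\<Sum>k<n. (h * x) ^ k / fact k * (lie ^^ k) (lie \<phi>) y0)) (\<lambda>h. h ^ n)"
          using Suc.prems by (intro Suc.IH poly_lie) auto
        ultimately show ?case by (intro ubig_add ubig_sum) auto
      qed (auto intro: ubig_fun_h)
      fix h x :: real assume h: "h > 0" and x: "x \<in> {0..1}"
      have "((y \<circ> (\<lambda>x. h * x)) has_vector_derivative h *\<^sub>R f (y (h * x))) (at x within {0..1})"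
      proof (rule vector_diff_chain_within)
        show "((\<lambda>x. h * x) has_vector_derivative h) (at x within {0..1})"
          by (auto intro!: derivative_eq_intros simp flip: has_real_derivative_iff_has_vector_derivative)
        show "(y has_vector_derivative f (y (h * x))) (at (h * x) within (\<lambda>x. h * x) ` {0..1})"
          using h x by (intro has_vector_derivative_within_subset[OF y']) auto
      qed
      then have "((\<lambda>x. y (h * x)) has_derivative (\<lambda>t. t *\<^sub>R (h *\<^sub>R f (y (h * x))))) (at x within {0..1})"
        by (simp add: has_vector_derivative_def o_def)
      from has_derivative_compose[OF this differentiable_imp_partials[OF real_polynomial_differentiable[OF Suc.prems(1)]]]
      have "((\<lambda>x. \<phi> (y (h * x))) has_real_derivative h * (\<Sum>i\<in>UNIV. partial i \<phi> (y (h * x)) * f (y (h * x)) $ i)) (at x within {0..1})"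
        unfolding has_field_derivative_def by (rule has_derivative_eq_rhs) (simp add: fun_eq_iff sum_distrib_left mult_ac)
      from DERIV_diff[OF this has_derivative_exp_series]
      have "(F h has_real_derivative h * (\<Sum>i\<in>UNIV. partial i \<phi> (y (h * x)) * f (y (h * x)) $ i) -
          h * (\<Sum>k<n. (h * x) ^ k / fact k * (lie ^^ Suc k) \<phi> y0)) (at x within {0..1})"
        unfolding F_def[abs_def] .
      moreover have "h * (\<Sum>i\<in>UNIV. partial i \<phi> (y (h * x)) * f (y (h * x)) $ i) -
          h * (\<Sum>k<n. (h * x) ^ k / fact k * (lie ^^ Suc k) \<phi> y0) = h * G h x"
        by (simp add: G_def lie_def[of \<phi> "y (h * x)"] right_diff_distrib sum_subtractf funpow_swap1 distrib_left)
      ultimately show "(F h has_real_derivative h * G h x) (at x within {0..1})" by simp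
    qed
    then show ?case unfolding F_def .
  }
qed

text \<open>Now \<open>\<alpha> h * h\<close> is O(h^(2s-1)), one power short. The linear term gains
  it from \<open>integral_skew_small\<close>; the quadratic one is O(h^(4s-2)) and hence small
  enough.\<close>

lemma stage_defect:
  assumes G: "graded (2 * s) G" and \<alpha>: "\<alpha> \<in> bigo_pow (2 * s - 2)"
  shows "(\<lambda>h. integral {0..1} (\<lambda>x. G h x * (p i (Z h x) - p i (S h x)))) \<in> bigo_pow (2 * s)"
proof -
  have \<alpha>h: "(\<lambda>h. \<alpha> h * h) \<in> bigo_pow (2 * s - 1)"
    using bigo_pow_mult[OF \<alpha> bigo_pow_id[of 1], of "2 * s - 1"] s2 by simp
  have pp: "real_polynomial_function (partial l (p i))" for l by (intro real_polynomial_partial poly_p)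
  have GT: "graded (2 * s) (\<lambda>h x. G h x * partial l (p i) (S h x))" for l
    by (intro graded_mult G poly_S_graded pp)
  have csk: "continuous_on {0..1} (\<lambda>x. skew (\<gamma> h) x $ l)" for h l
    unfolding skew_def vector_minus_component vector_scaleR_component by (intro continuous_intros)
  note cont = graded_continuous[OF G] graded_continuous[OF poly_S_graded] graded_continuous[OF poly_Z_graded] csk pp poly_p
  define I where "I h = integral {0..1} (\<lambda>x. G h x * (p i (Z h x) - p i (S h x)))" for h
  define J where "J h = (\<Sum>l\<in>UNIV. integral {0..1} (\<lambda>x. (G h x * partial l (p i) (S h x)) * skew (\<gamma> h) x $ l))" for h
  have "integral {0..1} (\<lambda>x. G h x * (p i (Z h x) - p i (S h x) + \<alpha> h * h * (\<Sum>l\<in>UNIV. partial l (p i) (S h x) * skew (\<gamma> h) x $ l)))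
      = I h + \<alpha> h * h * J h" for h
  proof -
    have "G h x * (p i (Z h x) - p i (S h x) + \<alpha> h * h * (\<Sum>l\<in>UNIV. partial l (p i) (S h x) * skew (\<gamma> h) x $ l)) =
        G h x * (p i (Z h x) - p i (S h x)) + \<alpha> h * h * (\<Sum>l\<in>UNIV. (G h x * partial l (p i) (S h x)) * skew (\<gamma> h) x $ l)" for x
      by (simp add: distrib_left sum_distrib_left mult_ac)
    moreover have "integral {0..1} (\<lambda>x. \<Sum>l\<in>UNIV. (G h x * partial l (p i) (S h x)) * skew (\<gamma> h) x $ l) = J h"
      unfolding J_def
      by (intro Henstock_Kurzweil_Integration.integral_sum integrable_continuous_real continuous_intros cont) auto
    moreover have "(\<lambda>x. G h x * (p i (Z h x) - p i (S h x))) integrable_on {0..1}"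
      "(\<lambda>x. \<alpha> h * h * (\<Sum>l\<in>UNIV. (G h x * partial l (p i) (S h x)) * skew (\<gamma> h) x $ l)) integrable_on {0..1}"
      by (intro integrable_continuous_real continuous_intros cont)+
    ultimately show ?thesis
      by (simp add: Henstock_Kurzweil_Integration.integral_add I_def)
  qed
  moreover have "ubig (\<lambda>h x. G h x * (p i (Z h x) - p i (S h x) + \<alpha> h * h * (\<Sum>l\<in>UNIV. partial l (p i) (S h x) * skew (\<gamma> h) x $ l)))
      (\<lambda>h. h ^ 0 * (\<alpha> h * h)\<^sup>2)"
    by (intro ubig_mult graded_ubig[OF G] expand_at_S poly_p)
  from bigo_integral[OF this]
  have "(\<lambda>h. integral {0..1} (\<lambda>x. G h x * (p i (Z h x) - p i (S h x) + \<alpha> h * h * (\<Sum>l\<in>UNIV. partial l (p i) (S h x) * skew (\<gamma> h) x $ l))))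
      \<in> O[at_right 0](\<lambda>h. (\<alpha> h * h) * (\<alpha> h * h))"
    by (simp add: power2_eq_square)
  moreover have "(\<lambda>h. (\<alpha> h * h) * (\<alpha> h * h)) \<in> bigo_pow (2 * s)"
    using s2 by (intro bigo_pow_mult[OF \<alpha>h \<alpha>h]) auto
  ultimately have 1: "(\<lambda>h. I h + \<alpha> h * h * J h) \<in> bigo_pow (2 * s)"
    using landau_o.big_trans by force
  have J: "J \<in> bigo_pow 1"
    unfolding J_def[abs_def] by (intro big_sum_in_bigo integral_skew_small GT)
  then have 2: "(\<lambda>h. \<alpha> h * h * J h) \<in> bigo_pow (2 * s)"
    using s2 by (intro bigo_pow_mult[OF \<alpha>h J]) auto
  from sum_in_bigo(2)[OF 1 2] show ?thesis by (simp add: I_def)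
qed

text \<open>Integration by parts along the collocation polynomial against the weights
  \<open>(h - t) ^ k / fact k\<close> of the Taylor-Lie series of the flow replaces the variational equation.\<close>

lemma numerical_expansion:
  assumes \<phi>: "real_polynomial_function \<phi>" and \<alpha>: "\<alpha> \<in> bigo_pow (2 * s - 2)"
  shows "(\<lambda>h. \<phi> (S h 1) - (\<Sum>k<Suc (2 * s). h ^ k / fact k * (lie ^^ k) \<phi> y0)) \<in> bigo_pow (Suc (2 * s))"
proof -
  define u where "u k h x = (h * poly [:1, - 1:] x) ^ k * (1 / fact k)" for k :: nat and h x :: real
  define u' where "u' k h x = (if k = 0 then 0 else - h * u (k - 1) h x)" for k h x
  define J where "J k h = integral {0..1} (\<lambda>x. u k h x * (lie ^^ Suc k) \<phi> (S h x))" for k h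
  have u: "graded (2 * s) (u k)" for k
    unfolding u_def[abs_def] using s2
    by (intro graded_mult graded_power graded_scaled_poly[where d = 1] graded_fun_h) auto
  have u_deriv: "(u k h has_real_derivative u' k h x) (at x)" for k h x
  proof (cases k)
    case (Suc n)
    have "((\<lambda>x. h * poly [:1, - 1:] x) has_real_derivative - h) (at x)"
      by (auto intro!: derivative_eq_intros)
    from DERIV_cmult_right[OF DERIV_power_Suc[OF this]]
    have "((\<lambda>x. (h * poly [:1, - 1:] x) ^ Suc n * (1 / fact (Suc n))) has_real_derivative
        (1 + real n) * (- h * (h * poly [:1, - 1:] x) ^ n) * (1 / fact (Suc n))) (at x)" .
    moreover have "(1 + real n) * (- h * (h * poly [:1, - 1:] x) ^ n) * (1 / fact (Suc n)) = u' k h x"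
    proof -
      have "1 + real n \<noteq> 0" by linarith
      then have "(1 + real n) * (- h * (h * poly [:1, - 1:] x) ^ n) * (1 / fact (Suc n)) =
          (- h * (h * poly [:1, - 1:] x) ^ n) / fact n"
        unfolding fact_Suc of_nat_Suc times_divide_eq_right mult_1_right by (rule mult_divide_mult_cancel_left)
      then show ?thesis by (simp add: u'_def u_def Suc)
    qed
    ultimately show ?thesis by (simp add: u_def[abs_def] Suc)
  qed (simp add: u_def[abs_def] u'_def)
  have u'_cont: "continuous_on {0..1} (u' k h)" for k h
    unfolding u'_def[abs_def] u_def by (cases k) (auto intro!: continuous_intros)
  have pk: "real_polynomial_function ((lie ^^ k) \<phi>)" for k by (rule poly_lie_pow[OF \<phi>])
  have step: "(\<lambda>h. (u k h 1 * (lie ^^ k) \<phi> (S h 1) - u k h 0 * (lie ^^ k) \<phi> y0) -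
      ((if k = 0 then 0 else - h * J (k - 1) h) + h * J k h)) \<in> bigo_pow (Suc (2 * s))" for k
  proof -
    define \<psi> where "\<psi> = (lie ^^ k) \<phi>"
    have \<psi>: "real_polynomial_function \<psi>" by (simp add: \<psi>_def pk)
    define G where "G i h x = u k h x * partial i \<psi> (S h x)" for i h x
    have G: "graded (2 * s) (G i)" for i
      unfolding G_def[abs_def] by (intro graded_mult u poly_S_graded real_polynomial_partial \<psi>)
    define R where "R h = (\<Sum>i\<in>UNIV. integral {0..1} (\<lambda>x. G i h x * (p i (Z h x) - p i (S h x))))" for h
    have Jk: "integral {0..1} (\<lambda>x. u k h x * (\<Sum>i\<in>UNIV. partial i \<psi> (S h x) * p i (Z h x))) =
        J k h + R h" for h
    proof -
      note cont = graded_continuous[OF G] graded_continuous[OF poly_S_graded[OF poly_p]]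
        graded_continuous[OF poly_Z_graded[OF poly_p]]
      have "u k h x * (\<Sum>i\<in>UNIV. partial i \<psi> (S h x) * p i (Z h x)) =
          u k h x * lie \<psi> (S h x) + (\<Sum>i\<in>UNIV. G i h x * (p i (Z h x) - p i (S h x)))" for x
        by (simp add: lie_def G_def right_diff_distrib sum_subtractf sum_distrib_left mult_ac)
      moreover have "integral {0..1} (\<lambda>x. \<Sum>i\<in>UNIV. G i h x * (p i (Z h x) - p i (S h x))) =
          (\<Sum>i\<in>UNIV. integral {0..1} (\<lambda>x. G i h x * (p i (Z h x) - p i (S h x))))"
        by (intro Henstock_Kurzweil_Integration.integral_sum integrable_continuous_real continuous_intros cont) auto
      moreover have "(\<lambda>x. u k h x * lie \<psi> (S h x)) integrable_on {0..1}"
        by (intro graded_integrable[OF graded_mult[OF u poly_S_graded[OF poly_lie[OF \<psi>]]]])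
      moreover have "(\<lambda>x. \<Sum>i\<in>UNIV. G i h x * (p i (Z h x) - p i (S h x))) integrable_on {0..1}"
        by (intro integrable_continuous_real continuous_intros cont)
      ultimately show ?thesis
        by (simp add: Henstock_Kurzweil_Integration.integral_add J_def \<psi>_def R_def)
    qed
    have J': "integral {0..1} (\<lambda>x. u' k h x * \<psi> (S h x)) = (if k = 0 then 0 else - h * J (k - 1) h)" for h
      by (cases k) (simp_all add: u'_def J_def \<psi>_def mult.assoc)
    have S0: "S h 0 = y0" for h by (simp add: S_def collocation_0)
    have "(\<lambda>h. h ^ 1 * R h) \<in> bigo_pow (Suc (2 * s))"
      unfolding R_def
      by (intro bigo_pow_mult[OF bigo_pow_id, of _ "2 * s"] big_sum_in_bigo stage_defect G \<alpha>) auto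
    from sum_in_bigo(1)[OF increment[OF \<psi> u[of k] u_deriv[of k] u'_cont[of k], unfolded Jk J' S0] this]
    show ?thesis unfolding \<psi>_def[symmetric] by (simp add: algebra_simps)
  qed
  \<comment> \<open>Differentiating the weight of index k yields minus h times J at k - 1, which
    cancels the Lie term of the preceding index.\<close>
  have tele: "(\<Sum>k<Suc n. (if k = 0 then 0 else - h * J (k - 1) h) + h * J k h) = h * J n h" for n h
    by (induction n) simp_all
  \<comment> \<open>At x = 1 only the weight with k = 0 survives, leaving \<open>\<phi>\<close> at
    the numerical solution; at x = 0 the weights are the factors of the Taylor series.\<close>
  have u1: "u k h 1 = (if k = 0 then 1 else 0)" and u0: "u k h 0 = h ^ k / fact k" for k h
    by (simp_all add: u_def)
  have "(\<lambda>h. \<Sum>k<Suc (2 * s). (u k h 1 * (lie ^^ k) \<phi> (S h 1) - u k h 0 * (lie ^^ k) \<phi> y0) -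
      ((if k = 0 then 0 else - h * J (k - 1) h) + h * J k h)) \<in> bigo_pow (Suc (2 * s))"
    by (intro big_sum_in_bigo step)
  moreover have "(\<Sum>k<Suc (2 * s). (u k h 1 * (lie ^^ k) \<phi> (S h 1) - u k h 0 * (lie ^^ k) \<phi> y0) -
      ((if k = 0 then 0 else - h * J (k - 1) h) + h * J k h)) =
      \<phi> (S h 1) - (\<Sum>k<Suc (2 * s). h ^ k / fact k * (lie ^^ k) \<phi> y0) - h * J (2 * s) h" for h
  proof -
    have "(\<Sum>k<Suc (2 * s). u k h 1 * (lie ^^ k) \<phi> (S h 1)) = \<phi> (S h 1)"
      unfolding sum.lessThan_Suc_shift by (simp add: u1)
    then show ?thesis unfolding sum_subtractf tele u0 by simp
  qed
  ultimately have A: "(\<lambda>h. \<phi> (S h 1) - (\<Sum>k<Suc (2 * s). h ^ k / fact k * (lie ^^ k) \<phi> y0) - h * J (2 * s) h)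
      \<in> bigo_pow (Suc (2 * s))" by (simp only:)
  \<comment> \<open>The one integral left by telescoping carries a weight O(h^(2s)), and its factor
    h completes the order.\<close>
  have "ubig (\<lambda>h x. h ^ (2 * s) * ((poly [:1, - 1:] x) ^ (2 * s) * (1 / fact (2 * s)))) (\<lambda>h. h ^ (2 * s))"
    by (intro ubig_mult_pow[where i = "2 * s" and j = 0] ubig_fun_h ubig_fun_x continuous_intros) auto
  then have "ubig (u (2 * s)) (\<lambda>h. h ^ (2 * s))"
    by (simp add: u_def[abs_def] power_mult_distrib mult.assoc)
  then have "J (2 * s) \<in> bigo_pow (2 * s)"
    unfolding J_def[abs_def]
    by (intro bigo_integral ubig_mult_pow[where i = "2 * s" and j = 0] graded_ubig[OF poly_S_graded[OF pk]]) auto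
  then have B: "(\<lambda>h. h ^ 1 * J (2 * s) h) \<in> bigo_pow (Suc (2 * s))"
    by (intro bigo_pow_mult[OF bigo_pow_id]) auto
  from sum_in_bigo(1)[OF A B] show ?thesis by simp
qed

text \<open>For a coordinate function the exact and the numerical expansion share the same Lie
  coefficients at \<open>y0\<close>, so their truncated sums cancel.\<close>

lemma local_error:
  assumes "solves_ivp f y0 y" and "\<alpha> \<in> bigo_pow (2 * s - 2)"
  shows "(\<lambda>h. norm (S h 1 - y h)) \<in> bigo_pow (Suc (2 * s))"
proof -
  have "(\<lambda>h. (S h 1 - y h) $ i) \<in> bigo_pow (Suc (2 * s))" for i
  proof -
    note v = real_polynomial_function_nth[of i]
    have "(\<lambda>h. y (h * 1) $ i - (\<Sum>k<Suc (2 * s). (h * 1) ^ k / fact k * (lie ^^ k) (\<lambda>x. x $ i) y0)) \<in> bigo_pow (Suc (2 * s))"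
      by (rule bigo_eval[OF flow_expansion[OF assms(1) v]]) auto
    from sum_in_bigo(2)[OF numerical_expansion[OF v assms(2)] this] show ?thesis by simp
  qed
  then have "(\<lambda>h. \<Sum>i\<in>UNIV. \<bar>(S h 1 - y h) $ i\<bar>) \<in> bigo_pow (Suc (2 * s))"
    by (intro big_sum_in_bigo) simp
  moreover have "(\<lambda>h. norm (S h 1 - y h)) \<in> O[at_right 0](\<lambda>h. \<Sum>i\<in>UNIV. \<bar>(S h 1 - y h) $ i\<bar>)"
    by (intro bigoI[of _ 1] always_eventually allI) (simp add: norm_le_l1_cart sum_nonneg del: vector_minus_component)
  ultimately show ?thesis by (rule landau_o.big_trans[rotated])
qed

end

subsection \<open>Derivatives of analytic maps\<close>

text \<open>Passing to \<open>nhds\<close> lets filter reasoning intersect the neighbourhoods;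
  \<open>max\<close> restores a non-negative constant.\<close>

lemma flat_atI:
  assumes "\<forall>\<^sub>F x in nhds z. \<bar>\<phi> x\<bar> \<le> B * norm (x - z) ^ n"
  shows "flat_at n z \<phi>"
proof -
  obtain d where d: "d > 0" "\<And>x. dist x z < d \<Longrightarrow> \<bar>\<phi> x\<bar> \<le> B * norm (x - z) ^ n"
    using assms unfolding eventually_nhds_metric by blast
  have "\<bar>\<phi> x\<bar> \<le> max B 0 * norm (x - z) ^ n" if "x \<in> ball z d" for x
  proof -
    have "\<bar>\<phi> x\<bar> \<le> B * norm (x - z) ^ n" using that by (intro d(2)) (simp add: dist_commute)
    also have "\<dots> \<le> max B 0 * norm (x - z) ^ n" by (intro mult_right_mono) auto
    finally show ?thesis .
  qed
  then show ?thesis using d(1) by (intro exI[of _ "max B 0"] conjI exI[of _ d]) auto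
qed

lemma flat_atE:
  assumes "flat_at n z \<phi>"
  obtains B where "B \<ge> 0" "\<forall>\<^sub>F x in nhds z. \<bar>\<phi> x\<bar> \<le> B * norm (x - z) ^ n"
  using assms unfolding eventually_nhds_metric by (metis dist_commute mem_ball)

lemma flat_at_mono:
  assumes "flat_at n z \<phi>" "m \<le> n"
  shows "flat_at m z \<phi>"
proof -
  obtain B where B: "B \<ge> 0" "\<forall>\<^sub>F x in nhds z. \<bar>\<phi> x\<bar> \<le> B * norm (x - z) ^ n"
    using assms(1) by (rule flat_atE)
  have "\<forall>\<^sub>F x in nhds z. dist x z < 1" by (auto simp: eventually_nhds_metric intro: exI[of _ 1])
  with B(2) have "\<forall>\<^sub>F x in nhds z. \<bar>\<phi> x\<bar> \<le> B * norm (x - z) ^ m"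
  proof eventually_elim
    case (elim x)
    have "norm (x - z) ^ n \<le> norm (x - z) ^ m"
      using elim(2) assms(2) by (intro power_decreasing) (auto simp: dist_norm)
    then have "B * norm (x - z) ^ n \<le> B * norm (x - z) ^ m" using B(1) by (rule mult_left_mono)
    with elim(1) show ?case by linarith
  qed
  then show ?thesis by (rule flat_atI)
qed

lemma flat_at_add:
  assumes "flat_at n z \<phi>" "flat_at n z \<psi>"
  shows "flat_at n z (\<lambda>x. \<phi> x + \<psi> x)"
proof -
  obtain B where B: "\<forall>\<^sub>F x in nhds z. \<bar>\<phi> x\<bar> \<le> B * norm (x - z) ^ n" using assms(1) by (rule flat_atE)
  obtain C where C: "\<forall>\<^sub>F x in nhds z. \<bar>\<psi> x\<bar> \<le> C * norm (x - z) ^ n" using assms(2) by (rule flat_atE)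
  have "\<forall>\<^sub>F x in nhds z. \<bar>\<phi> x + \<psi> x\<bar> \<le> (B + C) * norm (x - z) ^ n"
    using B C by eventually_elim (simp add: algebra_simps)
  then show ?thesis by (rule flat_atI)
qed

lemma flat_at_sum:
  "finite A \<Longrightarrow> (\<And>k. k \<in> A \<Longrightarrow> flat_at n z (\<phi> k)) \<Longrightarrow> flat_at n z (\<lambda>x. \<Sum>k\<in>A. \<phi> k x)"
proof (induction A rule: finite_induct)
  case empty
  show ?case by (rule flat_atI[where B = 0]) simp
next
  case (insert a A)
  then show ?case by (simp add: flat_at_add)
qed

lemma flat_at_mult:
  assumes "flat_at n z \<phi>" "flat_at 0 z \<psi>"
  shows "flat_at n z (\<lambda>x. \<phi> x * \<psi> x)"
proof -
  obtain B where B: "B \<ge> 0" "\<forall>\<^sub>F x in nhds z. \<bar>\<phi> x\<bar> \<le> B * norm (x - z) ^ n" using assms(1) by (rule flat_atE)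
  obtain C where C: "C \<ge> 0" "\<forall>\<^sub>F x in nhds z. \<bar>\<psi> x\<bar> \<le> C * norm (x - z) ^ 0" using assms(2) by (rule flat_atE)
  from B(2) C(2) have "\<forall>\<^sub>F x in nhds z. \<bar>\<phi> x * \<psi> x\<bar> \<le> (B * C) * norm (x - z) ^ n"
  proof eventually_elim
    case (elim x)
    have "\<bar>\<phi> x\<bar> * \<bar>\<psi> x\<bar> \<le> (B * norm (x - z) ^ n) * (C * norm (x - z) ^ 0)"
      using elim B(1) by (intro mult_mono) auto
    then show ?case by (simp add: abs_mult mult_ac)
  qed
  then show ?thesis by (rule flat_atI)
qed

lemma flat_at_polynomial:
  assumes "real_polynomial_function \<phi>"
  shows "flat_at 0 z \<phi>"
proof -
  have a: "flat_at 0 z (\<lambda>x. \<phi> x - \<phi> z)"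
    by (rule flat_at_mono[OF real_polynomial_lipschitz_at[OF assms]]) simp
  have b: "flat_at 0 z (\<lambda>x. \<phi> z)" by (rule flat_atI[where B = "\<bar>\<phi> z\<bar>"]) simp
  from flat_at_add[OF a b] show ?thesis by simp
qed

text \<open>Evaluate at the centre, where \<open>0 ^ Suc n = 0\<close>; order 0 would say nothing
  since \<open>0 ^ 0 = 1\<close>.\<close>

lemma flat_at_eq_0:
  assumes "flat_at (Suc n) z \<phi>"
  shows "\<phi> z = 0"
proof -
  obtain B where "\<forall>\<^sub>F x in nhds z. \<bar>\<phi> x\<bar> \<le> B * norm (x - z) ^ Suc n"
    using assms by (rule flat_atE)
  from eventually_nhds_x_imp_x[OF this] show ?thesis by simp
qed

lemma power_series_at_differentiable:
  "power_series_at n z f \<Longrightarrow> f differentiable (at z)"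
  using power_series_at_derivative(1) centre_in_ball by blast

lemma power_series_at_cong:
  assumes "power_series_at n z f" "\<forall>\<^sub>F x in nhds z. f x = g x"
  shows "power_series_at n z g"
proof -
  obtain r a where r: "r > 0" "\<And>k. sum k UNIV < n \<Longrightarrow> a k = 0"
    "\<And>x. x \<in> ball z r \<Longrightarrow> ((\<lambda>k. a k * monomial_at z k x) has_sum f x) UNIV"
    using assms(1) unfolding power_series_at_def by blast
  obtain d where d: "d > 0" "\<And>x. dist x z < d \<Longrightarrow> f x = g x"
    using assms(2) unfolding eventually_nhds_metric by blast
  have "((\<lambda>k. a k * monomial_at z k x) has_sum g x) UNIV" if "x \<in> ball z (min r d)" for x
    using r(3)[of x] d(2)[of x] that by (simp add: dist_commute)
  then show ?thesis
    using r(1,2) d(1) unfolding power_series_at_def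
    by (intro exI[of _ "min r d"] conjI exI[of _ a]) auto
qed

text \<open>The partial of the difference is known to split only near \<open>z\<close>, where the
  difference is differentiable; hence the passage through local equality.\<close>

lemma power_series_at_partial_diff:
  assumes ps: "power_series_at n z (\<lambda>x. f x - q x)" and q: "real_polynomial_function q"
  shows "power_series_at (n - 1) z (\<lambda>x. partial i f x - partial i q x)"
proof (rule power_series_at_cong[OF power_series_at_derivative(2)[OF ps]])
  obtain \<delta> where \<delta>: "\<delta> > 0" "\<And>x. x \<in> ball z \<delta> \<Longrightarrow> (\<lambda>x. f x - q x) differentiable (at x)"
    using power_series_at_derivative(1)[OF ps] by blast
  have "partial i (\<lambda>x. f x - q x) x = partial i f x - partial i q x" if "x \<in> ball z \<delta>" for x
    using partial_add[OF \<delta>(2)[OF that] real_polynomial_differentiable[OF q], of i] by simp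
  then show "\<forall>\<^sub>F x in nhds z. partial i (\<lambda>x. f x - q x) x = partial i f x - partial i q x"
    using \<delta>(1) unfolding eventually_nhds_metric by (intro exI[of _ \<delta>]) (auto simp: dist_commute)
qed

lemma analytic_differentiable:
  assumes "\<And>z. power_series_at 0 z f"
  shows "f differentiable (at x)"
  by (rule power_series_at_differentiable[OF assms])

lemma analytic_partial:
  assumes "\<And>z. power_series_at 0 z f"
  shows "power_series_at 0 z (partial i f)"
  using power_series_at_derivative(2)[OF assms, of z i] by simp

lemma gradient_nth:
  assumes "C differentiable (at x)"
  shows "gradient C x $ i = partial i C x"
proof -
  define g where "g = (\<chi> i. partial i C x)"
  have d: "(C has_derivative (\<lambda>v. inner v g)) (at x)"
    using differentiable_imp_partials[OF assms] by (simp add: g_def inner_vec_def mult.commute)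
  have "gradient C x = g"
    unfolding gradient_def gderiv_def
  proof (rule the_equality)
    show "(C has_derivative (\<lambda>v. inner v g)) (at x)" by (rule d)
    fix g' assume "(C has_derivative (\<lambda>v. inner v g')) (at x)"
    from has_derivative_unique[OF this d] have "inner v g' = inner v g" for v by metis
    then show "g' = g" by (metis vector_eq_ldot)
  qed
  then show ?thesis by (simp add: g_def)
qed

lemma frechet_derivative_nth:
  fixes g :: "real ^ 'm::finite \<Rightarrow> real ^ 'n::finite"
  assumes "\<And>i. (\<lambda>x. g x $ i) differentiable (at x)"
  shows "(g has_derivative (\<lambda>v. \<chi> i. \<Sum>l\<in>UNIV. partial l (\<lambda>x. g x $ i) x * v $ l)) (at x)"
    and "frechet_derivative g (at x) v $ i = (\<Sum>l\<in>UNIV. partial l (\<lambda>x. g x $ i) x * v $ l)"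
proof -
  show d: "(g has_derivative (\<lambda>v. \<chi> i. \<Sum>l\<in>UNIV. partial l (\<lambda>x. g x $ i) x * v $ l)) (at x)"
    unfolding has_derivative_componentwise_within[of g]
  proof
    fix b :: "real ^ 'n" assume "b \<in> Basis"
    then obtain i where b: "b = axis i 1" by (auto simp: Basis_vec_def)
    show "((\<lambda>x. inner (g x) b) has_derivative (\<lambda>v. inner (\<chi> i. \<Sum>l\<in>UNIV. partial l (\<lambda>x. g x $ i) x * v $ l) b)) (at x)"
      using differentiable_imp_partials[OF assms[of i]] by (simp add: b inner_axis)
  qed
  then show "frechet_derivative g (at x) v $ i = (\<Sum>l\<in>UNIV. partial l (\<lambda>x. g x $ i) x * v $ l)"
    by (simp add: frechet_derivative_at[OF d, symmetric])
qed

lemma second_derivative_nth: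
  fixes g :: "real ^ 'm::finite \<Rightarrow> real ^ 'n::finite"
  assumes g: "\<And>i z. power_series_at 0 z (\<lambda>x. g x $ i)"
  shows "second_derivative g x u v $ i =
    (\<Sum>m\<in>UNIV. (\<Sum>l\<in>UNIV. partial m (partial l (\<lambda>x. g x $ i)) x * v $ l) * u $ m)"
proof -
  have d: "partial l (\<lambda>x. g x $ i) differentiable (at x)" for l i x
    by (intro analytic_differentiable analytic_partial g)
  have e: "frechet_derivative g (at z) v $ i = (\<Sum>l\<in>UNIV. partial l (\<lambda>x. g x $ i) z * v $ l)" for z i
    by (intro frechet_derivative_nth analytic_differentiable g)
  have "second_derivative g x u v $ i =
      (\<Sum>m\<in>UNIV. partial m (\<lambda>z. \<Sum>l\<in>UNIV. partial l (\<lambda>x. g x $ i) z * v $ l) x * u $ m)"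
    unfolding second_derivative_def
    by (subst frechet_derivative_nth(2)) (auto simp: e intro!: differentiable_sum differentiable_mult d)
  also have "\<dots> = (\<Sum>m\<in>UNIV. (\<Sum>l\<in>UNIV. partial m (partial l (\<lambda>x. g x $ i)) x * v $ l) * u $ m)"
    by (intro sum.cong refl arg_cong2[where f = "(*)"])
      (subst partial_sum, auto intro!: differentiable_mult d simp: partial_mult d partial_const)
  finally show ?thesis .
qed

subsection \<open>Conservation of the invariant\<close>

lemma integral_poly_inner:
  fixes F :: "real \<Rightarrow> real ^ 'm::finite"
  assumes "continuous_on {0..1} F"
  shows "integral {0..1} (\<lambda>x. poly p x *\<^sub>R F x) \<bullet> v = integral {0..1} (\<lambda>x. poly p x * (F x \<bullet> v))"
proof -
  have "(\<lambda>x. poly p x *\<^sub>R F x) integrable_on {0..1}"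
    by (intro integrable_continuous_real continuous_intros assms)
  from integral_linear[OF this bounded_linear_inner_left[of v]] show ?thesis
    by (simp add: o_def)
qed

context gauss
begin

text \<open>Fundamental theorem along the path. The coefficients \<open>\<gamma>\<close> are
  arbitrary because it is applied to the modified ones that generate \<open>sigma1\<close>.\<close>

lemma line_integral_collocation:
  fixes C :: "real ^ 'm::finite \<Rightarrow> real"
  assumes C: "\<And>x. C differentiable (at x)" and cont: "\<And>x. continuous (at x) (gradient C)"
  shows "C (y0 + h *\<^sub>R \<gamma> 0) - C y0 =
    h * (\<Sum>j<s. integral {0..1} (\<lambda>x. poly (P j) x *\<^sub>R gradient C (collocation y0 h \<gamma> x)) \<bullet> \<gamma> j)"
proof -
  define \<sigma> where "\<sigma> = collocation y0 h \<gamma>"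
  define D where "D x = (\<Sum>j<s. h * (poly (P j) x * (gradient C (\<sigma> x) \<bullet> \<gamma> j)))" for x
  have \<sigma>': "(\<sigma> has_vector_derivative h *\<^sub>R (\<Sum>j<s. poly (P j) x *\<^sub>R \<gamma> j)) (at x within A)" for x A
    unfolding \<sigma>_def by (rule has_derivative_collocation)
  then have "continuous_on {0..1} \<sigma>"
    by (auto simp: continuous_on_eq_continuous_within intro: has_vector_derivative_continuous)
  then have cg: "continuous_on {0..1} (\<lambda>x. gradient C (\<sigma> x))"
    using continuous_on_compose2[of UNIV "gradient C"] cont continuous_at_imp_continuous_on by blast
  have "((\<lambda>x. C (\<sigma> x)) has_vector_derivative D x) (at x within {0..1})" for x
  proof -
    have dC: "(C has_derivative (\<lambda>v. gradient C z \<bullet> v)) (at z)" for z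
      using differentiable_imp_partials[OF C[of z]] by (simp add: inner_vec_def gradient_nth[OF C])
    from has_derivative_compose[OF \<sigma>'[unfolded has_vector_derivative_def] dC]
    show ?thesis
      unfolding has_vector_derivative_def D_def
      by (rule has_derivative_eq_rhs) (simp add: fun_eq_iff inner_sum_right sum_distrib_left mult_ac)
  qed
  then have "(D has_integral C (\<sigma> 1) - C (\<sigma> 0)) {0..1}"
    by (intro fundamental_theorem_of_calculus) auto
  moreover have "integral {0..1} D = (\<Sum>j<s. integral {0..1} (\<lambda>x. h * (poly (P j) x * (gradient C (\<sigma> x) \<bullet> \<gamma> j))))"
    unfolding D_def
    by (intro Henstock_Kurzweil_Integration.integral_sum integrable_continuous_real continuous_intros cg) auto
  ultimately show ?thesis
    by (simp add: integral_unique integral_poly_inner[OF cg] \<sigma>_def[symmetric] sum_distrib_left)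
      (simp add: \<sigma>_def collocation_0 collocation_1)
qed

text \<open>The segment is parametrised to reach \<open>b\<close> at t = 1, which is the form of
  \<open>sigma2\<close>.\<close>

lemma line_integral_segment:
  fixes C :: "real ^ 'm::finite \<Rightarrow> real"
  assumes C: "\<And>x. C differentiable (at x)" and cont: "\<And>x. continuous (at x) (gradient C)"
  shows "C b - C (b - k *\<^sub>R v) = k * (integral {0..1} (\<lambda>t. gradient C (b + ((t - 1) * k) *\<^sub>R v)) \<bullet> v)"
proof -
  define \<sigma> where "\<sigma> t = b + ((t - 1) * k) *\<^sub>R v" for t
  have \<sigma>': "(\<sigma> has_vector_derivative k *\<^sub>R v) (at x within A)" for x A
    unfolding \<sigma>_def[abs_def] by (auto intro!: derivative_eq_intros)
  then have "continuous_on {0..1} \<sigma>"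
    by (auto simp: continuous_on_eq_continuous_within intro: has_vector_derivative_continuous)
  then have cg: "continuous_on {0..1} (\<lambda>x. gradient C (\<sigma> x))"
    using continuous_on_compose2[of UNIV "gradient C"] cont continuous_at_imp_continuous_on by blast
  have "((\<lambda>x. C (\<sigma> x)) has_vector_derivative k * (gradient C (\<sigma> x) \<bullet> v)) (at x within {0..1})" for x
  proof -
    have dC: "(C has_derivative (\<lambda>v. gradient C z \<bullet> v)) (at z)" for z
      using differentiable_imp_partials[OF C[of z]] by (simp add: inner_vec_def gradient_nth[OF C])
    from has_derivative_compose[OF \<sigma>'[unfolded has_vector_derivative_def] dC]
    show ?thesis
      unfolding has_vector_derivative_def
      by (rule has_derivative_eq_rhs) (simp add: fun_eq_iff mult_ac)
  qed
  then have "((\<lambda>x. k * (gradient C (\<sigma> x) \<bullet> v)) has_integral C (\<sigma> 1) - C (\<sigma> 0)) {0..1}"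
    by (intro fundamental_theorem_of_calculus) auto
  from integral_unique[OF this]
  have "C (\<sigma> 1) - C (\<sigma> 0) = k * integral {0..1} (\<lambda>x. gradient C (\<sigma> x) \<bullet> v)" by simp
  also have "integral {0..1} (\<lambda>x. gradient C (\<sigma> x) \<bullet> v) = integral {0..1} (\<lambda>x. gradient C (\<sigma> x)) \<bullet> v"
    using integral_poly_inner[OF cg, of "[:1:]"] by simp
  finally show ?thesis by (simp add: \<sigma>_def)
qed

text \<open>The equation for \<open>\<alpha>\<close> says exactly that the step conserves \<open>C\<close>; this holds for any vectors
  in place of \<open>dir s \<gamma> j\<close>, so the values \<open>\<phi>\<^bsub>ij\<^esub>\<close> are never needed.\<close>

lemma invariant_drift:
  fixes C :: "real ^ 'm::finite \<Rightarrow> real"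
  assumes C: "\<And>x. C differentiable (at x)" and cont: "\<And>x. continuous (at x) (gradient C)"
  shows "C (y0 + h *\<^sub>R \<gamma> 0) - C y0 = h * (Numer P s (gradient C) (\<bullet>) y0 h \<alpha> \<gamma> - \<alpha> * Denom P s (gradient C) (\<bullet>) y0 h \<alpha> \<gamma>)"
proof -
  \<comment> \<open>With these coefficients \<open>sigma1\<close> is a collocation path from
    \<open>y0\<close>.\<close>
  define \<gamma>' where "\<gamma>' j = \<gamma> j - \<alpha> *\<^sub>R dir s \<gamma> j" for j
  define \<rho> where "\<rho> = coeff1 P s (gradient C) y0 h \<alpha> \<gamma>"
  define d where "d = dir s \<gamma>"
  have "sigma1 P s y0 h \<alpha> \<gamma> x = collocation y0 h \<gamma>' x" if "x \<in> {0..1}" for x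
    using that by (simp add: sigma1_def collocation_def \<gamma>'_def integral_eq_antideriv)
  then have \<rho>: "\<rho> j = integral {0..1} (\<lambda>x. poly (P j) x *\<^sub>R gradient C (collocation y0 h \<gamma>' x))" for j
    unfolding \<rho>_def coeff1_def by (intro Henstock_Kurzweil_Integration.integral_cong) simp
  have 1: "C (y0 + h *\<^sub>R \<gamma>' 0) - C y0 = h * (\<Sum>j<s. \<rho> j \<bullet> \<gamma>' j)"
    unfolding \<rho> by (rule line_integral_collocation[OF C cont])
  \<comment> \<open>The end of \<open>sigma1\<close> is the start of \<open>sigma2\<close>, which
    then leads to the numerical solution; adding both line integrals gives the drift.\<close>
  have e: "y0 + h *\<^sub>R \<gamma> 0 - (\<alpha> * h) *\<^sub>R d 0 = y0 + h *\<^sub>R \<gamma>' 0"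
    by (simp add: \<gamma>'_def d_def algebra_simps)
  have 2: "C (y0 + h *\<^sub>R \<gamma> 0) - C (y0 + h *\<^sub>R \<gamma>' 0) = \<alpha> * h * (mean2 s (gradient C) y0 h \<alpha> \<gamma> \<bullet> d 0)"
    using line_integral_segment[OF C cont, of "y0 + h *\<^sub>R \<gamma> 0" "\<alpha> * h" "d 0", unfolded e]
    by (simp add: mean2_def sigma2_def d_def mult.assoc)
  have split: "(\<Sum>j<s. F j) = F 0 + (\<Sum>j\<in>{1..<s}. F j)" for F :: "nat \<Rightarrow> real"
    using s2 sum.atLeast_Suc_lessThan[of 0 s F] by (simp add: lessThan_atLeast0)
  have 3: "(\<Sum>j<s. \<rho> j \<bullet> \<gamma>' j) = (\<Sum>j<s. \<rho> j \<bullet> \<gamma> j) - \<alpha> * (\<rho> 0 \<bullet> d 0 + (\<Sum>j\<in>{1..<s}. \<rho> j \<bullet> d j))"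
    unfolding split[of "\<lambda>j. \<rho> j \<bullet> d j", symmetric]
    by (simp add: \<gamma>'_def d_def inner_diff_right sum_subtractf sum_distrib_left)
  show ?thesis
    using 1[unfolded 3] 2 unfolding Numer_def Denom_def \<rho>_def[symmetric] d_def[symmetric]
    by (simp add: inner_diff_left algebra_simps)
qed

end

lemma equip_order:
  fixes f :: "real ^ 'm::finite \<Rightarrow> real ^ 'm" and C :: "real ^ 'm \<Rightarrow> real"
  assumes s: "s \<ge> 2" and P: "orthonormal_legendre P" and c: "gauss_nodes P s c"
    and f: "real_analytic f" and lip: "L-lipschitz_on UNIV f"
    and C: "real_analytic C" and inv: "\<And>x. gradient C x \<bullet> f x = 0"
    and y: "solves_ivp f y0 y"
    and nondeg: "second_derivative (gradient C) y0 (f y0) (f y0) \<bullet> f y0 \<noteq> 0"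
    and sol: "\<forall>\<^sub>F h in at_right 0. \<bar>\<alpha> h\<bar> \<le> K * h\<^sup>2 \<and> equip_system P s c f (gradient C) (\<bullet>) y0 h (\<alpha> h) (\<gamma> h)"
  shows "(\<lambda>h. norm (y0 + h *\<^sub>R \<gamma> h 0 - y h)) \<in> O[at_right 0](\<lambda>h. h ^ (2 * s + 1))"
proof -
  interpret gauss P s c using P c s by unfold_locales
  note psC = real_analytic_power_series_at[OF C]
  note psf = real_analytic_power_series_at[OF real_analytic_nth[OF f]]
  have C_diff: "C differentiable (at x)" for x by (rule analytic_differentiable[OF psC])
  have g_nth: "gradient C x $ i = partial i C x" for x i by (rule gradient_nth[OF C_diff])
  have psg: "power_series_at 0 z (\<lambda>x. gradient C x $ i)" for z i
    unfolding g_nth by (rule analytic_partial[OF psC])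
  have g_cont: "continuous (at x) (gradient C)" for x
    using frechet_derivative_nth(1)[OF analytic_differentiable[OF psg]] by (rule has_derivative_continuous)
  \<comment> \<open>Order 2s + 2 suffices for all uses: 2s + 1 for the value of \<open>C\<close>
    after the step, 2s for the invariance relation after one derivative, and at least 1 for third
    derivatives at \<open>y0\<close>.\<close>
  have "\<forall>i. \<exists>p. real_polynomial_function p \<and> power_series_at (2 * s + 2) y0 (\<lambda>x. f x $ i - p x)"
    using power_series_at_truncate[OF psf] by blast
  then obtain p where p: "\<And>i. real_polynomial_function (p i)"
    and fp: "\<And>i. power_series_at (2 * s + 2) y0 (\<lambda>x. f x $ i - p i x)" by metis
  obtain E where E: "real_polynomial_function E" and CE: "power_series_at (2 * s + 2) y0 (\<lambda>x. C x - E x)"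
    using power_series_at_truncate[OF psC] by blast
  have pE: "real_polynomial_function (partial i E)" for i by (intro real_polynomial_partial E)
  have \<alpha>: "\<alpha> \<in> bigo_pow 2"
    using sol by (intro bigoI[of _ K]) (auto elim!: eventually_mono)
  have stages: "\<forall>\<^sub>F h in at_right 0. \<forall>j<s. \<gamma> h j = Psi P s c f y0 h (\<alpha> h) (\<gamma> h) j"
    using sol by (auto elim!: eventually_mono simp: equip_system_def)
  interpret equip_run P s c f p y0 \<alpha> \<gamma> L
    by unfold_locales (fact lip p power_series_at_bound[OF fp] \<alpha> stages)+
  have S1: "S h 1 = y0 + h *\<^sub>R \<gamma> h 0" for h by (simp add: S_def collocation_1)
  have conserved: "(\<lambda>h. E (S h 1) - E y0) \<in> bigo_pow (Suc (2 * s))"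
  proof -
    have flat: "flat_at (Suc (2 * s)) y0 (\<lambda>x. C x - E x)"
      by (rule flat_at_mono[OF power_series_at_bound[OF CE]]) simp
    have "(\<lambda>h. C (S h 1) - E (S h 1)) \<in> bigo_pow (Suc (2 * s))"
      by (rule bigo_eval[OF near_bigo_pow[OF near_S flat]]) simp
    then have "(\<lambda>h. - (C (S h 1) - E (S h 1))) \<in> bigo_pow (Suc (2 * s))"
      by (simp only: landau_o.big.uminus_in_iff)
    \<comment> \<open>Since the denominator is non-zero, the quotient equation makes the drift of
      \<open>C\<close> vanish exactly; only the passage from \<open>C\<close> to \<open>E\<close>
      leaves an error.\<close>
    moreover have ev: "\<forall>\<^sub>F h in at_right 0. E (S h 1) - E y0 = - (C (S h 1) - E (S h 1))"
      using sol
    proof eventually_elim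
      case (elim h)
      have "Numer P s (gradient C) (\<bullet>) y0 h (\<alpha> h) (\<gamma> h) = \<alpha> h * Denom P s (gradient C) (\<bullet>) y0 h (\<alpha> h) (\<gamma> h)"
        using elim unfolding equip_system_def by (metis nonzero_eq_divide_eq)
      then have "C (S h 1) = C y0"
        using invariant_drift[OF C_diff g_cont, of y0 h "\<gamma> h" "\<alpha> h"] by (simp add: S1)
      moreover have "C y0 = E y0" using flat_at_eq_0[OF flat] by simp
      ultimately show ?case by simp
    qed
    ultimately show ?thesis using landau_o.big.in_cong[OF ev] by blast
  qed
  have flatE: "flat_at (2 * s + 1) y0 (\<lambda>x. partial i C x - partial i E x)" for i
    using power_series_at_bound[OF power_series_at_partial_diff[OF CE E]] by simp
  have flatf: "flat_at 0 y0 (\<lambda>x. f x $ i)" for i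
    using power_series_at_bound[OF psf] .
  have flatp: "flat_at (2 * s) y0 (\<lambda>x. - 1 * (f x $ i - p i x))" for i
    using flat_at_mult[OF flat_at_mono[OF power_series_at_bound[OF fp]] flat_at_polynomial[OF real_polynomial_function.intros(2)], of "2 * s" i "- 1"]
    by (simp add: mult.commute)
  have invariant: "flat_at (2 * s) y0 (\<lambda>x. \<Sum>i\<in>UNIV. partial i E x * p i x)"
  proof -
    \<comment> \<open>The product of the truncated gradient and field is compared with the exact
      product, which is zero, by changing one factor at a time.\<close>
    have "flat_at (2 * s) y0 (\<lambda>x. \<Sum>i\<in>UNIV. - 1 * (f x $ i - p i x) * partial i E x
        + (partial i C x - partial i E x) * (- 1 * f x $ i))"
    proof (rule flat_at_sum, simp, rule flat_at_add; rule flat_at_mult)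
      fix i
      show "flat_at (2 * s) y0 (\<lambda>x. - 1 * (f x $ i - p i x))" by (rule flatp)
      show "flat_at 0 y0 (partial i E)" by (rule flat_at_polynomial[OF pE])
      show "flat_at (2 * s) y0 (\<lambda>x. partial i C x - partial i E x)"
        by (rule flat_at_mono[OF flatE]) simp
      show "flat_at 0 y0 (\<lambda>x. - 1 * f x $ i)" using flatf[of i] by simp
    qed
    moreover have "(\<Sum>i\<in>UNIV. - 1 * (f x $ i - p i x) * partial i E x
        + (partial i C x - partial i E x) * (- 1 * f x $ i)) = (\<Sum>i\<in>UNIV. partial i E x * p i x)" for x
    proof -
      have "(\<Sum>i\<in>UNIV. partial i C x * f x $ i) = 0" using inv[of x] by (simp add: inner_vec_def g_nth)
      then show ?thesis by (simp add: algebra_simps sum.distrib sum_subtractf sum_negf)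
    qed
    ultimately show ?thesis by simp
  qed
  have f0: "p i y0 = f y0 $ i" for i
  proof -
    have "flat_at (Suc (2 * s + 1)) y0 (\<lambda>x. f x $ i - p i x)"
      using power_series_at_bound[OF fp[of i]] by simp
    from flat_at_eq_0[OF this] show ?thesis by simp
  qed
  have third: "partial m (partial l (partial i C)) y0 = partial m (partial l (partial i E)) y0" for m l i
  proof -
    have "power_series_at (2 * s + 2 - 1 - 1 - 1) y0
        (\<lambda>x. partial m (partial l (partial i C)) x - partial m (partial l (partial i E)) x)"
      by (intro power_series_at_partial_diff CE E real_polynomial_partial)
    moreover have "2 * s + 2 - 1 - 1 - 1 = Suc (2 * s - 2)" using s by simp
    ultimately have "power_series_at (Suc (2 * s - 2)) y0
        (\<lambda>x. partial m (partial l (partial i C)) x - partial m (partial l (partial i E)) x)" by (simp only:)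
    from flat_at_eq_0[OF power_series_at_bound[OF this]] show ?thesis by simp
  qed
  have "second_derivative (gradient C) y0 (f y0) (f y0) \<bullet> f y0 =
    (\<Sum>i\<in>UNIV. \<Sum>l\<in>UNIV. \<Sum>m\<in>UNIV. p i y0 * p l y0 * p m y0 * partial m (partial l (partial i E)) y0)"
  proof -
    have "second_derivative (gradient C) y0 (f y0) (f y0) \<bullet> f y0 =
      (\<Sum>i\<in>UNIV. \<Sum>m\<in>UNIV. \<Sum>l\<in>UNIV. p i y0 * p l y0 * p m y0 * partial m (partial l (partial i E)) y0)"
      unfolding inner_vec_def second_derivative_nth[OF psg]
      by (simp add: g_nth third f0 sum_distrib_left sum_distrib_right mult_ac)
    also have "\<dots> = (\<Sum>i\<in>UNIV. \<Sum>l\<in>UNIV. \<Sum>m\<in>UNIV. p i y0 * p l y0 * p m y0 * partial m (partial l (partial i E)) y0)"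
      by (rule sum.cong[OF refl]) (rule sum.swap)
    finally show ?thesis .
  qed
  with nondeg have "\<alpha> \<in> bigo_pow (2 * s - 2)"
    by (intro alpha_order[OF E conserved invariant]) simp
  from local_error[OF y this] show ?thesis by (simp add: S1)
qed

text \<open>Symmetry of second derivatives is inherited from a Taylor polynomial with contact of
  order 3, whose second partials agree at the point and commute.\<close>

lemma jacobian_gradient_symmetric:
  fixes C :: "real ^ 'm::finite \<Rightarrow> real"
  assumes "real_analytic C"
  shows "transpose (jacobian (gradient C) (at x)) = jacobian (gradient C) (at x)"
proof -
  note psC = real_analytic_power_series_at[OF assms]
  have g_nth: "gradient C x $ i = partial i C x" for x i
    by (rule gradient_nth[OF analytic_differentiable[OF psC]])
  obtain E where E: "real_polynomial_function E" and CE: "power_series_at 3 x (\<lambda>z. C z - E z)"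
    using power_series_at_truncate[OF psC] by blast
  have "partial l (partial i C) x = partial l (partial i E) x" for l i
  proof -
    have "power_series_at (3 - 1 - 1) x (\<lambda>z. partial l (partial i C) z - partial l (partial i E) z)"
      by (intro power_series_at_partial_diff CE E real_polynomial_partial)
    then have "power_series_at (Suc 0) x (\<lambda>z. partial l (partial i C) z - partial l (partial i E) z)" by simp
    from flat_at_eq_0[OF power_series_at_bound[OF this]] show ?thesis by simp
  qed
  moreover have "jacobian (gradient C) (at x) $ i $ l = partial l (partial i C) x" for i l
    unfolding jacobian_def matrix_def
    by (simp add: frechet_derivative_nth(2)[OF analytic_differentiable] g_nth analytic_partial psC
        axis_def if_distrib sum.delta cong: if_cong)
  ultimately have "jacobian (gradient C) (at x) $ l $ i = jacobian (gradient C) (at x) $ i $ l" for i l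
    using real_polynomial_partial_commute[OF E] by simp
  then show ?thesis
    by (simp add: Finite_Cartesian_Product.vec_eq_iff transpose_def)
qed

lemma quadratic_form_transpose:
  fixes A :: "real ^ 'm::finite ^ 'm"
  shows "v \<bullet> (transpose A *v v) = v \<bullet> (A *v v)"
  by (simp add: inner_commute[of v "v v* A"] dot_lmul_matrix)

subsection \<open>The Hamiltonian case\<close>

lemma has_derivative_matrix_vector_mult:
  fixes g :: "real ^ 'm::finite \<Rightarrow> real ^ 'n::finite" and A :: "real ^ 'n ^ 'k::finite"
  assumes "g differentiable (at x)"
  shows "frechet_derivative (\<lambda>z. A *v g z) (at x) = (\<lambda>v. A *v frechet_derivative g (at x) v)"
  using bounded_linear.has_derivative[OF matrix_vector_mul_bounded_linear[of A] frechet_derivative_works[THEN iffD1, OF assms]]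
  by (rule frechet_derivative_at[symmetric])

lemma second_derivative_matrix_vector_mult:
  fixes g :: "real ^ 'm::finite \<Rightarrow> real ^ 'n::finite" and A :: "real ^ 'n ^ 'k::finite"
  assumes g: "\<And>i z. power_series_at 0 z (\<lambda>x. g x $ i)"
  shows "second_derivative (\<lambda>z. A *v g z) x u v = A *v second_derivative g x u v"
proof -
  have d: "g differentiable (at z)" for z
    using frechet_derivative_nth(1)[OF analytic_differentiable[OF g]] differentiableI by blast
  have d': "partial l (\<lambda>x. g x $ i) differentiable (at x)" for l i
    by (rule analytic_differentiable[OF analytic_partial[OF g]])
  have "(\<lambda>z. frechet_derivative g (at z) v $ i) differentiable (at x)" for i
    unfolding frechet_derivative_nth(2)[OF analytic_differentiable[OF g]]
    by (auto intro!: differentiable_sum differentiable_mult d')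
  from frechet_derivative_nth(1)[OF this]
  have "(\<lambda>z. frechet_derivative g (at z) v) differentiable (at x)" by (rule differentiableI)
  then show ?thesis
    by (simp add: second_derivative_def has_derivative_matrix_vector_mult d)
qed

lemma integral_matrix_vector_mult:
  fixes F :: "real \<Rightarrow> real ^ 'm::finite" and A :: "real ^ 'm ^ 'k::finite"
  assumes "continuous_on {0..1} F"
  shows "integral {0..1} (\<lambda>x. A *v F x) = A *v integral {0..1} F"
  using integral_linear[OF integrable_continuous_real[OF assms] matrix_vector_mul_bounded_linear[of A]]
  by (simp add: o_def)

context gauss
begin

lemma continuous_sigma1: "continuous_on {0..1} (sigma1 P s y0 h \<alpha> \<gamma>)"
proof -
  have "continuous_on {0..1} (\<lambda>x. y0 + h *\<^sub>R (\<Sum>j<s. poly (antideriv (P j)) x *\<^sub>R (\<gamma> j - \<alpha> *\<^sub>R dir s \<gamma> j)))"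
    by (intro continuous_intros)
  then show ?thesis
    by (rule continuous_on_eq) (simp add: sigma1_def integral_eq_antideriv)
qed

lemma continuous_sigma2: "continuous_on {0..1} (sigma2 s y0 h \<alpha> \<gamma>)"
  unfolding sigma2_def[abs_def] by (intro continuous_intros)

lemma coeff1_matrix_vector_mult:
  assumes "continuous_on UNIV g"
  shows "coeff1 P s (\<lambda>x. A *v g x) y0 h \<alpha> \<gamma> j = A *v coeff1 P s g y0 h \<alpha> \<gamma> j"
proof -
  have "continuous_on {0..1} (\<lambda>x. g (sigma1 P s y0 h \<alpha> \<gamma> x))"
    using continuous_on_compose2[OF assms continuous_sigma1] by blast
  then have "continuous_on {0..1} (\<lambda>x. poly (P j) x *\<^sub>R g (sigma1 P s y0 h \<alpha> \<gamma> x))"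
    by (intro continuous_intros)
  from integral_matrix_vector_mult[OF this, of A] show ?thesis
    by (simp add: coeff1_def matrix_vector_mult_scaleR)
qed

lemma mean2_matrix_vector_mult:
  assumes "continuous_on UNIV g"
  shows "mean2 s (\<lambda>x. A *v g x) y0 h \<alpha> \<gamma> = A *v mean2 s g y0 h \<alpha> \<gamma>"
proof -
  have "continuous_on {0..1} (\<lambda>x. g (sigma2 s y0 h \<alpha> \<gamma> x))"
    using continuous_on_compose2[OF assms continuous_sigma2] by blast
  from integral_matrix_vector_mult[OF this] show ?thesis by (simp add: mean2_def)
qed

end

lemma symplectic_J_nth:
  shows "(symplectic_J *v v) $ Inl k = v $ Inr k" and "(symplectic_J *v v) $ Inr k = - v $ Inl k"
proof -
  have "symplectic_J $ Inl k $ j = (if j = Inr k then 1 else 0)"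
    "symplectic_J $ Inr k $ j = (if j = Inl k then - 1 else 0)" for j
    by (cases j; auto simp: symplectic_J_def)+
  then show "(symplectic_J *v v) $ Inl k = v $ Inr k" "(symplectic_J *v v) $ Inr k = - v $ Inl k"
    by (simp_all add: matrix_vector_mult_def if_distrib[of "\<lambda>t. t * _"] cong: if_cong)
qed

lemma inner_sum_index:
  fixes v w :: "real ^ ('d::finite + 'd)"
  shows "v \<bullet> w = (\<Sum>k\<in>UNIV. v $ Inl k * w $ Inl k) + (\<Sum>k\<in>UNIV. v $ Inr k * w $ Inr k)"
  unfolding inner_vec_def UNIV_Plus_UNIV[symmetric] by (subst sum.Plus) auto

lemma symplectic_J_inner: "(symplectic_J *v v) \<bullet> (symplectic_J *v w) = v \<bullet> w"
  unfolding inner_sum_index by (simp add: symplectic_J_nth)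

lemma symplectic_J_isotropic: "v \<bullet> (symplectic_J *v v) = 0"
  unfolding inner_sum_index by (simp add: symplectic_J_nth sum_negf mult.commute)

text \<open>With f = J g, the Hamiltonian pairing of an average of f with a vector v is the inner
  product of J applied to the average of g with J v. J is orthogonal, so both copies of it drop out
  and the numerator and denominator for g remain.\<close>

lemma equip_system_hamiltonian:
  fixes g :: "real ^ ('d::finite + 'd) \<Rightarrow> real ^ ('d + 'd)"
  assumes "gauss P s c" and g: "continuous_on UNIV g"
  defines "f \<equiv> \<lambda>x. symplectic_J *v g x"
  shows "equip_system P s c f f (\<lambda>u v. u \<bullet> (symplectic_J *v v)) y0 h \<alpha> \<gamma> \<longleftrightarrow> equip_system P s c f g (\<bullet>) y0 h \<alpha> \<gamma>"
proof -
  interpret gauss P s c by fact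
  have "Numer P s f (\<lambda>u v. u \<bullet> (symplectic_J *v v)) y0 h \<alpha> \<gamma> = Numer P s g (\<bullet>) y0 h \<alpha> \<gamma>"
    by (simp add: Numer_def f_def coeff1_matrix_vector_mult[OF g] symplectic_J_inner)
  moreover have "Denom P s f (\<lambda>u v. u \<bullet> (symplectic_J *v v)) y0 h \<alpha> \<gamma> = Denom P s g (\<bullet>) y0 h \<alpha> \<gamma>"
    by (simp add: Denom_def f_def coeff1_matrix_vector_mult[OF g] mean2_matrix_vector_mult[OF g]
        symplectic_J_inner flip: matrix_vector_mult_diff_distrib)
  ultimately show ?thesis by (simp add: equip_system_def)
qed

theorem theorem7:
  fixes s :: nat and P :: "nat \<Rightarrow> real poly" and c :: "nat \<Rightarrow> real" and K :: real
  assumes "s \<ge> 2" and "K > 0"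
    and "orthonormal_legendre P" and "gauss_nodes P s c"
  shows
    "(\<forall>(f :: real ^ 'm \<Rightarrow> real ^ 'm) (C :: real ^ 'm \<Rightarrow> real) y0 y \<alpha> \<gamma>.
        real_analytic f \<and> (\<exists>L. L-lipschitz_on UNIV f) \<and>
        real_analytic C \<and> (\<forall>x. gradient C x \<bullet> f x = 0) \<and>
        solves_ivp f y0 y \<and>
        (let g = gradient C; f0 = f y0; f0' = jacobian f (at y0); g0' = jacobian g (at y0) in
           f0 \<bullet> ((transpose g0' ** f0' - transpose (g0' ** f0')) *v f0)
             - second_derivative g y0 f0 f0 \<bullet> f0 \<noteq> 0) \<and>
        (\<forall>\<^sub>F h in at_right 0.
           unique_equip_solution P s c K f (gradient C) (\<lambda>u v. u \<bullet> v) y0 h (\<alpha> h) (\<gamma> h))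
        \<longrightarrow> (\<lambda>h. norm (y0 + h *\<^sub>R \<gamma> h 0 - y h)) \<in> O[at_right 0](\<lambda>h. h ^ (2 * s + 1)))
     \<and>
     (\<forall>(f :: real ^ ('d::finite + 'd) \<Rightarrow> real ^ ('d + 'd)) (H :: real ^ ('d + 'd) \<Rightarrow> real) y0 y \<alpha> \<gamma>.
        real_analytic f \<and> (\<exists>L. L-lipschitz_on UNIV f) \<and>
        real_analytic H \<and> (\<forall>x. f x = symplectic_J *v gradient H x) \<and>
        solves_ivp f y0 y \<and>
        (let f0 = f y0 in second_derivative f y0 f0 f0 \<bullet> (symplectic_J *v f0) \<noteq> 0) \<and>
        (\<forall>\<^sub>F h in at_right 0.
           unique_equip_solution P s c K f f (\<lambda>u v. u \<bullet> (symplectic_J *v v)) y0 h (\<alpha> h) (\<gamma> h))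
        \<longrightarrow> (\<lambda>h. norm (y0 + h *\<^sub>R \<gamma> h 0 - y h)) \<in> O[at_right 0](\<lambda>h. h ^ (2 * s + 1)))"
proof (intro conjI allI impI; elim conjE exE)
  fix f :: "real ^ 'm \<Rightarrow> real ^ 'm" and C :: "real ^ 'm \<Rightarrow> real" and y0 y \<alpha> \<gamma> L
  assume f: "real_analytic f" and lip: "L-lipschitz_on UNIV f" and C: "real_analytic C"
    and inv: "\<forall>x. gradient C x \<bullet> f x = 0" and y: "solves_ivp f y0 y"
    and nondeg: "let g = gradient C; f0 = f y0; f0' = jacobian f (at y0); g0' = jacobian g (at y0) in
           f0 \<bullet> ((transpose g0' ** f0' - transpose (g0' ** f0')) *v f0)
             - second_derivative g y0 f0 f0 \<bullet> f0 \<noteq> 0"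
    and sol: "\<forall>\<^sub>F h in at_right 0.
           unique_equip_solution P s c K f (gradient C) (\<lambda>u v. u \<bullet> v) y0 h (\<alpha> h) (\<gamma> h)"
  \<comment> \<open>To be used with A =
    \<open>jacobian (gradient C) (at y0) ** jacobian f (at y0)\<close>, whose first factor equals
    its transpose.\<close>
  have "f y0 \<bullet> ((A - transpose A) *v f y0) = 0" for A
    using quadratic_form_transpose[of "f y0" A]
    by (simp add: matrix_vector_mult_diff_rdistrib inner_diff_right)
  with nondeg have nondeg': "second_derivative (gradient C) y0 (f y0) (f y0) \<bullet> f y0 \<noteq> 0"
    by (simp add: Let_def jacobian_gradient_symmetric[OF C])
  show "(\<lambda>h. norm (y0 + h *\<^sub>R \<gamma> h 0 - y h)) \<in> O[at_right 0](\<lambda>h. h ^ (2 * s + 1))"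
  proof (rule equip_order[OF assms(1,3,4) f lip C _ y nondeg'])
    show "\<forall>\<^sub>F h in at_right 0. \<bar>\<alpha> h\<bar> \<le> K * h\<^sup>2 \<and> equip_system P s c f (gradient C) (\<bullet>) y0 h (\<alpha> h) (\<gamma> h)"
      using sol by (rule eventually_mono) (simp add: unique_equip_solution_def)
  qed (rule inv[rule_format])
next
  fix f :: "real ^ ('d + 'd) \<Rightarrow> real ^ ('d + 'd)" and H :: "real ^ ('d + 'd) \<Rightarrow> real" and y0 y \<alpha> \<gamma> L
  assume f: "real_analytic f" and lip: "L-lipschitz_on UNIV f" and H: "real_analytic H"
    and f_H: "\<forall>x. f x = symplectic_J *v gradient H x" and y: "solves_ivp f y0 y"
    and nondeg: "let f0 = f y0 in second_derivative f y0 f0 f0 \<bullet> (symplectic_J *v f0) \<noteq> 0"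
    and sol: "\<forall>\<^sub>F h in at_right 0.
           unique_equip_solution P s c K f f (\<lambda>u v. u \<bullet> (symplectic_J *v v)) y0 h (\<alpha> h) (\<gamma> h)"
  have fH: "f = (\<lambda>x. symplectic_J *v gradient H x)" using f_H by blast
  note psH = real_analytic_power_series_at[OF H]
  have psg: "power_series_at 0 z (\<lambda>x. gradient H x $ i)" for z i
    unfolding gradient_nth[OF analytic_differentiable[OF psH]] by (rule analytic_partial[OF psH])
  have cont: "continuous_on UNIV (gradient H)"
    using frechet_derivative_nth(1)[OF analytic_differentiable[OF psg]]
    by (intro continuous_at_imp_continuous_on ballI has_derivative_continuous)
  have gauss: "gauss P s c" using assms by unfold_locales
  have "second_derivative f y0 u v = symplectic_J *v second_derivative (gradient H) y0 u v" for u v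
    unfolding fH by (rule second_derivative_matrix_vector_mult[OF psg])
  \<comment> \<open>The second derivative of \<open>f\<close> is J times that of the gradient, so
    orthogonality of J removes it here too.\<close>
  with nondeg have nondeg': "second_derivative (gradient H) y0 (f y0) (f y0) \<bullet> f y0 \<noteq> 0"
    by (simp add: Let_def symplectic_J_inner)
  have sys: "equip_system P s c f f (\<lambda>u v. u \<bullet> (symplectic_J *v v)) y0 h a g \<longleftrightarrow>
      equip_system P s c f (gradient H) (\<bullet>) y0 h a g" for h a g
    unfolding fH by (rule equip_system_hamiltonian[OF gauss cont])
  show "(\<lambda>h. norm (y0 + h *\<^sub>R \<gamma> h 0 - y h)) \<in> O[at_right 0](\<lambda>h. h ^ (2 * s + 1))"
  proof (rule equip_order[OF assms(1,3,4) f lip H _ y nondeg'])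
    show "gradient H x \<bullet> f x = 0" for x
      unfolding f_H[rule_format] by (rule symplectic_J_isotropic)
    show "\<forall>\<^sub>F h in at_right 0. \<bar>\<alpha> h\<bar> \<le> K * h\<^sup>2 \<and> equip_system P s c f (gradient H) (\<bullet>) y0 h (\<alpha> h) (\<gamma> h)"
      using sol by (rule eventually_mono) (simp add: unique_equip_solution_def sys)
  qed
qed

end
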